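(* For $n\ge 2$, a map $Z\colon\mathrm{Conv}_{\mathrm{coe}}(\mathbb{R}^n)\to\mathbb{R}$ is a continuous, $\operatorname{SL}(n)$ and translation invariant valuation such that $$Z(u+t)=e^{-t}Z(u)$$ for every $u\in\mathrm{Conv}_{\mathrm{coe}}(\mathbb{R}^n)$ and $t\in\mathbb{R}$, if and only if there are constants $c_0,c_n\in\mathbb{R}$ such that $$Z(u)=c_0\,e^{-\min_{x\in\mathbb{R}^n}u(x)}+c_n\int_{\mathbb{R}^n}e^{-u(x)}\,\mathrm{d}x$$ for every $u\in\mathrm{Conv}_{\mathrm{coe}}(\mathbb{R}^n)$.
   Context: $\mathrm{Conv}_{\mathrm{coe}}(\mathbb{R}^n)$ is the set of lower semicontinuous, convex functions $u\colon\mathbb{R}^n\to(-\infty,+\infty]$ with $u\not\equiv+\infty$ that are coercive, i.e. $\lim_{|x|\to+\infty}u(x)=+\infty$; such $u$ attains its minimum. Convention: $e^{-u(x)}=0$ if $u(x)=+\infty$. A map $Z$ is a valuation if $Z(u)+Z(v)=Z(u\wedge v)+Z(u\vee v)$ for all $u,v\in\mathrm{Conv}_{\mathrm{coe}}(\mathbb{R}^n)$ such that also the pointwise minimum $u\wedge v$ and the pointwise maximum $u\vee v$ belong to $\mathrm{Conv}_{\mathrm{coe}}(\mathbb{R}^n)$. It is translation invariant if $Z(u\circ\tau^{-1})=Z(u)$ for every $u$ and every translation $\tau$ of $\mathbb{R}^n$, and $\operatorname{SL}(n)$ invariant if $Z(u\circ\vartheta^{-1})=Z(u)$ for every $u$ and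 every $\vartheta\in\operatorname{SL}(n)$. Continuity is with respect to epi-convergence: a sequence $u_k\in\mathrm{Conv}_{\mathrm{coe}}(\mathbb{R}^n)$ epi-converges to $u\in\mathrm{Conv}_{\mathrm{coe}}(\mathbb{R}^n)$ if the sublevel sets $\{u_k\le t\}:=\{x:u_k(x)\le t\}$ converge to $\{u\le t\}$ for every $t\ne\min_{x\in\mathbb{R}^n}u(x)$, where convergence of non-empty compact convex sets is in the Hausdorff metric and a sequence of sets converges to $\varnothing$ if all its members are empty from some index on. Continuity of $Z$ means that $u_k\to u$ implies $Z(u_k)\to Z(u)$. *)

theory Defs
  imports "HOL-Analysis.Analysis"
begin

definition lsc :: "('a::topological_space \<Rightarrow> ereal) \<Rightarrow> bool" where
  "lsc u \<longleftrightarrow> (\<forall>x. u x \<le> Liminf (at x) u)"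

(* The library's convex_on is for real-valued functions only.  For functions with values in
   (-\<infinity>, \<infinity>] the sum on the right never has the form \<infinity> + (-\<infinity>). *)
definition convex_ereal :: "('a::real_vector \<Rightarrow> ereal) \<Rightarrow> bool" where
  "convex_ereal u \<longleftrightarrow> (\<forall>x y. \<forall>l\<in>{0<..<1::real}.
     u ((1 - l) *\<^sub>R x + l *\<^sub>R y) \<le> ereal (1 - l) * u x + ereal l * u y)"

definition coercive :: "('a::real_normed_vector \<Rightarrow> ereal) \<Rightarrow> bool" where
  "coercive u \<longleftrightarrow> (u \<longlongrightarrow> \<infinity>) at_infinity"

definition conv_coe :: "('a::euclidean_space \<Rightarrow> ereal) set" where
  "conv_coe = {u. (\<forall>x. u x \<noteq> -\<infinity>) \<and> (\<exists>x. u x \<noteq> \<infinity>) \<and> lsc u \<and> convex_ereal u \<and> coercive u}"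

(* The least element of the range, which exists for u in conv_coe (see min_value_attained). *)
definition min_value :: "('a \<Rightarrow> ereal) \<Rightarrow> ereal" where
  "min_value u = (LEAST t. t \<in> range u)"

(* exp (-a) for a in (-\<infinity>, \<infinity>]; the value at -\<infinity> is junk and never used. *)
definition exp_neg :: "ereal \<Rightarrow> real" where
  "exp_neg a = (if a = \<infinity> then 0 else exp (- real_of_ereal a))"

definition sublevel :: "('a \<Rightarrow> ereal) \<Rightarrow> real \<Rightarrow> 'a set" where
  "sublevel u t = {x. u x \<le> ereal t}"

(* Meaningful for non-empty bounded sets only; both suprema are then of non-empty sets of reals
   that are bounded above. *)
definition hausdorff_dist :: "'a::metric_space set \<Rightarrow> 'a set \<Rightarrow> real" where
  "hausdorff_dist A B = max (SUP x\<in>A. infdist x B) (SUP y\<in>B. infdist y A)"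

(* Finitely many members may be empty when the limit is not: infdist x {} = 0, so eventual
   non-emptiness has to be required separately. *)
definition set_converges :: "(nat \<Rightarrow> 'a::metric_space set) \<Rightarrow> 'a set \<Rightarrow> bool" where
  "set_converges A B \<longleftrightarrow>
     (if B = {} then \<forall>\<^sub>F k in sequentially. A k = {}
      else (\<forall>\<^sub>F k in sequentially. A k \<noteq> {}) \<and> (\<lambda>k. hausdorff_dist (A k) B) \<longlonglongrightarrow> 0)"

definition epi_converges ::
    "(nat \<Rightarrow> 'a::euclidean_space \<Rightarrow> ereal) \<Rightarrow> ('a \<Rightarrow> ereal) \<Rightarrow> bool" where
  "epi_converges us u \<longleftrightarrow>
     (\<forall>t::real. ereal t \<noteq> min_value u \<longrightarrow> set_converges (\<lambda>k. sublevel (us k) t) (sublevel u t))"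

(* A functional on conv_coe is represented by a function Z on all extended-real-valued functions;
   the notions below only involve its values on conv_coe. *)

definition valuation :: "(('a::euclidean_space \<Rightarrow> ereal) \<Rightarrow> real) \<Rightarrow> bool" where
  "valuation Z \<longleftrightarrow> (\<forall>u\<in>conv_coe. \<forall>v\<in>conv_coe.
     (\<lambda>x. min (u x) (v x)) \<in> conv_coe \<longrightarrow> (\<lambda>x. max (u x) (v x)) \<in> conv_coe \<longrightarrow>
     Z u + Z v = Z (\<lambda>x. min (u x) (v x)) + Z (\<lambda>x. max (u x) (v x)))"

definition translation_invariant :: "(('a::euclidean_space \<Rightarrow> ereal) \<Rightarrow> real) \<Rightarrow> bool" where
  "translation_invariant Z \<longleftrightarrow> (\<forall>u\<in>conv_coe. \<forall>a. Z (u \<circ> inv (\<lambda>x. x + a)) = Z u)"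

definition SL_invariant :: "((real ^ 'n \<Rightarrow> ereal) \<Rightarrow> real) \<Rightarrow> bool" where
  "SL_invariant Z \<longleftrightarrow>
     (\<forall>u\<in>conv_coe. \<forall>A :: real ^ 'n ^ 'n. det A = 1 \<longrightarrow> Z (u \<circ> inv (\<lambda>x. A *v x)) = Z u)"

definition epi_continuous :: "(('a::euclidean_space \<Rightarrow> ereal) \<Rightarrow> real) \<Rightarrow> bool" where
  "epi_continuous Z \<longleftrightarrow> (\<forall>us. \<forall>u\<in>conv_coe. (\<forall>k. us k \<in> conv_coe) \<longrightarrow> epi_converges us u \<longrightarrow>
     (\<lambda>k. Z (us k)) \<longlonglongrightarrow> Z u)"

lemma lsc_open_superlevel:
  assumes "lsc u" shows "open {x. c < u x}"
proof (subst open_subopen, intro ballI)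
  fix x assume "x \<in> {x. c < u x}"
  then have c: "c < u x" by simp
  also have "\<dots> \<le> Liminf (at x) u" using assms by (simp add: lsc_def)
  finally have "\<forall>\<^sub>F y in at x. c < u y" by (rule less_LiminfD)
  then obtain T where "open T" "x \<in> T" "\<forall>y\<in>T. y \<noteq> x \<longrightarrow> c < u y"
    by (auto simp: eventually_at_topological)
  with c show "\<exists>T. open T \<and> x \<in> T \<and> T \<subseteq> {x. c < u x}"
    by (intro exI[of _ T]) auto
qed

lemma min_value_attained:
  fixes u :: "'a::euclidean_space \<Rightarrow> ereal"
  assumes u: "u \<in> conv_coe"
  shows "\<exists>x. u x = min_value u \<and> (\<forall>y. u x \<le> u y)"
proof -
  have "\<exists>x. \<forall>y. u x \<le> u y"
  proof (rule ccontr)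
    assume "\<not> ?thesis"
    then have gt: "\<exists>y. u y < u x" for x by (simp add: not_le)
    from u obtain x0 where x0: "u x0 < \<infinity>" by (auto simp: conv_coe_def)
    from u x0 have "\<forall>\<^sub>F x in at_infinity. u x0 < u x"
      unfolding conv_coe_def coercive_def by (auto dest: order_tendstoD(1))
    then obtain R where R: "\<And>x. R \<le> norm x \<Longrightarrow> u x0 < u x"
      by (auto simp: eventually_at_infinity)
    have op: "open {x. c < u x}" for c
      using u by (intro lsc_open_superlevel) (auto simp: conv_coe_def)
    have cov: "cball 0 R \<subseteq> (\<Union>y\<in>UNIV. {x. u y < u x})" using gt by auto
    have "compact (cball (0::'a) R)" by simp
    from compactE_image[OF this op cov] obtain C where C: "finite C"
      "cball 0 R \<subseteq> (\<Union>y\<in>C. {x. u y < u x})" by auto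
    define m where "m = Min (u ` insert x0 C)"
    have le: "m \<le> u y" if "y \<in> insert x0 C" for y
      unfolding m_def using C(1) that by (intro Min_le) auto
    have "m \<in> u ` insert x0 C" unfolding m_def using C(1) by (intro Min_in) auto
    then obtain z where z: "m = u z" by auto
    show False
    proof (cases "z \<in> cball 0 R")
      case True
      with C(2) obtain y where "y \<in> C" "u y < u z" by auto
      with le[of y] z show False by auto
    next
      case False
      with R[of z] le[of x0] z show False by auto
    qed
  qed
  then obtain x where x: "\<forall>y. u x \<le> u y" by auto
  then have "min_value u = u x"
    unfolding min_value_def by (intro Least_equality) auto
  with x show ?thesis by auto
qed

end

theory Submission
  imports Defs
begin

text \<open>
A functional with the five properties is called \<^emph>\<open>admissible\<close> below; the admissible functionals form
a vector space.  The two functionals \<open>u \<mapsto> exp (- min u)\<close> and \<open>u \<mapsto> \<integral> exp (- u)\<close> are admissible.  For the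
minimum the valuation identity holds because two closed sublevel sets that cover a convex set must
meet.  For the integral the identity holds pointwise under the integral sign, and continuity is
dominated convergence: an epi-convergent sequence has a common linear lower bound
(\<open>uniform_linear_growth\<close>) and converges off the boundary of the domain of its limit
(\<open>epi_converges_AE\<close>).

For the converse, let \<open>w\<^sub>J\<close> be the function that is \<open>\<Sum>i. t\<^sub>i\<close> on the face of the positive orthant
spanned by the coordinates in \<open>J\<close>, and \<open>\<infinity>\<close> elsewhere.  Subtracting from \<open>Z\<close> a combination of the two
functionals gives an admissible \<open>D\<close> that is zero at \<open>w\<close> for \<open>J = {}\<close> (the indicator of the origin) and
for the full orthant.  It remains to show that such a \<open>D\<close> is zero.

\<^item> \<^emph>\<open>Cones\<close> (\<open>admissible_zero_on_cones\<close>).  Up to \<open>SL(n)\<close>, a linear function on a full-dimensional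
simplicial cone is determined by one number \<open>d > 0\<close>, the determinant of the generators on which it
takes the value one.  Cutting the cone in two makes \<open>D\<close> an additive function of \<open>d\<close>; as \<open>d\<close> tends to
zero the functions become steep and epi-converge to the indicator of the origin, so this function
is continuous at zero, hence linear, hence zero.  For a lower-dimensional cone the determinant can
be absorbed by a free direction, so there \<open>D\<close> is even constant.

\<^item> \<^emph>\<open>Polytopes\<close> (\<open>admissible_generic_cell\<close>, \<open>admissible_polytope\<close>).  Let an affine function \<open>a\<close> be
given on a polyhedron \<open>P\<close> cut out by hyperplanes in general position.  Its minimum is attained at a
vertex, where \<open>P\<close> looks like a simplicial cone \<open>C\<close>, and \<open>D\<close> vanishes for \<open>a\<close> on \<open>C\<close>.  Cutting \<open>C\<close> by
the remaining hyperplanes, one at a time, turns it into \<open>P\<close>; each part that is cut off avoids the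
vertex, so the minimum of \<open>a\<close> is larger there, and induction on the minimum applies.  Any
polytope is a limit of polytopes in general position.

\<^item> \<^emph>\<open>Piecewise affine functions\<close> (\<open>admissible_polytope_max_affine\<close>).  A maximum of finitely many
affine functions on a polytope becomes affine after cutting along the hyperplanes on which two of
them agree.

\<^item> \<^emph>\<open>Approximation\<close> (\<open>admissible_vanishes\<close>).  Every function in \<open>conv_coe\<close> is the supremum of
countably many affine functions, and finite maxima of these, restricted to growing cubes,
epi-converge to it.
\<close>

section \<open>Coercive convex functions\<close>

lemma lscI_open:
  assumes "\<And>c. open {x. c < u x}"
  shows "lsc u"
  unfolding lsc_def
proof (intro allI)
  fix x show "u x \<le> Liminf (at x) u"
  proof (subst le_Liminf_iff, intro allI impI)
    fix y assume "y < u x"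
    then show "\<forall>\<^sub>F z in at x. y < u z"
      using assms[of y] unfolding eventually_at_topological by blast
  qed
qed

lemma conv_coeI:
  fixes u :: "'a::euclidean_space \<Rightarrow> ereal"
  assumes "\<And>x. u x \<noteq> -\<infinity>" "u x0 \<noteq> \<infinity>" "\<And>c. open {x. c < u x}" "convex_ereal u"
    and b: "\<And>t. bounded (sublevel u t)"
  shows "u \<in> conv_coe"
proof -
  have "coercive u"
    unfolding coercive_def tendsto_PInfty
  proof
    fix r
    obtain B where B: "\<And>x. u x \<le> ereal r \<Longrightarrow> norm x \<le> B"
      using b[of r] unfolding bounded_iff sublevel_def by blast
    show "\<forall>\<^sub>F x in at_infinity. ereal r < u x"
      unfolding eventually_at_infinity
    proof (intro exI[of _ "B+1"] allI impI)
      fix x :: 'a assume "B + 1 \<le> norm x"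
      then show "ereal r < u x" using B[of x] by (force simp: not_le[symmetric])
    qed
  qed
  with assms lscI_open[of u] show ?thesis by (auto simp: conv_coe_def)
qed

definition extended :: "'a set \<Rightarrow> ('a \<Rightarrow> real) \<Rightarrow> 'a \<Rightarrow> ereal" where
  "extended K f x = (if x \<in> K then ereal (f x) else \<infinity>)"

lemma extended_in_conv_coe:
  fixes f :: "'a::euclidean_space \<Rightarrow> real"
  assumes K: "closed K" "convex K" "K \<noteq> {}"
    and f: "convex_on K f" "continuous_on K f"
    and b: "\<And>t. bounded {x\<in>K. f x \<le> t}"
  shows "extended K f \<in> conv_coe"
proof -
  have op: "open {x. c < extended K f x}" for c
  proof (cases c)
    case (real r)
    have "closed (K \<inter> f -` {..r})"
      by (rule continuous_closed_preimage[OF f(2) K(1)]) auto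
    moreover have "{x. c < extended K f x} = - (K \<inter> f -` {..r})"
      by (auto simp: extended_def real)
    ultimately show ?thesis by (metis open_Compl)
  next
    case MInf
    then have "{x. c < extended K f x} = UNIV" by (auto simp: extended_def)
    then show ?thesis by simp
  next
    case PInf
    then have "{x. c < extended K f x} = {}" by (auto simp: extended_def)
    then show ?thesis by simp
  qed
  have 2: "convex_ereal (extended K f)"
    unfolding convex_ereal_def
  proof (intro allI ballI)
    fix x y :: 'a and l :: real assume l: "l \<in> {0<..<1}"
    show "extended K f ((1 - l) *\<^sub>R x + l *\<^sub>R y)
        \<le> ereal (1 - l) * extended K f x + ereal l * extended K f y"
    proof (cases "x \<in> K \<and> y \<in> K")
      case True
      have "(1 - l) *\<^sub>R x + l *\<^sub>R y \<in> K"
        using K(2) True l by (auto simp: convex_alt)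
      moreover have "f ((1 - l) *\<^sub>R x + l *\<^sub>R y) \<le> (1 - l) * f x + l * f y"
        using convex_onD[OF f(1), of l x y] True l by auto
      ultimately show ?thesis using True by (simp add: extended_def)
    next
      case False
      then have "ereal (1 - l) * extended K f x + ereal l * extended K f y = \<infinity>"
        using l by (auto simp: extended_def)
      then show ?thesis by (metis ereal_less_eq(1))
    qed
  qed
  obtain x0 where "x0 \<in> K" using K(3) by blast
  show ?thesis
  proof (rule conv_coeI[OF _ _ op 2])
    show "extended K f x0 \<noteq> \<infinity>" using \<open>x0 \<in> K\<close> by (simp add: extended_def)
    have "sublevel (extended K f) t = {x\<in>K. f x \<le> t}" for t
      by (auto simp: sublevel_def extended_def)
    then show "bounded (sublevel (extended K f) t)" for t using b by simp
  qed (simp add: extended_def)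
qed

lemma convex_on_affine_fun:
  fixes s :: real
  assumes "convex K" shows "convex_on K (\<lambda>x. y \<bullet> x + s)"
proof (rule convex_onI)
  fix t :: real and x z
  have "y \<bullet> ((1 - t) *\<^sub>R x + t *\<^sub>R z) + s = (1 - t) * (y \<bullet> x + s) + t * (y \<bullet> z + s)"
    unfolding inner_add_right inner_scaleR_right by algebra
  then show "y \<bullet> ((1 - t) *\<^sub>R x + t *\<^sub>R z) + s \<le> (1 - t) * (y \<bullet> x + s) + t * (y \<bullet> z + s)"
    by simp
qed (rule assms)

lemma extended_affine_conv_coe:
  fixes K :: "'a::euclidean_space set"
  assumes "closed K" "convex K" "K \<noteq> {}" "\<And>t. bounded {x\<in>K. y \<bullet> x + s \<le> t}"
  shows "extended K (\<lambda>x. y \<bullet> x + s) \<in> conv_coe"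
  by (rule extended_in_conv_coe[OF assms(1-3) convex_on_affine_fun[OF assms(2)] _ assms(4)])
    (intro continuous_intros)

lemma min_value_real:
  fixes u :: "'a::euclidean_space \<Rightarrow> ereal"
  assumes "u \<in> conv_coe"
  obtains m x0 where "min_value u = ereal m" "u x0 = ereal m" "\<And>y. ereal m \<le> u y"
proof -
  obtain x where x: "u x = min_value u" "\<And>y. u x \<le> u y"
    using min_value_attained[OF assms] by auto
  have "u x \<noteq> \<infinity>" using assms x(2) by (force simp: conv_coe_def)
  moreover have "u x \<noteq> -\<infinity>" using assms by (auto simp: conv_coe_def)
  ultimately obtain m where "u x = ereal m" by (cases "u x") auto
  with x that[of m x] show ?thesis by auto
qed

lemma min_value_le:
  fixes u :: "'a::euclidean_space \<Rightarrow> ereal"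
  assumes "u \<in> conv_coe" shows "min_value u \<le> u y"
  using min_value_attained[OF assms] by auto

lemma min_value_eqI: "u x = m \<Longrightarrow> (\<And>y. m \<le> u y) \<Longrightarrow> min_value u = m"
  unfolding min_value_def by (intro Least_equality) auto

lemma convex_sublevel:
  assumes "u \<in> conv_coe"
  shows "convex (sublevel u t)"
  unfolding convex_alt
proof (intro ballI allI impI)
  fix x y l assume x: "x \<in> sublevel u t" and y: "y \<in> sublevel u t" and l: "0 \<le> l \<and> l \<le> (1::real)"
  show "(1 - l) *\<^sub>R x + l *\<^sub>R y \<in> sublevel u t"
  proof (cases "l = 0 \<or> l = 1")
    case False
    with l have l: "0 < l" "l < 1" by auto
    have cv: "convex_ereal u" using assms by (simp add: conv_coe_def)
    obtain a b where ab: "u x = ereal a" "u y = ereal b" "a \<le> t" "b \<le> t"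
      using assms x y unfolding conv_coe_def sublevel_def
      by (cases "u x"; cases "u y") auto
    have "u ((1 - l) *\<^sub>R x + l *\<^sub>R y) \<le> ereal (1 - l) * u x + ereal l * u y"
      using cv l unfolding convex_ereal_def by auto
    also have "\<dots> = ereal ((1 - l) * a + l * b)" using ab by simp
    also have "\<dots> \<le> ereal t"
    proof -
      have "(1 - l) * a + l * b \<le> (1 - l) * t + l * t"
        using ab l by (intro add_mono mult_left_mono) auto
      then show ?thesis by (simp add: algebra_simps)
    qed
    finally show ?thesis by (simp add: sublevel_def)
  qed (use x y in auto)
qed

lemma compact_sublevel:
  fixes u :: "'a::euclidean_space \<Rightarrow> ereal"
  assumes "u \<in> conv_coe"
  shows "compact (sublevel u t)"
proof -
  have "open {x. ereal t < u x}" using assms by (intro lsc_open_superlevel) (simp add: conv_coe_def)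
  moreover have "sublevel u t = - {x. ereal t < u x}" by (auto simp: sublevel_def)
  ultimately have "closed (sublevel u t)" by (metis closed_Compl)
  moreover have "bounded (sublevel u t)"
  proof -
    from assms have "\<forall>\<^sub>F x in at_infinity. ereal t < u x"
      unfolding conv_coe_def coercive_def by (auto simp: tendsto_PInfty)
    then obtain R where R: "\<And>x. R \<le> norm x \<Longrightarrow> ereal t < u x"
      by (auto simp: eventually_at_infinity)
    show ?thesis unfolding bounded_iff sublevel_def
    proof (intro exI[of _ R] ballI)
      fix x assume "x \<in> {x. u x \<le> ereal t}"
      then show "norm x \<le> R" using R[of x] by (cases "R \<le> norm x") auto
    qed
  qed
  ultimately show ?thesis by (simp add: compact_eq_bounded_closed)
qed

lemma sublevel_eq_empty_iff:
  fixes u :: "'a::euclidean_space \<Rightarrow> ereal"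
  assumes "u \<in> conv_coe"
  shows "sublevel u t = {} \<longleftrightarrow> ereal t < min_value u"
  using min_value_attained[OF assms] unfolding sublevel_def
  by (auto simp: not_le intro: less_le_trans) (metis leD leI)

text \<open>Moving towards a minimiser lowers the value strictly, by convexity.  This is what fails at the level
\<open>t = min u\<close>, the one excluded from the definition of epi-convergence.\<close>

lemma dense_strict_sublevel:
  fixes u :: "'a::euclidean_space \<Rightarrow> ereal"
  assumes "u \<in> conv_coe" "min_value u < ereal t" "y \<in> sublevel u t" "0 < e"
  shows "\<exists>z\<in>ball y e. u z < ereal t"
proof -
  obtain m x0 where m: "min_value u = ereal m" "u x0 = ereal m"
    using min_value_real[OF assms(1)] by metis
  define l where "l = min (1/2) (e / (2 * (norm (x0 - y) + 1)))"
  have l: "0 < l" "l < 1" using assms(4) by (auto simp: l_def add_nonneg_pos)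
  obtain a where a: "u y = ereal a" "a \<le> t"
    using assms(1,3) unfolding conv_coe_def sublevel_def by (cases "u y") auto
  let ?z = "(1 - l) *\<^sub>R y + l *\<^sub>R x0"
  have "u ?z \<le> ereal (1 - l) * u y + ereal l * u x0"
    using assms(1) l unfolding conv_coe_def convex_ereal_def by auto
  also have "\<dots> = ereal ((1 - l) * a + l * m)" using a m by simp
  also have "\<dots> < ereal t"
  proof -
    have "(1 - l) * a + l * m < (1 - l) * t + l * t"
      using a m l assms(2) by (intro add_le_less_mono mult_left_mono mult_strict_left_mono) auto
    then show ?thesis by (simp add: algebra_simps)
  qed
  finally have "u ?z < ereal t" .
  moreover have "dist y ?z < e"
  proof -
    have "y - ?z = l *\<^sub>R (y - x0)" by (simp add: algebra_simps)
    then have "dist y ?z = l * norm (x0 - y)"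
      using l by (simp add: dist_norm norm_minus_commute)
    also have "\<dots> \<le> e / (2 * (norm (x0 - y) + 1)) * norm (x0 - y)"
      by (intro mult_right_mono) (auto simp: l_def)
    also have "\<dots> < e"
    proof -
      have "0 < norm (x0 - y) + 1" by (simp add: add_nonneg_pos)
      moreover have "norm (x0 - y) * e < (2 * (norm (x0 - y) + 1)) * e"
        using assms(4) \<open>0 < norm (x0 - y) + 1\<close> norm_ge_zero[of "x0 - y"]
        by (intro mult_strict_right_mono) (auto simp del: norm_ge_zero)
      ultimately show ?thesis by (simp add: divide_simps mult.commute)
    qed
    finally show ?thesis .
  qed
  ultimately show ?thesis by auto
qed

text \<open>The inverse \<open>h\<close> is there to carry the compact sublevel sets of \<open>u\<close> to those of \<open>u \<circ> g\<close>.\<close>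

lemma conv_coe_comp_affine:
  fixes u :: "'a::euclidean_space \<Rightarrow> ereal"
  assumes u: "u \<in> conv_coe" and cont: "continuous_on UNIV g" "continuous_on UNIV h"
    and g: "\<And>l x y. g ((1 - l) *\<^sub>R x + l *\<^sub>R y) = (1 - l) *\<^sub>R g x + l *\<^sub>R g y"
    and gh: "\<And>x. g (h x) = x" "\<And>x. h (g x) = x"
  shows "(\<lambda>x. u (g x)) \<in> conv_coe"
proof -
  obtain x0 where x0: "u x0 \<noteq> \<infinity>" using u by (auto simp: conv_coe_def)
  show ?thesis
  proof (rule conv_coeI[where ?x0.0 = "h x0"])
    show "u (g x) \<noteq> -\<infinity>" for x using u by (auto simp: conv_coe_def)
    show "u (g (h x0)) \<noteq> \<infinity>" using x0 by (simp add: gh)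
    show "open {x. c < u (g x)}" for c
    proof -
      have "open {x. c < u x}" using u by (intro lsc_open_superlevel) (simp add: conv_coe_def)
      then have "open (g -` {x. c < u x})" by (intro open_vimage cont)
      then show ?thesis by (simp add: vimage_def)
    qed
    show "convex_ereal (\<lambda>x. u (g x))"
      using u by (simp add: conv_coe_def convex_ereal_def g)
    have "sublevel (\<lambda>x. u (g x)) t = h ` sublevel u t" for t
      unfolding sublevel_def image_def using gh by auto
    then show "bounded (sublevel (\<lambda>x. u (g x)) t)" for t
      using compact_continuous_image[OF continuous_on_subset[OF cont(2)] compact_sublevel[OF u, of t]]
      by (simp add: compact_imp_bounded)
  qed
qed

lemma conv_coe_translate:
  fixes u :: "'a::euclidean_space \<Rightarrow> ereal"
  assumes "u \<in> conv_coe"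
  shows "(\<lambda>x. u (x - v)) \<in> conv_coe"
  by (rule conv_coe_comp_affine[OF assms, of _ "\<lambda>x. x + v"])
    (auto intro!: continuous_intros simp: algebra_simps)

lemma conv_coe_add_const:
  fixes u :: "'a::euclidean_space \<Rightarrow> ereal"
  assumes u: "u \<in> conv_coe"
  shows "(\<lambda>x. u x + ereal t) \<in> conv_coe"
proof -
  obtain x0 where x0: "u x0 \<noteq> \<infinity>" using u by (auto simp: conv_coe_def)
  have less: "c < u x + ereal t \<longleftrightarrow> c - ereal t < u x" for c x
    by (cases "u x"; cases c) (auto simp: field_simps)
  show ?thesis
  proof (rule conv_coeI[where ?x0.0 = x0])
    show "u x + ereal t \<noteq> -\<infinity>" for x using u by (simp add: conv_coe_def)
    show "u x0 + ereal t \<noteq> \<infinity>" using x0 by simp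
    show "open {x. c < u x + ereal t}" for c
      unfolding less using u by (intro lsc_open_superlevel) (simp add: conv_coe_def)
    show "convex_ereal (\<lambda>x. u x + ereal t)"
      unfolding convex_ereal_def
    proof (intro allI ballI)
      fix x y :: 'a and l :: real assume l: "l \<in> {0<..<1}"
      have "u ((1 - l) *\<^sub>R x + l *\<^sub>R y) \<le> ereal (1 - l) * u x + ereal l * u y"
        using u l unfolding conv_coe_def convex_ereal_def by auto
      then have "u ((1 - l) *\<^sub>R x + l *\<^sub>R y) + ereal t \<le> ereal (1 - l) * u x + ereal l * u y + ereal t"
        by (rule add_right_mono)
      also have "\<dots> = ereal (1 - l) * (u x + ereal t) + ereal l * (u y + ereal t)"
        using l u by (cases "u x"; cases "u y") (auto simp: conv_coe_def algebra_simps)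
      finally show "u ((1 - l) *\<^sub>R x + l *\<^sub>R y) + ereal t
        \<le> ereal (1 - l) * (u x + ereal t) + ereal l * (u y + ereal t)" .
    qed
    have "sublevel (\<lambda>x. u x + ereal t) s = sublevel u (s - t)" for s
    proof -
      have "u x + ereal t \<le> ereal s \<longleftrightarrow> u x \<le> ereal (s - t)" for x by (cases "u x") auto
      then show ?thesis by (simp add: sublevel_def)
    qed
    then show "bounded (sublevel (\<lambda>x. u x + ereal t) s)" for s
      using compact_sublevel[OF u] by (simp add: compact_imp_bounded)
  qed
qed

lemma obtain_matrix_inverse:
  fixes A :: "real^'n^'n"
  assumes "det A \<noteq> 0"
  obtains B where "A ** B = mat 1" "B ** A = mat 1" "inv ((*v) A) = (*v) B"
proof -
  obtain B where B: "A ** B = mat 1" "B ** A = mat 1"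
    using assms by (auto simp: invertible_det_nz[symmetric] invertible_def)
  then have "inv ((*v) A) = (*v) B"
    by (intro inv_equality) (simp_all add: matrix_vector_mul_assoc)
  with B show ?thesis by (rule that)
qed

lemma conv_coe_comp_matrix:
  fixes B :: "real^'n^'n"
  assumes "u \<in> conv_coe" "det B \<noteq> 0"
  shows "(\<lambda>x. u (B *v x)) \<in> conv_coe"
proof -
  obtain A where A: "B ** A = mat 1" "A ** B = mat 1" by (rule obtain_matrix_inverse[OF assms(2)])
  show ?thesis
    by (rule conv_coe_comp_affine[OF assms(1), of _ "(*v) A"])
      (auto intro!: matrix_vector_mult_linear_continuous_on
        simp: matrix_vector_mul_assoc A matrix_vector_right_distrib matrix_vector_mult_scaleR)
qed

section \<open>Epi-convergence\<close>

lemma infdist_le_hausdorff_dist: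
  fixes A B :: "'a::euclidean_space set"
  assumes "bounded A" "bounded B"
  shows "x \<in> A \<Longrightarrow> infdist x B \<le> hausdorff_dist A B"
    and "y \<in> B \<Longrightarrow> infdist y A \<le> hausdorff_dist A B"
proof -
  have *: "bdd_above ((\<lambda>x. infdist x T) ` S)" if "bounded S" for S T :: "'a set"
  proof -
    have "compact ((\<lambda>x. infdist x T) ` closure S)"
      using that by (intro compact_continuous_image continuous_intros) (simp add: compact_closure)
    then have "bdd_above ((\<lambda>x. infdist x T) ` closure S)"
      by (intro bounded_imp_bdd_above compact_imp_bounded)
    then show ?thesis by (rule bdd_above_mono) (intro image_mono closure_subset)
  qed
  show "infdist x B \<le> hausdorff_dist A B" if "x \<in> A"
    unfolding hausdorff_dist_def using cSUP_upper[OF that *[OF assms(1), of B]] by simp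
  show "infdist y A \<le> hausdorff_dist A B" if "y \<in> B"
    unfolding hausdorff_dist_def using cSUP_upper[OF that *[OF assms(2), of A]] by simp
qed

lemma hausdorff_dist_leI:
  assumes "A \<noteq> {}" "B \<noteq> {}" "\<And>x. x \<in> A \<Longrightarrow> infdist x B \<le> e" "\<And>y. y \<in> B \<Longrightarrow> infdist y A \<le> e"
  shows "hausdorff_dist A B \<le> e"
  unfolding hausdorff_dist_def using assms by (auto intro!: cSUP_least)

lemma hausdorff_dist_nonneg:
  fixes A B :: "'a::euclidean_space set"
  assumes "bounded A" "bounded B" "A \<noteq> {}"
  shows "0 \<le> hausdorff_dist A B"
proof -
  obtain x where "x \<in> A" using assms by auto
  then show ?thesis using infdist_le_hausdorff_dist(1)[OF assms(1,2), of x] infdist_nonneg[of x B] by linarith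
qed

text \<open>The lower half of epi-convergence in local form (a liminf inequality along all sequences of
points) becomes uniform on compact sets.\<close>

lemma eventually_superlevel_compact:
  fixes us :: "nat \<Rightarrow> 'a::euclidean_space \<Rightarrow> ereal"
  assumes low: "\<And>x t. ereal t < u x \<Longrightarrow>
      \<exists>N. open N \<and> x \<in> N \<and> (\<forall>\<^sub>F k in sequentially. \<forall>y\<in>N. ereal t < us k y)"
    and K: "compact K" "\<And>x. x \<in> K \<Longrightarrow> ereal t < u x"
  shows "\<forall>\<^sub>F k in sequentially. \<forall>y\<in>K. ereal t < us k y"
proof -
  have "\<forall>x\<in>K. \<exists>N. open N \<and> x \<in> N \<and> (\<forall>\<^sub>F k in sequentially. \<forall>y\<in>N. ereal t < us k y)"
    using low K(2) by blast
  then obtain N where N: "\<And>x. x \<in> K \<Longrightarrow> open (N x)" "\<And>x. x \<in> K \<Longrightarrow> x \<in> N x"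
    "\<And>x. x \<in> K \<Longrightarrow> \<forall>\<^sub>F k in sequentially. \<forall>y\<in>N x. ereal t < us k y"
    by metis
  have "K \<subseteq> (\<Union>x\<in>K. N x)" using N(2) by blast
  from compactE_image[OF K(1) N(1) this] obtain C where C: "C \<subseteq> K" "finite C" "K \<subseteq> (\<Union>x\<in>C. N x)"
    by metis
  have "\<forall>\<^sub>F k in sequentially. \<forall>x\<in>C. \<forall>y\<in>N x. ereal t < us k y"
    using C N(3) by (intro eventually_ball_finite) auto
  then show ?thesis by eventually_elim (use C(3) in blast)
qed

text \<open>The hypotheses are the usual two halves of epi-convergence: a liminf inequality, and recovery
sequences.  That the sublevel sets are then uniformly bounded is due to convexity.  On a large sphere
around a minimiser of \<open>u\<close> the functions exceed a level \<open>T\<close>, by compactness, while they are below \<open>T\<close>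
somewhere inside; a point below \<open>T\<close> outside the sphere would force a value below \<open>T\<close> on the sphere.\<close>

lemma epi_convergesI:
  fixes us :: "nat \<Rightarrow> 'a::euclidean_space \<Rightarrow> ereal"
  assumes us: "\<And>k. us k \<in> conv_coe" and u: "u \<in> conv_coe"
    and low: "\<And>x t. ereal t < u x \<Longrightarrow>
      \<exists>N. open N \<and> x \<in> N \<and> (\<forall>\<^sub>F k in sequentially. \<forall>y\<in>N. ereal t < us k y)"
    and upp: "\<And>x t e. u x < ereal t \<Longrightarrow> 0 < e \<Longrightarrow>
      \<forall>\<^sub>F k in sequentially. \<exists>y\<in>ball x e. us k y \<le> ereal t"
  shows "epi_converges us u"
proof -
  note compact = eventually_superlevel_compact[of u us, OF low]
  obtain m x0 where m: "min_value u = ereal m" "u x0 = ereal m" "\<And>y. ereal m \<le> u y"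
    using min_value_real[OF u] by metis
  have bounded: "\<exists>R>0. \<forall>\<^sub>F k in sequentially. sublevel (us k) t \<subseteq> cball x0 R" for t
  proof -
    define T where "T = max t (m + 1)"
    obtain R where R: "0 < R" "\<And>x. x \<in> sublevel u T \<Longrightarrow> dist x0 x < R"
      using compact_imp_bounded[OF compact_sublevel[OF u, of T]]
      by (metis bounded_subset_ballD mem_ball subsetD)
    have "\<forall>\<^sub>F k in sequentially. \<forall>y\<in>sphere x0 R. ereal T < us k y"
    proof (rule compact)
      fix x assume "x \<in> sphere x0 R"
      then show "ereal T < u x" using R(2)[of x] by (force simp: sublevel_def)
    qed (auto)
    moreover have "\<forall>\<^sub>F k in sequentially. \<exists>y\<in>ball x0 R. us k y \<le> ereal T"
    proof (rule upp)
      have "m < T" by (auto simp: T_def)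
      then show "u x0 < ereal T" by (simp add: m)
    qed (rule R)
    ultimately have "\<forall>\<^sub>F k in sequentially. sublevel (us k) t \<subseteq> cball x0 R"
    proof eventually_elim
      case (elim k)
      then obtain z where z: "z \<in> ball x0 R" "us k z \<le> ereal T" by auto
      show ?case
      proof
        fix x assume x: "x \<in> sublevel (us k) t"
        show "x \<in> cball x0 R"
        proof (rule ccontr)
          assume nx: "x \<notin> cball x0 R"
          have "closed_segment z x \<inter> frontier (ball x0 R) \<noteq> {}"
            by (rule connected_Int_frontier) (use z nx in auto)
          then obtain y where y: "y \<in> closed_segment z x" "y \<in> sphere x0 R"
            using R(1) by (metis disjoint_iff frontier_ball)
          have "t \<le> T" by (simp add: T_def)
          then have "x \<in> sublevel (us k) T" "z \<in> sublevel (us k) T"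
            using x z by (auto simp: sublevel_def elim: order_trans)
          then have "closed_segment z x \<subseteq> sublevel (us k) T"
            by (intro closed_segment_subset convex_sublevel us)
          with y elim(1) show False by (force simp: sublevel_def)
        qed
      qed
    qed
    with R(1) show ?thesis by blast
  qed
  show ?thesis unfolding epi_converges_def
  proof (intro allI impI)
    fix t assume t: "ereal t \<noteq> min_value u"
    obtain R where R: "\<forall>\<^sub>F k in sequentially. sublevel (us k) t \<subseteq> cball x0 R"
      using bounded by blast
    show "set_converges (\<lambda>k. sublevel (us k) t) (sublevel u t)"
    proof (cases "t < m")
      case True
      then have e: "sublevel u t = {}" using sublevel_eq_empty_iff[OF u] m by auto
      have "\<forall>\<^sub>F k in sequentially. \<forall>y\<in>cball x0 R. ereal t < us k y"
        using True m(3) by (intro compact) (auto intro: less_le_trans[of _ "ereal m"])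
      with R have "\<forall>\<^sub>F k in sequentially. sublevel (us k) t = {}"
        by eventually_elim (force simp: sublevel_def)
      with e show ?thesis by (simp add: set_converges_def)
    next
      case False
      with t m have tm: "m < t" by auto
      let ?B = "sublevel u t"
      have ne: "?B \<noteq> {}" using sublevel_eq_empty_iff[OF u] m tm by auto
      have ne': "\<forall>\<^sub>F k in sequentially. sublevel (us k) t \<noteq> {}"
        using upp[of x0 t 1] m tm by (auto simp: sublevel_def elim!: eventually_mono)
      have "\<forall>\<^sub>F k in sequentially. hausdorff_dist (sublevel (us k) t) ?B \<le> e" if "0 < e" for e
      proof -
        have 1: "\<forall>\<^sub>F k in sequentially. \<forall>y\<in>cball x0 R \<inter> {y. e \<le> infdist y ?B}. ereal t < us k y"
        proof (rule compact)
          have "closed {y. e \<le> infdist y ?B}"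
            by (intro closed_Collect_le continuous_intros)
          then show "Topological_Spaces.compact (cball x0 R \<inter> {y. e \<le> infdist y ?B})"
            by (intro compact_Int_closed) auto
          fix x assume "x \<in> cball x0 R \<inter> {y. e \<le> infdist y ?B}"
          then have "x \<notin> ?B" using \<open>0 < e\<close> by auto
          then show "ereal t < u x" by (auto simp: sublevel_def)
        qed
        have "?B \<subseteq> (\<Union>y\<in>?B. ball y (e/3))" using \<open>0 < e\<close> by force
        from compactE_image[OF compact_sublevel[OF u] _ this]
        obtain C where C: "C \<subseteq> ?B" "finite C" "?B \<subseteq> (\<Union>y\<in>C. ball y (e/3))" by auto
        have "\<forall>\<^sub>F k in sequentially. \<exists>z\<in>ball y (2*e/3). z \<in> sublevel (us k) t" if "y \<in> C" for y
        proof -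
          obtain z where z: "z \<in> ball y (e/3)" "u z < ereal t"
            using dense_strict_sublevel[OF u, of t y "e/3"] tm m(1) subsetD[OF C(1) \<open>y \<in> C\<close>] \<open>0 < e\<close>
            by auto
          have "\<forall>\<^sub>F k in sequentially. \<exists>w\<in>ball z (e/3). us k w \<le> ereal t"
            using upp[of z t "e/3"] z \<open>0 < e\<close> by auto
          then show ?thesis
          proof eventually_elim
            case (elim k)
            then obtain w where w: "w \<in> ball z (e/3)" "us k w \<le> ereal t" by auto
            then have "dist y w < 2*e/3"
              using z(1) dist_triangle[of y w z] by auto
            with w show ?case by (auto simp: sublevel_def)
          qed
        qed
        then have 2: "\<forall>\<^sub>F k in sequentially. \<forall>y\<in>C. \<exists>z\<in>ball y (2*e/3). z \<in> sublevel (us k) t"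
          using C by (intro eventually_ball_finite) auto
        from 1 2 R ne' show ?thesis
        proof eventually_elim
          case (elim k)
          show ?case
          proof (rule hausdorff_dist_leI)
            fix x assume "x \<in> sublevel (us k) t"
            with elim(1,3) show "infdist x ?B \<le> e"
              by (force simp: sublevel_def not_le[symmetric])
          next
            fix y assume "y \<in> ?B"
            then obtain c where c: "c \<in> C" "dist c y < e/3" using C(3) by auto
            then obtain z where z: "dist c z < 2*e/3" "z \<in> sublevel (us k) t" using elim(2) by force
            have "infdist y (sublevel (us k) t) \<le> dist y z" by (rule infdist_le[OF z(2)])
            also have "\<dots> \<le> e" using c z dist_triangle[of y z c] by (simp add: dist_commute)
            finally show "infdist y (sublevel (us k) t) \<le> e" .
          qed (use ne elim in auto)
        qed
      qed
      moreover have "0 \<le> hausdorff_dist (sublevel (us k) t) ?B" if "sublevel (us k) t \<noteq> {}" for k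
        by (intro hausdorff_dist_nonneg compact_imp_bounded compact_sublevel us u that)
      then have "\<forall>\<^sub>F k in sequentially. 0 \<le> hausdorff_dist (sublevel (us k) t) ?B"
        using ne' by (rule eventually_mono[rotated])
      ultimately have "(\<lambda>k. hausdorff_dist (sublevel (us k) t) ?B) \<longlonglongrightarrow> 0"
      proof -
        assume A: "\<And>e. 0 < e \<Longrightarrow> \<forall>\<^sub>F k in sequentially. hausdorff_dist (sublevel (us k) t) ?B \<le> e"
          and B: "\<forall>\<^sub>F k in sequentially. 0 \<le> hausdorff_dist (sublevel (us k) t) ?B"
        show ?thesis
        proof (rule tendstoI)
          fix e :: real assume "0 < e"
          then have "\<forall>\<^sub>F k in sequentially. hausdorff_dist (sublevel (us k) t) ?B \<le> e/2" using A[of "e/2"] \<open>0 < e\<close> by simp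
          with B show "\<forall>\<^sub>F k in sequentially. dist (hausdorff_dist (sublevel (us k) t) ?B) 0 < e"
            by eventually_elim (use \<open>0 < e\<close> in auto)
        qed
      qed
      with ne ne' show ?thesis by (simp add: set_converges_def)
    qed
  qed
qed

lemma epi_converges_const:
  fixes u :: "'a::euclidean_space \<Rightarrow> ereal"
  assumes "u \<in> conv_coe" shows "epi_converges (\<lambda>_. u) u"
proof (rule epi_convergesI)
  fix x t assume "ereal t < u x"
  then show "\<exists>N. open N \<and> x \<in> N \<and> (\<forall>\<^sub>F k in sequentially. \<forall>y\<in>N. ereal t < u y)"
    using assms lsc_open_superlevel[of u "ereal t"] by (intro exI[of _ "{x. ereal t < u x}"]) (auto simp: conv_coe_def)
next
  fix x t and e :: real assume "u x < ereal t" "0 < e"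
  then show "\<forall>\<^sub>F k in sequentially. \<exists>y\<in>ball x e. u y \<le> ereal t"
    by (intro always_eventually allI bexI[of _ x]) auto
qed (use assms in auto)

text \<open>A point outside a compact sublevel set of the limit keeps a positive distance from it.\<close>

lemma epi_converges_pointwise_lower:
  fixes u :: "'a::euclidean_space \<Rightarrow> ereal"
  assumes us: "\<And>k. us k \<in> conv_coe" and u: "u \<in> conv_coe" and ep: "epi_converges us u"
    and t: "t < u x"
  shows "\<forall>\<^sub>F k in sequentially. t < us k x"
proof -
  obtain m where m: "min_value u = ereal m" using min_value_real[OF u] by blast
  obtain s where s: "t < ereal s" "ereal s < u x" using ereal_dense2[OF t] by auto
  obtain r where r: "s \<le> r" "ereal r < u x" "r \<noteq> m"
  proof (cases "s = m")
    case True
    obtain r where "ereal s < ereal r" "ereal r < u x" using ereal_dense2[OF s(2)] by auto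
    with True show ?thesis using that[of r] by auto
  qed (use s that in auto)
  let ?B = "sublevel u r"
  have sc: "set_converges (\<lambda>k. sublevel (us k) r) ?B"
    using ep m r(3) by (auto simp: epi_converges_def)
  have xB: "x \<notin> ?B" using r(2) by (auto simp: sublevel_def)
  have "\<forall>\<^sub>F k in sequentially. x \<notin> sublevel (us k) r"
  proof (cases "?B = {}")
    case True
    then show ?thesis using sc by (auto simp: set_converges_def elim: eventually_mono)
  next
    case False
    have "closed ?B" by (intro compact_imp_closed compact_sublevel u)
    then have pos: "0 < infdist x ?B"
      using xB False by (simp add: infdist_pos_not_in_closed)
    have "(\<lambda>k. hausdorff_dist (sublevel (us k) r) ?B) \<longlonglongrightarrow> 0"
      using sc False by (auto simp: set_converges_def)
    then have "\<forall>\<^sub>F k in sequentially. hausdorff_dist (sublevel (us k) r) ?B < infdist x ?B"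
      using pos by (rule order_tendstoD)
    then show ?thesis
    proof eventually_elim
      case (elim k)
      have "bounded (sublevel (us k) r)" "bounded ?B"
        by (intro compact_imp_bounded compact_sublevel us u)+
      then show ?case using elim infdist_le_hausdorff_dist(1)[of "sublevel (us k) r" ?B x] by auto
    qed
  qed
  then show ?thesis
  proof eventually_elim
    case (elim k)
    then have "ereal r < us k x" by (auto simp: sublevel_def)
    then show ?case using s(1) r(1) by (meson ereal_less_eq(3) less_le_trans less_trans order.strict_trans2)
  qed
qed

text \<open>If \<open>x\<close> were outside the convex set \<open>sublevel (us k) t\<close>, then going from \<open>x\<close> straight away from that set
would lead to a point of the limit set at distance at least \<open>r\<close> from it.\<close>

lemma epi_converges_pointwise_upper:
  fixes u :: "'a::euclidean_space \<Rightarrow> ereal"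
  assumes us: "\<And>k. us k \<in> conv_coe" and u: "u \<in> conv_coe" and ep: "epi_converges us u"
    and x: "x \<in> interior (sublevel u t)" and t: "ereal t \<noteq> min_value u"
  shows "\<forall>\<^sub>F k in sequentially. us k x \<le> ereal t"
proof -
  let ?B = "sublevel u t"
  obtain r where r: "0 < r" "cball x r \<subseteq> ?B" using x by (auto simp: mem_interior_cball)
  then have ne: "?B \<noteq> {}" by auto
  have "set_converges (\<lambda>k. sublevel (us k) t) ?B"
    using ep t by (auto simp: epi_converges_def)
  then have 1: "\<forall>\<^sub>F k in sequentially. sublevel (us k) t \<noteq> {}"
    and 2: "(\<lambda>k. hausdorff_dist (sublevel (us k) t) ?B) \<longlonglongrightarrow> 0"
    using ne by (auto simp: set_converges_def)
  have "\<forall>\<^sub>F k in sequentially. hausdorff_dist (sublevel (us k) t) ?B < r"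
    using 2 r(1) by (rule order_tendstoD)
  with 1 show ?thesis
  proof eventually_elim
    case (elim k)
    let ?A = "sublevel (us k) t"
    have A: "closed ?A" "convex ?A" "bounded ?A"
      using compact_sublevel[OF us] convex_sublevel[OF us] by (auto intro: compact_imp_closed compact_imp_bounded)
    show ?case
    proof (rule ccontr)
      assume "\<not> ?case"
      then have xA: "x \<notin> ?A" by (auto simp: sublevel_def)
      define p where "p = closest_point ?A x"
      have pA: "p \<in> ?A" unfolding p_def by (rule closest_point_in_set) (use A elim in auto)
      then have xp: "x \<noteq> p" using xA by auto
      \<comment> \<open>Moving from \<open>x\<close> away from its nearest point \<open>p\<close> stays in the ball and gains distance \<open>r\<close>.\<close>
      define d where "d = (1 / norm (x - p)) *\<^sub>R (x - p)"
      have d: "norm d = 1" using xp by (simp add: d_def)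
      have "x + r *\<^sub>R d \<in> ?B"
        using r d by (auto intro!: subsetD[OF r(2)] simp: dist_norm)
      then have "infdist (x + r *\<^sub>R d) ?A \<le> hausdorff_dist ?A ?B"
        by (intro infdist_le_hausdorff_dist A compact_imp_bounded compact_sublevel u)
      moreover have "r \<le> infdist (x + r *\<^sub>R d) ?A"
        unfolding infdist_def using elim(1)
      proof (simp, intro cINF_greatest)
        fix z assume z: "z \<in> ?A"
        have "(x - p) \<bullet> (z - p) \<le> 0"
          unfolding p_def by (rule closest_point_dot[OF A(2,1) z])
        then have "d \<bullet> (z - p) \<le> 0" by (simp add: d_def divide_nonpos_nonneg)
        moreover have "d \<bullet> (x - p) \<ge> 0" by (simp add: d_def)
        ultimately have "r \<le> d \<bullet> (x + r *\<^sub>R d - z)"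
          using d by (simp add: inner_diff_right inner_add_right dot_square_norm)
        also have "\<dots> \<le> norm d * norm (x + r *\<^sub>R d - z)" by (rule norm_cauchy_schwarz)
        finally show "r \<le> dist (x + r *\<^sub>R d) z" using d by (simp add: dist_norm)
      qed
      ultimately show False using elim(2) by linarith
    qed
  qed
qed

lemma epi_converges_min_value:
  fixes u :: "'a::euclidean_space \<Rightarrow> ereal"
  assumes us: "\<And>k. us k \<in> conv_coe" and u: "u \<in> conv_coe" and ep: "epi_converges us u"
  shows "(\<lambda>k. min_value (us k)) \<longlonglongrightarrow> min_value u"
proof (rule order_tendstoI)
  obtain m where m: "min_value u = ereal m" using min_value_real[OF u] by blast
  fix a
  {
    assume "a < min_value u"
    then obtain t where t: "a < ereal t" "ereal t < min_value u" using ereal_dense2 by blast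
    then have "sublevel u t = {}" using sublevel_eq_empty_iff[OF u] by auto
    then have "\<forall>\<^sub>F k in sequentially. sublevel (us k) t = {}"
      using ep t(2) by (force simp: epi_converges_def set_converges_def)
    then show "\<forall>\<^sub>F k in sequentially. a < min_value (us k)"
      by eventually_elim (use t(1) sublevel_eq_empty_iff[OF us] in \<open>auto intro: less_trans\<close>)
  next
    assume "min_value u < a"
    then obtain t where t: "min_value u < ereal t" "ereal t < a" using ereal_dense2 by blast
    then have "sublevel u t \<noteq> {}" using sublevel_eq_empty_iff[OF u] by auto
    then have "\<forall>\<^sub>F k in sequentially. sublevel (us k) t \<noteq> {}"
      using ep t(1) by (force simp: epi_converges_def set_converges_def)
    then show "\<forall>\<^sub>F k in sequentially. min_value (us k) < a"
      by eventually_elim (use t(2) sublevel_eq_empty_iff[OF us] in \<open>auto simp: not_less intro: le_less_trans\<close>)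
  }
qed

section \<open>Admissible functionals\<close>

definition exp_homogeneous :: "(('a::euclidean_space \<Rightarrow> ereal) \<Rightarrow> real) \<Rightarrow> bool" where
  "exp_homogeneous Z \<longleftrightarrow> (\<forall>u\<in>conv_coe. \<forall>t::real. Z (\<lambda>x. u x + ereal t) = exp (- t) * Z u)"

definition admissible :: "((real ^ 'n \<Rightarrow> ereal) \<Rightarrow> real) \<Rightarrow> bool" where
  "admissible Z \<longleftrightarrow> epi_continuous Z \<and> SL_invariant Z \<and> translation_invariant Z \<and> valuation Z
     \<and> exp_homogeneous Z"

lemma inv_translation: "inv (\<lambda>x. x + a) = (\<lambda>x. x - (a::'a::group_add))"
  by (rule inv_equality) auto

lemma admissible_tendsto:
  assumes "admissible Z" "\<And>k. us k \<in> conv_coe" "u \<in> conv_coe" "epi_converges us u"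
  shows "(\<lambda>k. Z (us k)) \<longlonglongrightarrow> Z u"
  using assms by (simp add: admissible_def epi_continuous_def)

lemma admissible_valuation:
  assumes "admissible Z" "u \<in> conv_coe" "v \<in> conv_coe"
    "(\<lambda>x. min (u x) (v x)) \<in> conv_coe" "(\<lambda>x. max (u x) (v x)) \<in> conv_coe"
  shows "Z u + Z v = Z (\<lambda>x. min (u x) (v x)) + Z (\<lambda>x. max (u x) (v x))"
  using assms by (simp add: admissible_def valuation_def)

lemma admissible_translate:
  assumes "admissible Z" "u \<in> conv_coe"
  shows "Z (\<lambda>x. u (x - v)) = Z u"
proof -
  have "Z (u \<circ> inv (\<lambda>x. x + v)) = Z u"
    using assms by (auto simp: admissible_def translation_invariant_def)
  then show ?thesis by (simp add: inv_translation o_def)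
qed

lemma admissible_add_const:
  assumes "admissible Z" "u \<in> conv_coe"
  shows "Z (\<lambda>x. u x + ereal t) = exp (- t) * Z u"
  using assms by (auto simp: admissible_def exp_homogeneous_def)

lemma admissible_SL:
  fixes C :: "real^'n^'n"
  assumes "admissible Z" "u \<in> conv_coe" "det C = 1"
  shows "Z (\<lambda>x. u (C *v x)) = Z u"
proof -
  have "det C \<noteq> 0" using assms(3) by simp
  then obtain A where A: "C ** A = mat 1" "A ** C = mat 1" by (rule obtain_matrix_inverse)
  then have "det A = 1" using assms(3) by (metis det_I det_mul mult.right_neutral)
  then have "Z (u \<circ> inv ((*v) A)) = Z u"
    using assms by (auto simp: admissible_def SL_invariant_def)
  moreover have "inv ((*v) A) = (*v) C"
    by (rule inv_equality) (auto simp: matrix_vector_mul_assoc A)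
  ultimately show ?thesis by (simp add: o_def)
qed

text \<open>This is how \<open>SL(n)\<close> invariance enters: two linear images with the same determinant differ by an
element of \<open>SL(n)\<close>.\<close>

lemma admissible_cong_det:
  fixes B C :: "real^'n^'n"
  assumes Z: "admissible Z" and u: "u \<in> conv_coe" and "det B = det C" "det C \<noteq> 0"
  shows "Z (\<lambda>x. u (B *v x)) = Z (\<lambda>x. u (C *v x))"
proof -
  obtain D where D: "C ** D = mat 1" "D ** C = mat 1" by (rule obtain_matrix_inverse[OF assms(4)])
  have "det D * det C = 1" using D by (metis det_I det_mul)
  then have "det (D ** B) = 1" using assms by (simp add: det_mul)
  then have "Z (\<lambda>x. (\<lambda>y. u (C *v y)) ((D ** B) *v x)) = Z (\<lambda>x. u (C *v x))"
    by (intro admissible_SL Z conv_coe_comp_matrix u assms)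
  moreover have "C *v ((D ** B) *v x) = B *v x" for x
    by (simp add: matrix_vector_mul_assoc matrix_mul_assoc D)
  ultimately show ?thesis by simp
qed

lemma admissible_lincomb:
  assumes "admissible Y" "admissible Z"
  shows "admissible (\<lambda>u. a * Y u + b * Z u)"
  using assms unfolding admissible_def
proof (elim conjE, intro conjI)
  assume Y: "epi_continuous Y" and Z: "epi_continuous Z"
  show "epi_continuous (\<lambda>u. a * Y u + b * Z u)"
    using Y Z unfolding epi_continuous_def by (auto intro!: tendsto_intros)
next
  assume Y: "valuation Y" and Z: "valuation Z"
  show "valuation (\<lambda>u. a * Y u + b * Z u)"
    unfolding valuation_def
  proof (intro ballI impI)
    fix u v :: "real^'a \<Rightarrow> ereal"
    assume *: "u \<in> conv_coe" "v \<in> conv_coe"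
      "(\<lambda>x. min (u x) (v x)) \<in> conv_coe" "(\<lambda>x. max (u x) (v x)) \<in> conv_coe"
    have "Y u + Y v = Y (\<lambda>x. min (u x) (v x)) + Y (\<lambda>x. max (u x) (v x))"
      "Z u + Z v = Z (\<lambda>x. min (u x) (v x)) + Z (\<lambda>x. max (u x) (v x))"
      using Y Z * unfolding valuation_def by blast+
    then show "a * Y u + b * Z u + (a * Y v + b * Z v) =
        a * Y (\<lambda>x. min (u x) (v x)) + b * Z (\<lambda>x. min (u x) (v x)) +
        (a * Y (\<lambda>x. max (u x) (v x)) + b * Z (\<lambda>x. max (u x) (v x)))"
      by algebra
  qed
qed (auto simp: SL_invariant_def translation_invariant_def exp_homogeneous_def algebra_simps)

text \<open>The five properties only see the values on \<open>conv_coe\<close>, since this set is closed under the operations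
that they involve.\<close>

lemma admissible_cong:
  fixes Y Z :: "(real^'n \<Rightarrow> ereal) \<Rightarrow> real"
  assumes Y: "admissible Y" and eq: "\<And>u. u \<in> conv_coe \<Longrightarrow> Z u = Y u"
  shows "admissible Z"
  unfolding admissible_def
proof (intro conjI)
  show "epi_continuous Z"
    unfolding epi_continuous_def
  proof (intro allI ballI impI)
    fix us and u :: "real^'n \<Rightarrow> ereal"
    assume *: "u \<in> conv_coe" "\<forall>k. us k \<in> conv_coe" "epi_converges us u"
    then have "(\<lambda>k. Y (us k)) \<longlonglongrightarrow> Y u" by (intro admissible_tendsto[OF Y]) auto
    then show "(\<lambda>k. Z (us k)) \<longlonglongrightarrow> Z u" using * by (simp add: eq)
  qed
  show "SL_invariant Z"
    unfolding SL_invariant_def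
  proof (intro ballI allI impI)
    fix u :: "real^'n \<Rightarrow> ereal" and A :: "real^'n^'n" assume u: "u \<in> conv_coe" and A: "det A = 1"
    have "det A \<noteq> 0" using A by simp
    then obtain B where B: "A ** B = mat 1" "B ** A = mat 1" "inv ((*v) A) = (*v) B"
      by (rule obtain_matrix_inverse)
    note B(3)
    moreover have "det B = 1" using A B by (metis det_I det_mul mult_1)
    ultimately have "u \<circ> inv ((*v) A) \<in> conv_coe"
      using conv_coe_comp_matrix[OF u, of B] by (simp add: o_def)
    then show "Z (u \<circ> inv ((*v) A)) = Z u"
      using Y u A by (simp add: eq admissible_def SL_invariant_def)
  qed
  show "translation_invariant Z"
    unfolding translation_invariant_def
  proof (intro ballI allI)
    fix u :: "real^'n \<Rightarrow> ereal" and a assume u: "u \<in> conv_coe"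
    have "u \<circ> inv (\<lambda>x. x + a) \<in> conv_coe"
      using conv_coe_translate[OF u, of a] by (simp add: inv_translation o_def)
    then show "Z (u \<circ> inv (\<lambda>x. x + a)) = Z u"
      using Y u by (simp add: eq admissible_def translation_invariant_def)
  qed
  show "valuation Z"
    unfolding valuation_def by (auto simp: eq intro: admissible_valuation[OF Y])
  show "exp_homogeneous Z"
    unfolding exp_homogeneous_def by (simp add: eq conv_coe_add_const admissible_add_const[OF Y])
qed

text \<open>The valuation property for a function whose domain is cut in two, on which the treatment of polytopes
rests.\<close>

lemma admissible_cut:
  assumes Z: "admissible Z" and A: "closed A" "convex A" and B: "closed B" "convex B"
    and K: "A \<union> B = K" "convex K" and ne: "A \<inter> B \<noteq> {}"
    and f: "convex_on K f" "continuous_on K f" "\<And>t. bounded {x\<in>K. f x \<le> t}"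
  shows "Z (extended A f) + Z (extended B f) = Z (extended K f) + Z (extended (A \<inter> B) f)"
proof -
  have sub: "extended C f \<in> conv_coe" if C: "closed C" "convex C" "C \<noteq> {}" "C \<subseteq> K" for C
  proof (rule extended_in_conv_coe[OF C(1-3)])
    show "convex_on C f" using f(1) C by (meson convex_on_subset)
    show "continuous_on C f" using f(2) C(4) by (rule continuous_on_subset)
    show "bounded {x\<in>C. f x \<le> t}" for t using f(3)[of t] by (rule bounded_subset) (use C in auto)
  qed
  have mn: "(\<lambda>x. min (extended A f x) (extended B f x)) = extended K f"
    unfolding K(1)[symmetric] by (auto simp: extended_def min_def fun_eq_iff)
  have mx: "(\<lambda>x. max (extended A f x) (extended B f x)) = extended (A \<inter> B) f"
    by (auto simp: extended_def max_def fun_eq_iff)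
  have "closed K" using A B K by auto
  have "Z (extended A f) + Z (extended B f) = Z (\<lambda>x. min (extended A f x) (extended B f x)) + Z (\<lambda>x. max (extended A f x) (extended B f x))"
    unfolding mn mx
    by (rule admissible_valuation[OF Z, of "extended A f" "extended B f", unfolded mn mx])
       (intro sub; use A B K ne \<open>closed K\<close> in \<open>auto intro: convex_Int\<close>)+
  then show ?thesis by (simp add: mn mx)
qed

section \<open>The exponential of the minimum\<close>

lemma exp_neg_tendsto:
  assumes "f \<longlonglongrightarrow> a" "a \<noteq> -\<infinity>"
  shows "(\<lambda>k. exp_neg (f k)) \<longlonglongrightarrow> exp_neg a"
proof (cases a)
  case (real r)
  then have f: "f \<longlonglongrightarrow> ereal r" using assms by simp
  have "\<forall>\<^sub>F k in sequentially. f k < \<infinity>" using f by (rule order_tendstoD) auto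
  then have "\<forall>\<^sub>F k in sequentially. exp (- real_of_ereal (f k)) = exp_neg (f k)"
    by eventually_elim (auto simp: exp_neg_def)
  moreover have "(\<lambda>k. exp (- real_of_ereal (f k))) \<longlonglongrightarrow> exp (- r)"
    by (intro tendsto_intros lim_real_of_ereal f)
  ultimately show ?thesis using real by (simp add: exp_neg_def tendsto_cong)
next
  case PInf
  have "(\<lambda>k. exp_neg (f k)) \<longlonglongrightarrow> 0"
  proof (rule tendstoI)
    fix e :: real assume e: "0 < e"
    have "\<forall>\<^sub>F k in sequentially. ereal (- ln e) < f k"
      by (rule order_tendstoD(1)[OF assms(1)]) (simp add: PInf)
    then show "\<forall>\<^sub>F k in sequentially. dist (exp_neg (f k)) 0 < e"
    proof eventually_elim
      case (elim k)
      then show ?case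
      proof (cases "f k")
        case (real r)
        then have "- r < ln e" using elim by simp
        then have "exp (- r) < exp (ln e)" by simp
        then show ?thesis using real e by (simp add: exp_neg_def)
      qed (use e in \<open>auto simp: exp_neg_def\<close>)
    qed
  qed
  then show ?thesis using PInf by (simp add: exp_neg_def)
qed (use assms in auto)

lemma exp_neg_add: "a \<noteq> -\<infinity> \<Longrightarrow> exp_neg (a + ereal t) = exp (- t) * exp_neg a"
  by (cases a) (auto simp: exp_neg_def exp_add[symmetric])

lemma exp_neg_min_max: "exp_neg a + exp_neg b = exp_neg (min a b) + exp_neg (max a b)"
  by (simp add: min_def max_def)

lemma min_value_comp_inv:
  assumes "bij f" shows "min_value (u \<circ> inv f) = min_value u"
proof -
  have "range (u \<circ> inv f) = range u"
    using assms by (metis bij_imp_bij_inv bij_is_surj fun.set_map image_comp)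
  then show ?thesis by (simp add: min_value_def)
qed

lemma min_value_min:
  fixes u v :: "'a::euclidean_space \<Rightarrow> ereal"
  assumes "u \<in> conv_coe" "v \<in> conv_coe"
  shows "min_value (\<lambda>x. min (u x) (v x)) = min (min_value u) (min_value v)"
proof -
  obtain x where x: "u x = min_value u" "\<And>y. u x \<le> u y" using min_value_attained[OF assms(1)] by auto
  obtain y where y: "v y = min_value v" "\<And>z. v y \<le> v z" using min_value_attained[OF assms(2)] by auto
  show ?thesis
  proof (cases "u x \<le> v y")
    case True
    then show ?thesis using x y
      by (intro trans[OF min_value_eqI[of _ x "u x"]]) (auto simp: min_def intro: order_trans)
  next
    case False
    then have "v y \<le> u z" for z using x(2)[of z] by (meson less_imp_le not_le order_trans)
    with False x y show ?thesis
      by (intro trans[OF min_value_eqI[of _ y "v y"]]) (auto simp: min_def intro!: antisym)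
  qed
qed

text \<open>At the level \<open>max (min u) (min v)\<close> the sublevel sets of \<open>u\<close> and \<open>v\<close> are closed and non-empty, and their
union is a sublevel set of the convex function \<open>min u v\<close>.  So they meet, by connectedness.\<close>

lemma min_value_max:
  fixes u v :: "'a::euclidean_space \<Rightarrow> ereal"
  assumes u: "u \<in> conv_coe" and v: "v \<in> conv_coe" and uv: "(\<lambda>x. min (u x) (v x)) \<in> conv_coe"
  shows "min_value (\<lambda>x. max (u x) (v x)) = max (min_value u) (min_value v)"
proof -
  obtain m where m1: "min_value u = ereal m" using min_value_real[OF u] by blast
  obtain m' where m2: "min_value v = ereal m'" using min_value_real[OF v] by blast
  note m = m1 m2
  let ?M = "max m m'"
  let ?w = "\<lambda>x. min (u x) (v x)"
  have eq: "sublevel ?w ?M = sublevel u ?M \<union> sublevel v ?M"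
    by (auto simp: sublevel_def min_def)
  have c: "connected (sublevel ?w ?M)" by (intro convex_connected convex_sublevel uv)
  have cl: "closed (sublevel u ?M)" "closed (sublevel v ?M)"
    by (intro compact_imp_closed compact_sublevel u v)+
  have ne: "sublevel u ?M \<noteq> {}" "sublevel v ?M \<noteq> {}"
    using sublevel_eq_empty_iff[OF u] sublevel_eq_empty_iff[OF v] m by auto
  have "sublevel u ?M \<inter> sublevel v ?M \<noteq> {}"
    using c cl ne unfolding connected_closed eq by blast
  then obtain z where z: "u z \<le> ereal ?M" "v z \<le> ereal ?M" by (auto simp: sublevel_def)
  have le: "ereal ?M \<le> max (u y) (v y)" for y
    using min_value_le[OF u, of y] min_value_le[OF v, of y] m
    by (auto simp: max_def split: if_splits intro: order_trans)
  have "min_value (\<lambda>x. max (u x) (v x)) = ereal ?M"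
    by (rule min_value_eqI[of _ z]) (use le z in \<open>auto intro!: antisym\<close>)
  then show ?thesis using m by (auto simp: max_def)
qed

lemma admissible_exp_neg_min_value:
  "admissible (\<lambda>u::real^'n \<Rightarrow> ereal. exp_neg (min_value u))"
  unfolding admissible_def
proof (intro conjI)
  show "epi_continuous (\<lambda>u::real^'n \<Rightarrow> ereal. exp_neg (min_value u))"
    unfolding epi_continuous_def
  proof (intro allI ballI impI)
    fix us and u :: "real^'n \<Rightarrow> ereal"
    assume *: "u \<in> conv_coe" "\<forall>k. us k \<in> conv_coe" "epi_converges us u"
    obtain m x0 where "min_value u = ereal m" "u x0 = ereal m" "\<And>y. ereal m \<le> u y"
      using min_value_real[OF *(1)] by blast
    then have "min_value u \<noteq> -\<infinity>" by simp
    then show "(\<lambda>k. exp_neg (min_value (us k))) \<longlonglongrightarrow> exp_neg (min_value u)"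
      using * by (intro exp_neg_tendsto epi_converges_min_value) auto
  qed
  show "SL_invariant (\<lambda>u::real^'n \<Rightarrow> ereal. exp_neg (min_value u))"
    unfolding SL_invariant_def
  proof (intro ballI allI impI)
    fix u :: "real^'n \<Rightarrow> ereal" and A :: "real^'n^'n" assume "det A = 1"
    then have "bij ((*v) A)" by (intro invertible_eq_bij[THEN iffD1]) (simp add: invertible_det_nz)
    then show "exp_neg (min_value (u \<circ> inv ((*v) A))) = exp_neg (min_value u)"
      by (simp add: min_value_comp_inv)
  qed
  show "translation_invariant (\<lambda>u::real^'n \<Rightarrow> ereal. exp_neg (min_value u))"
    unfolding translation_invariant_def
  proof (intro ballI allI)
    fix u :: "real^'n \<Rightarrow> ereal" and a
    have "bij (\<lambda>x::real^'n. x + a)" by (rule bij_plus_right)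
    then show "exp_neg (min_value (u \<circ> inv (\<lambda>x. x + a))) = exp_neg (min_value u)"
      by (simp add: min_value_comp_inv)
  qed
  show "valuation (\<lambda>u::real^'n \<Rightarrow> ereal. exp_neg (min_value u))"
    unfolding valuation_def
    by (simp add: min_value_min min_value_max exp_neg_min_max[symmetric])
  show "exp_homogeneous (\<lambda>u::real^'n \<Rightarrow> ereal. exp_neg (min_value u))"
    unfolding exp_homogeneous_def
  proof (intro ballI allI)
    fix u :: "real^'n \<Rightarrow> ereal" and t assume u: "u \<in> conv_coe"
    obtain m x0 where m: "min_value u = ereal m" "u x0 = ereal m" "\<And>y. ereal m \<le> u y"
      using min_value_real[OF u] by blast
    have "min_value (\<lambda>x. u x + ereal t) = ereal m + ereal t"
      by (rule min_value_eqI[of _ x0]) (use m in \<open>auto intro!: add_mono simp del: plus_ereal.simps\<close>)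
    then show "exp_neg (min_value (\<lambda>x. u x + ereal t)) = exp (- t) * exp_neg (min_value u)"
      using m exp_neg_add[of "ereal m" t] by simp
  qed
qed

section \<open>The integral\<close>

text \<open>Along a ray from \<open>x0\<close> the difference quotients of a convex function increase.\<close>

lemma linear_growth_from_sphere:
  assumes u: "u \<in> conv_coe" and x0: "u x0 \<le> ereal a" and r: "0 < r"
    and s: "\<And>z. dist x0 z = r \<Longrightarrow> ereal b \<le> u z" and x: "r \<le> dist x0 x"
  shows "ereal (a + dist x0 x / r * (b - a)) \<le> u x"
proof (cases "u x")
  case (real c)
  obtain a' where a': "u x0 = ereal a'" "a' \<le> a"
    using u x0 by (cases "u x0") (auto simp: conv_coe_def)
  define l where "l = r / dist x0 x"
  have "0 < dist x0 x" using r x by linarith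
  then have l: "0 < l" "l \<le> 1" using r x by (simp_all add: l_def)
  define z where "z = (1 - l) *\<^sub>R x0 + l *\<^sub>R x"
  have "x0 - z = l *\<^sub>R (x0 - x)" by (simp add: z_def algebra_simps)
  then have "dist x0 z = l * dist x0 x" using l by (simp add: dist_norm)
  also have "\<dots> = r" using \<open>0 < dist x0 x\<close> by (simp add: l_def)
  finally have "dist x0 z = r" .
  then have "ereal b \<le> u z" by (rule s)
  also have "u z \<le> ereal ((1 - l) * a + l * c)"
  proof (cases "l = 1")
    case False
    then have "u z \<le> ereal (1 - l) * u x0 + ereal l * u x"
      using u l unfolding conv_coe_def convex_ereal_def z_def by auto
    also have "\<dots> = ereal ((1 - l) * a' + l * c)" by (simp add: a' real)
    also have "\<dots> \<le> ereal ((1 - l) * a + l * c)"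
      using l a' by (auto intro!: mult_left_mono)
    finally show ?thesis .
  qed (simp add: z_def real)
  finally have "b - a \<le> l * (c - a)" by (simp add: algebra_simps)
  then have "(b - a) / l \<le> c - a" using l by (simp add: field_simps)
  moreover have "(b - a) / l = dist x0 x / r * (b - a)" by (simp add: l_def)
  ultimately show ?thesis by (simp add: real)
qed (use u in \<open>auto simp: conv_coe_def\<close>)

text \<open>Let \<open>m\<close> be the minimum of \<open>u\<close>.  From some index on the sublevel sets at the level \<open>m + 1\<close> lie in a common
ball of radius \<open>R\<close> and the minima are below \<open>m + 1/2\<close>.  So each function gains at least \<open>1/2\<close> on the way
from its minimiser to the sphere of radius \<open>2R\<close> around it, and keeps at least this slope beyond.\<close>

lemma uniform_linear_growth:
  fixes u :: "'a::euclidean_space \<Rightarrow> ereal"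
  assumes us: "\<And>k. us k \<in> conv_coe" and u: "u \<in> conv_coe" and ep: "epi_converges us u"
  obtains a b where "0 < a" "\<forall>\<^sub>F k in sequentially. \<forall>x. ereal (a * norm x - b) \<le> us k x"
proof -
  obtain m x0 where m: "min_value u = ereal m" "u x0 = ereal m" "\<And>y. ereal m \<le> u y"
    using min_value_real[OF u] by blast
  let ?B = "sublevel u (m + 1)"
  obtain R0 where R0: "\<And>x. x \<in> ?B \<Longrightarrow> norm x \<le> R0"
    using compact_imp_bounded[OF compact_sublevel[OF u, of "m+1"]] unfolding bounded_iff by blast
  define R where "R = max R0 0 + 1"
  have R: "1 \<le> R" "R0 + 1 \<le> R" by (auto simp: R_def)
  have ne: "?B \<noteq> {}" using sublevel_eq_empty_iff[OF u] m by auto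
  have "set_converges (\<lambda>k. sublevel (us k) (m+1)) ?B"
    using ep m unfolding epi_converges_def by auto
  then have 1: "\<forall>\<^sub>F k in sequentially. hausdorff_dist (sublevel (us k) (m+1)) ?B < 1"
    using ne order_tendstoD(2)[of "\<lambda>k. hausdorff_dist (sublevel (us k) (m+1)) ?B" 0 sequentially 1]
    by (simp add: set_converges_def)
  have lim: "(\<lambda>k. min_value (us k)) \<longlonglongrightarrow> ereal m"
    using epi_converges_min_value[OF us u ep] m by simp
  have 2: "\<forall>\<^sub>F k in sequentially. ereal (m - 1) < min_value (us k)"
    by (rule order_tendstoD(1)[OF lim]) simp
  have 3: "\<forall>\<^sub>F k in sequentially. min_value (us k) < ereal (m + 1/2)"
    by (rule order_tendstoD(2)[OF lim]) simp
  \<comment> \<open>The slope: a gain of \<open>1/2\<close> over the distance \<open>2 R\<close>.\<close>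
  define a where "a = 1 / (4 * R)"
  have "\<forall>\<^sub>F k in sequentially. \<forall>x. ereal (a * norm x - (2 - m + 1/4)) \<le> us k x"
    using 1 2 3
  proof eventually_elim
    case (elim k)
    obtain c z where c: "min_value (us k) = ereal c" "us k z = ereal c" "\<And>y. ereal c \<le> us k y"
      using min_value_real[OF us] by blast
    have c': "m - 1 < c" "c < m + 1/2" using elim c by auto
    have bd: "norm x < R" if "x \<in> sublevel (us k) (m+1)" for x
    proof -
      have "infdist x ?B \<le> hausdorff_dist (sublevel (us k) (m+1)) ?B"
        by (intro infdist_le_hausdorff_dist compact_imp_bounded compact_sublevel us u that)
      with elim(1) have "infdist x ?B < 1" by linarith
      then obtain y where "y \<in> ?B" "dist x y < 1"
        using infdist_attains_inf[of ?B x] ne compact_imp_closed[OF compact_sublevel[OF u]] by metis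
      then have "norm x < R0 + 1" using R0[of y] norm_triangle_sub[of x y] by (auto simp: dist_norm)
      then show ?thesis using R by linarith
    qed
    have z: "norm z < R" using c' c by (intro bd) (auto simp: sublevel_def)
    show ?case
    proof
      fix x
      have nx: "norm x \<le> dist z x + R"
        using z norm_triangle_sub[of x z] by (auto simp: dist_norm norm_minus_commute)
      have eq: "a * (dist z x + R) = dist z x / (2*R) * (1/2) + 1/4"
        using R by (simp add: a_def field_simps)
      have ax: "a * norm x \<le> a * (dist z x + R)"
        using nx R by (intro mult_left_mono) (auto simp: a_def)
      have "ereal (a * norm x - (2 - m + 1/4)) \<le> ereal (m - 2 + dist z x / (2*R) * (1/2))"
        using ax eq by simp
      also have "\<dots> \<le> us k x"
      proof (cases "2 * R \<le> dist z x")
        case True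
        have "ereal (c + dist z x / (2*R) * (m + 1 - c)) \<le> us k x"
        proof (rule linear_growth_from_sphere[OF us _ _ _ True])
          fix w assume "dist z w = 2 * R"
          then have "R \<le> norm w" using z norm_triangle_ineq4[of z w] by (simp add: dist_norm)
          then show "ereal (m + 1) \<le> us k w" using bd[of w] by (force simp: sublevel_def)
        qed (use c R in auto)
        moreover have "dist z x / (2*R) * (1/2) \<le> dist z x / (2*R) * (m + 1 - c)"
          using c' R by (intro mult_left_mono) auto
        ultimately show ?thesis using c' by (smt (verit, ccfv_threshold) ereal_less_eq(3) order_trans)
      next
        case False
        then have "dist z x / (2*R) \<le> 1" using R by (simp add: field_simps)
        then have "m - 2 + dist z x / (2*R) * (1/2) \<le> c" using c'(1) by argo
        then show ?thesis using c(3)[of x] by (meson ereal_less_eq(3) order_trans)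
      qed
      finally show "ereal (a * norm x - (2 - m + 1/4)) \<le> us k x" .
    qed
  qed
  moreover have "0 < a" using R by (simp add: a_def)
  ultimately show ?thesis using that by blast
qed

lemma linear_growth:
  fixes u :: "'a::euclidean_space \<Rightarrow> ereal"
  assumes u: "u \<in> conv_coe"
  obtains a b where "0 < a" "\<And>x. ereal (a * norm x - b) \<le> u x"
  using uniform_linear_growth[OF _ u epi_converges_const[OF u]] u by auto

text \<open>The integrand is bounded by a series of multiples of indicators of balls of radius \<open>k + 1\<close>, whose
integrals are \<open>exp (- a k)\<close> times a polynomial in \<open>k\<close>.\<close>

lemma integrable_exp_neg_norm:
  assumes a: "0 < a"
  shows "integrable lborel (\<lambda>x::'a::euclidean_space. exp (b - a * norm x))"
proof -
  define g :: "nat \<Rightarrow> 'a \<Rightarrow> real" where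
    "g k x = exp (b + a - a * (real k + 1)) * indicator (cball 0 (real k + 1)) x" for k x
  let ?c = "unit_ball_vol (DIM('a))"
  have le: "ennreal (exp (b - a * norm x)) \<le> (\<Sum>k. ennreal (g k x))" for x :: 'a
  proof -
    define k where "k = nat \<lfloor>norm x\<rfloor>"
    have "real k = of_int \<lfloor>norm x\<rfloor>" by (simp add: k_def)
    then have k: "real k \<le> norm x" "norm x \<le> real k + 1" by linarith+
    then have "b - a * norm x \<le> b + a - a * (real k + 1)"
      using a mult_left_mono[OF k(1), of a] by (simp add: algebra_simps)
    then have "ennreal (exp (b - a * norm x)) \<le> ennreal (g k x)"
      using k by (simp add: g_def)
    also have "\<dots> \<le> (\<Sum>k. ennreal (g k x))"
      using sum_le_suminf[of "\<lambda>k. ennreal (g k x)" "{k}"] by simp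
    finally show ?thesis .
  qed
  have int_g: "(\<integral>\<^sup>+ x. ennreal (g k x) \<partial>lborel)
      = ennreal (exp (b + a - a * (real k + 1)) * (?c * (real k + 1) ^ DIM('a)))" for k
  proof -
    have "(\<integral>\<^sup>+ x. ennreal (g k x) \<partial>lborel) =
      (\<integral>\<^sup>+ x. ennreal (exp (b + a - a * (real k + 1))) * indicator (cball 0 (real k + 1)) x \<partial>(lborel :: 'a measure))"
      by (rule nn_integral_cong) (auto simp: g_def indicator_def)
    also have "\<dots> = ennreal (exp (b + a - a * (real k + 1))) * emeasure (lborel :: 'a measure) (cball 0 (real k + 1))"
      by (rule nn_integral_cmult_indicator) auto
    also have "\<dots> = ennreal (exp (b + a - a * (real k + 1)) * (?c * (real k + 1) ^ DIM('a)))"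
      by (simp add: emeasure_cball ennreal_mult'')
    finally show ?thesis .
  qed
  have summ: "summable (\<lambda>k. exp (b + a - a * (real k + 1)) * (?c * (real k + 1) ^ DIM('a)))"
  proof -
    let ?n = "DIM('a)"
    define D where "D = exp (b + a) * ?c * (2 / a) ^ ?n"
    have lim: "filterlim (\<lambda>k. a / 2 * (real k + 1)) at_top sequentially"
      using a by (intro filterlim_tendsto_pos_mult_at_top[OF tendsto_const]
          filterlim_at_top_mono[OF filterlim_real_sequentially]) auto
    have "(\<lambda>k. (a / 2 * (real k + 1)) ^ ?n / exp (a / 2 * (real k + 1))) \<longlonglongrightarrow> 0"
      by (rule filterlim_compose[OF tendsto_power_div_exp_0 lim])
    then have "\<forall>\<^sub>F k in sequentially. (a / 2 * (real k + 1)) ^ ?n / exp (a / 2 * (real k + 1)) < 1"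
      by (rule order_tendstoD) simp
    then have ev: "\<forall>\<^sub>F k in sequentially.
        norm (exp (b + a - a * (real k + 1)) * (?c * (real k + 1) ^ ?n)) \<le> D * exp (- a / 2) ^ k"
    proof eventually_elim
      case (elim k)
      let ?y = "a / 2 * (real k + 1)"
      have e1: "?y ^ ?n \<le> exp ?y" using elim by (simp add: divide_less_eq)
      have e2: "(real k + 1) ^ ?n = (2 / a) ^ ?n * ?y ^ ?n"
      proof -
        have "2 / a * ?y = real k + 1" using a by (simp add: field_simps)
        then show ?thesis by (metis power_mult_distrib)
      qed
      have e3: "exp (b + a - a * (real k + 1)) = exp (b + a) * exp (- ?y) * exp (- ?y)"
        by (simp flip: exp_add add: field_simps)
      have "exp (b + a - a * (real k + 1)) * (?c * (real k + 1) ^ ?n)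
          = D * exp (- ?y) * (exp (- ?y) * ?y ^ ?n)"
        unfolding e2 e3 D_def by (simp add: mult_ac)
      also have "\<dots> \<le> D * exp (- ?y) * 1"
        using e1 a by (intro mult_left_mono) (auto simp: exp_minus divide_simps D_def)
      also have "\<dots> \<le> D * exp (- a / 2 * real k)"
        using a by (simp add: D_def mult_left_mono algebra_simps)
      also have "exp (- a / 2 * real k) = exp (- a / 2) ^ k"
        by (simp add: exp_of_nat_mult[symmetric] mult.commute)
      finally show ?case by (simp add: abs_mult)
    qed
    have "summable (\<lambda>k. D * exp (- a / 2) ^ k)"
      using a by (intro summable_mult summable_geometric) auto
    from summable_comparison_test_ev[OF ev this] show ?thesis .
  qed
  have "(\<integral>\<^sup>+ x. ennreal (exp (b - a * norm x)) \<partial>(lborel :: 'a measure))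
      \<le> (\<integral>\<^sup>+ x. (\<Sum>k. ennreal (g k x)) \<partial>lborel)"
    by (intro nn_integral_mono le)
  also have "\<dots> = (\<Sum>k. \<integral>\<^sup>+ x. ennreal (g k x) \<partial>lborel)"
  proof (rule nn_integral_suminf)
    show "(\<lambda>x. ennreal (g k x)) \<in> borel_measurable lborel" for k
    proof (rule measurable_compose[OF _ measurable_ennreal])
      show "g k \<in> borel_measurable lborel"
        unfolding g_def[abs_def]
        by (rule borel_measurable_times[OF borel_measurable_const borel_measurable_indicator]) simp
    qed
  qed
  also have "\<dots> < \<infinity>"
  proof -
    have "0 \<le> ?c" by (rule unit_ball_vol_nonneg) simp
    then have "(\<Sum>k. ennreal (exp (b + a - a * (real k + 1)) * (?c * (real k + 1) ^ DIM('a))))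
        = ennreal (\<Sum>k. exp (b + a - a * (real k + 1)) * (?c * (real k + 1) ^ DIM('a)))"
      by (intro suminf_ennreal2 summ mult_nonneg_nonneg zero_le_power) auto
    then show ?thesis unfolding int_g by (metis ennreal_less_top infinity_ennreal_def)
  qed
  finally have fin: "(\<integral>\<^sup>+ x. ennreal (exp (b - a * norm x)) \<partial>(lborel :: 'a measure)) < \<infinity>" .
  show ?thesis
  proof (rule integrableI_bounded)
    have "continuous_on UNIV (\<lambda>x::'a. exp (b - a * norm x))" by (intro continuous_intros)
    then show "(\<lambda>x::'a. exp (b - a * norm x)) \<in> borel_measurable lborel"
      by (simp add: borel_measurable_continuous_onI)
    show "(\<integral>\<^sup>+ x. ennreal (norm (exp (b - a * norm x))) \<partial>(lborel :: 'a measure)) < \<infinity>"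
      unfolding real_norm_def abs_exp_cancel by (rule fin)
  qed
qed

lemma borel_measurable_conv_coe:
  fixes u :: "'a::euclidean_space \<Rightarrow> ereal"
  assumes "u \<in> conv_coe"
  shows "u \<in> borel_measurable borel"
proof (rule borel_measurableI_greater)
  fix y show "{x \<in> space borel. y < u x} \<in> sets borel"
    using assms lsc_open_superlevel[of u y] by (simp add: conv_coe_def)
qed

lemma borel_measurable_exp_neg [measurable]: "exp_neg \<in> borel_measurable borel"
  unfolding exp_neg_def[abs_def] by measurable

lemma exp_neg_le: "ereal r \<le> a \<Longrightarrow> exp_neg a \<le> exp (- r)"
  by (cases a) (auto simp: exp_neg_def)

lemma exp_neg_nonneg [simp]: "0 \<le> exp_neg a"
  by (simp add: exp_neg_def)

lemma measurable_exp_neg_conv_coe: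
  fixes u :: "'a::euclidean_space \<Rightarrow> ereal"
  assumes "u \<in> conv_coe"
  shows "(\<lambda>x. exp_neg (u x)) \<in> borel_measurable lborel"
  using measurable_compose[OF borel_measurable_conv_coe[OF assms] borel_measurable_exp_neg] by simp

lemma integrable_exp_neg:
  fixes u :: "'a::euclidean_space \<Rightarrow> ereal"
  assumes u: "u \<in> conv_coe"
  shows "integrable lborel (\<lambda>x. exp_neg (u x))"
proof -
  obtain a b where ab: "0 < a" "\<And>x. ereal (a * norm x - b) \<le> u x"
    using linear_growth[OF u] by blast
  show ?thesis
  proof (rule Bochner_Integration.integrable_bound[OF integrable_exp_neg_norm[OF ab(1), of b] measurable_exp_neg_conv_coe[OF u]])
    show "AE x in lborel. norm (exp_neg (u x)) \<le> norm (exp (b - a * norm x))"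
      using exp_neg_le[OF ab(2)] by simp
  qed
qed

lemma convex_domain:
  assumes "u \<in> conv_coe" shows "convex {x. u x \<noteq> \<infinity>}"
  unfolding convex_alt
proof (intro ballI allI impI)
  fix x y and l :: real assume *: "x \<in> {x. u x \<noteq> \<infinity>}" "y \<in> {x. u x \<noteq> \<infinity>}" and l: "0 \<le> l \<and> l \<le> 1"
  obtain a b where ab: "u x = ereal a" "u y = ereal b"
    using * assms by (cases "u x"; cases "u y") (auto simp: conv_coe_def)
  then have "x \<in> sublevel u (max a b)" "y \<in> sublevel u (max a b)" by (auto simp: sublevel_def)
  then have "(1 - l) *\<^sub>R x + l *\<^sub>R y \<in> sublevel u (max a b)"
    using convex_sublevel[OF assms, of "max a b"] l by (auto simp: convex_alt)
  then have "u ((1 - l) *\<^sub>R x + l *\<^sub>R y) \<le> ereal (max a b)" by (simp add: sublevel_def del: ereal_max)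
  then show "(1 - l) *\<^sub>R x + l *\<^sub>R y \<in> {x. u x \<noteq> \<infinity>}"
    by (metis (mono_tags, lifting) PInfty_neq_ereal(1) ereal_infty_less_eq(1) mem_Collect_eq)
qed

text \<open>A convex function is continuous in the interior of its domain.\<close>

lemma interior_domain_in_interior_sublevel:
  fixes u :: "'a::euclidean_space \<Rightarrow> ereal"
  assumes u: "u \<in> conv_coe" and x: "x \<in> interior {x. u x \<noteq> \<infinity>}" and t: "u x < ereal t"
  shows "x \<in> interior (sublevel u t)"
proof -
  let ?D = "interior {x. u x \<noteq> \<infinity>}"
  define f where "f = real_of_ereal \<circ> u"
  have f: "u y = ereal (f y)" if "y \<in> ?D" for y
    using that interior_subset[of "{x. u x \<noteq> \<infinity>}"] u
    by (cases "u y") (auto simp: f_def conv_coe_def)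
  have cD: "convex ?D" by (intro convex_interior convex_domain u)
  have "convex_on ?D f"
  proof (rule convex_onI)
    fix l :: real and y z assume l: "0 < l" "l < 1" and yz: "y \<in> ?D" "z \<in> ?D"
    have "(1 - l) *\<^sub>R y + l *\<^sub>R z \<in> ?D" using cD l yz by (auto simp: convex_alt)
    moreover have "u ((1 - l) *\<^sub>R y + l *\<^sub>R z) \<le> ereal (1 - l) * u y + ereal l * u z"
      using u l unfolding conv_coe_def convex_ereal_def by auto
    ultimately show "f ((1 - l) *\<^sub>R y + l *\<^sub>R z) \<le> (1 - l) * f y + l * f z"
      using yz by (simp add: f)
  qed (rule cD)
  then have "continuous_on ?D f" by (intro convex_on_continuous) auto
  then have "open (?D \<inter> f -` {..<t})"
    by (intro continuous_open_preimage) auto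
  moreover have "?D \<inter> f -` {..<t} \<subseteq> sublevel u t" by (auto simp: sublevel_def f)
  moreover have "x \<in> ?D \<inter> f -` {..<t}" using x t by (simp add: f)
  ultimately show ?thesis by (meson interiorI)
qed

text \<open>Convergence can fail only on the boundary of the domain of \<open>u\<close>, and the boundary of a convex set is a
null set.\<close>

lemma epi_converges_AE:
  fixes u :: "'a::euclidean_space \<Rightarrow> ereal"
  assumes us: "\<And>k. us k \<in> conv_coe" and u: "u \<in> conv_coe" and ep: "epi_converges us u"
  shows "AE x in lborel. (\<lambda>k. us k x) \<longlonglongrightarrow> u x"
proof -
  let ?D = "{x. u x \<noteq> \<infinity>}"
  have "frontier ?D \<in> null_sets lborel"
    using negligible_convex_frontier[OF convex_domain[OF u]] negligible_iff_null_sets[of "frontier ?D"]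
    by (simp add: null_sets_completion_iff)
  then have "AE x in lborel. x \<notin> frontier ?D" by (rule AE_not_in)
  then show ?thesis
  proof eventually_elim
    case (elim x)
    show ?case
    proof (rule order_tendstoI)
      fix t assume "t < u x"
      then show "\<forall>\<^sub>F k in sequentially. t < us k x"
        by (rule epi_converges_pointwise_lower[OF us u ep])
    next
      fix t assume t: "u x < t"
      then have "x \<in> ?D" by auto
      then have "x \<in> interior ?D" using elim closure_subset[of ?D] by (auto simp: frontier_def)
      obtain s where s: "u x < ereal s" "ereal s < t" using ereal_dense2[OF t] by auto
      have "\<forall>\<^sub>F k in sequentially. us k x \<le> ereal s"
      proof (rule epi_converges_pointwise_upper[OF us u ep])
        show "x \<in> interior (sublevel u s)"
          by (rule interior_domain_in_interior_sublevel[OF u \<open>x \<in> interior ?D\<close> s(1)])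
        show "ereal s \<noteq> min_value u" using min_value_le[OF u, of x] s(1) by auto
      qed
      then show "\<forall>\<^sub>F k in sequentially. us k x < t"
        by eventually_elim (use s(2) in auto)
    qed
  qed
qed

lemma epi_continuous_integral:
  "epi_continuous (\<lambda>u::'a::euclidean_space \<Rightarrow> ereal. \<integral>x. exp_neg (u x) \<partial>lborel)"
  unfolding epi_continuous_def
proof (intro allI ballI impI)
  fix us and u :: "'a \<Rightarrow> ereal"
  assume u: "u \<in> conv_coe" and us': "\<forall>k. us k \<in> conv_coe" and ep: "epi_converges us u"
  note us = us'[rule_format]
  obtain a b where ab: "0 < a" "\<forall>\<^sub>F k in sequentially. \<forall>x. ereal (a * norm x - b) \<le> us k x"
    using uniform_linear_growth[OF us u ep] by blast
  then obtain N where N: "\<And>k x. N \<le> k \<Longrightarrow> ereal (a * norm x - b) \<le> us k x"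
    by (auto simp: eventually_sequentially)
  have "(\<lambda>k. \<integral>x. exp_neg (us (k + N) x) \<partial>lborel) \<longlonglongrightarrow> (\<integral>x. exp_neg (u x) \<partial>lborel)"
  proof (rule integral_dominated_convergence[OF _ _ integrable_exp_neg_norm[OF ab(1), of b]])
    show "(\<lambda>x. exp_neg (u x)) \<in> borel_measurable lborel" by (rule measurable_exp_neg_conv_coe[OF u])
    show "(\<lambda>x. exp_neg (us (k + N) x)) \<in> borel_measurable lborel" for k
      by (rule measurable_exp_neg_conv_coe[OF us])
    show "AE x in lborel. norm (exp_neg (us (k + N) x)) \<le> exp (b - a * norm x)" for k
      using exp_neg_le[OF N[of "k + N"]] by simp
    show "AE x in lborel. (\<lambda>k. exp_neg (us (k + N) x)) \<longlonglongrightarrow> exp_neg (u x)"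
      using epi_converges_AE[OF us u ep]
    proof eventually_elim
      case (elim x)
      then have "(\<lambda>k. us (k + N) x) \<longlonglongrightarrow> u x" by (rule LIMSEQ_ignore_initial_segment)
      then show ?case using u by (intro exp_neg_tendsto) (auto simp: conv_coe_def)
    qed
  qed
  then show "(\<lambda>k. \<integral>x. exp_neg (us k x) \<partial>lborel) \<longlonglongrightarrow> (\<integral>x. exp_neg (u x) \<partial>lborel)"
    by (rule LIMSEQ_offset)
qed

lemma det_shear:
  assumes "m \<noteq> (n::'n::finite)"
  shows "det (matrix (\<lambda>v::real^'n. \<chi> i. if i = m then v $ m + v $ n else v $ i)) = 1"
proof -
  have "matrix (\<lambda>v::real^'n. \<chi> i. if i = m then v $ m + v $ n else v $ i)
      = (\<chi> k. if k = m then row m (mat 1) + 1 *s row n (mat 1) else row k (mat 1))"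
    by (auto simp: vec_eq_iff matrix_def row_def mat_def axis_def)
  then show ?thesis using det_row_operation[OF assms, where c=1 and A="mat 1"] by simp
qed

lemma det_swap:
  assumes "m \<noteq> (n::'n::finite)"
  shows "det (matrix (\<lambda>v::real^'n. \<chi> i. v $ Transposition.transpose m n i)) = -1"
proof -
  have "matrix (\<lambda>v::real^'n. \<chi> i. v $ Transposition.transpose m n i)
      = transpose (\<chi> a b. mat 1 $ a $ Transposition.transpose m n b)"
    by (auto simp: vec_eq_iff matrix_def axis_def mat_def transpose_def)
  then show ?thesis using assms by (simp add: det_permute_columns permutes_swap_id sign_swap_id)
qed

lemma measure_shear_cbox:
  assumes "m \<noteq> (n::'n::finite)"
  shows "measure lebesgue ((\<lambda>v::real^'n. \<chi> i. if i = m then v $ m + v $ n else v $ i) ` cbox a b)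
    = measure lebesgue (cbox a b)" (is "measure lebesgue (?h ` _) = _")
proof (cases "cbox a b = {}")
  case False
  \<comment> \<open>After a translation the box lies in the half-space \<open>0 \<le> x $ n\<close>, as \<open>measure_shear_interval\<close> requires.\<close>
  let ?v = "(\<chi> i. if i = n then - a $ n else 0) :: real^'n"
  have lin: "linear ?h" by (rule linearI) (auto simp: vec_eq_iff algebra_simps)
  have tr: "(+) ?v ` cbox a b = cbox (?v + a) (?v + b)" by (rule cbox_translation[symmetric])
  have "?h ` (+) ?v ` cbox a b = (+) (?h ?v) ` ?h ` cbox a b"
    using linear_add[OF lin] by (auto simp: image_image)
  then have "measure lebesgue (?h ` cbox a b) = measure lebesgue (?h ` (+) ?v ` cbox a b)"
    by (simp add: measure_translation)
  also have "\<dots> = measure lebesgue (cbox (?v + a) (?v + b))"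
    unfolding tr using False tr by (intro measure_shear_interval assms) auto
  also have "\<dots> = measure lebesgue (cbox a b)"
    unfolding tr[symmetric] by (rule measure_translation)
  finally show ?thesis .
qed simp

text \<open>Both sides are multiplicative in \<open>f\<close>, so elementary maps suffice.\<close>

lemma measure_linear_image_cart:
  fixes f :: "real^'n \<Rightarrow> real^'n"
  assumes "linear f" "S \<in> lmeasurable"
  shows "f ` S \<in> lmeasurable \<and> measure lebesgue (f ` S) = \<bar>det (matrix f)\<bar> * measure lebesgue S"
proof -
  have "\<forall>S\<in>lmeasurable. f ` S \<in> lmeasurable \<and> measure lebesgue (f ` S) = \<bar>det (matrix f)\<bar> * measure lebesgue S"
  proof (rule induct_linear_elementary[OF assms(1)])
    fix f g :: "real^'n \<Rightarrow> real^'n"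
    assume *: "linear f" "linear g"
      "\<forall>S\<in>lmeasurable. f ` S \<in> lmeasurable \<and> measure lebesgue (f ` S) = \<bar>det (matrix f)\<bar> * measure lebesgue S"
      "\<forall>S\<in>lmeasurable. g ` S \<in> lmeasurable \<and> measure lebesgue (g ` S) = \<bar>det (matrix g)\<bar> * measure lebesgue S"
    then show "\<forall>S\<in>lmeasurable. (f \<circ> g) ` S \<in> lmeasurable
        \<and> measure lebesgue ((f \<circ> g) ` S) = \<bar>det (matrix (f \<circ> g))\<bar> * measure lebesgue S"
      unfolding image_comp[symmetric] by (simp add: matrix_compose det_mul abs_mult)
  next
    fix f :: "real^'n \<Rightarrow> real^'n" and i assume f: "linear f" "\<And>x. f x $ i = 0"
    have "f x \<noteq> axis i 1" for x
    proof
      assume "f x = axis i 1"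
      then have "f x $ i = 1" by simp
      with f(2) show False by simp
    qed
    then have "\<not> surj f" by (metis surjD)
    then have ninj: "\<not> inj f" using f(1) linear_injective_imp_surjective by blast
    then have "det (matrix f) = 0" using det_nz_iff_inj[OF f(1)] by blast
    moreover have "negligible (f ` S)" for S
      using negligible_linear_singular_image[OF f(1) ninj] .
    ultimately show "\<forall>S\<in>lmeasurable. f ` S \<in> lmeasurable \<and> measure lebesgue (f ` S) = \<bar>det (matrix f)\<bar> * measure lebesgue S"
      by (simp add: negligible_imp_measure0 negligible_imp_measurable)
  next
    fix c :: "'n \<Rightarrow> real"
    have "det (matrix (\<lambda>x. \<chi> i. c i * x $ i)) = prod c UNIV"
      by (subst det_diagonal) (auto simp: matrix_def axis_def)
    then show "\<forall>S\<in>lmeasurable. (\<lambda>x. \<chi> i. c i * x $ i) ` S \<in> lmeasurable \<and>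
        measure lebesgue ((\<lambda>x. \<chi> i. c i * x $ i) ` S) = \<bar>det (matrix (\<lambda>x. \<chi> i. c i * x $ i))\<bar> * measure lebesgue S"
      by (simp add: measurable_stretch measure_stretch)
  next
    fix m n :: 'n assume mn: "m \<noteq> n"
    let ?h = "\<lambda>v::real^'n. \<chi> i. v $ Transposition.transpose m n i"
    have lin: "linear ?h" by (rule linearI) (simp_all add: vec_eq_iff)
    have meq: "measure lebesgue (?h ` cbox a b) = 1 * measure lebesgue (cbox a b)" for a b
    proof (cases "cbox a b = {}")
      case False
      have inv: "?h (?h x) = x" for x by (simp add: vec_eq_iff)
      have mem: "?h x \<in> cbox (?h a) (?h b) \<longleftrightarrow> x \<in> cbox a b" for x
        by (simp add: mem_box_cart) (metis transpose_involutory)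
      have eq: "?h ` cbox a b = cbox (?h a) (?h b)"
      proof
        show "cbox (?h a) (?h b) \<subseteq> ?h ` cbox a b"
        proof
          fix y assume "y \<in> cbox (?h a) (?h b)"
          then have "?h y \<in> cbox a b" using mem[of "?h y"] unfolding inv by blast
          then show "y \<in> ?h ` cbox a b" using inv[of y] by (intro image_eqI[of _ ?h "?h y"]) simp_all
        qed
        show "?h ` cbox a b \<subseteq> cbox (?h a) (?h b)" using mem by blast
      qed
      then have "cbox (?h a) (?h b) \<noteq> {}" using False by auto
      then show ?thesis
        using prod.permute[OF permutes_swap_id, where S=UNIV and g="\<lambda>i. (b - a) $ i", of m n] False
        by (simp add: eq content_cbox_cart o_def)
    qed simp
    show "\<forall>S\<in>lmeasurable. ?h ` S \<in> lmeasurable \<and> measure lebesgue (?h ` S) = \<bar>det (matrix ?h)\<bar> * measure lebesgue S"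
    proof
      fix S :: "(real^'n) set" assume "S \<in> lmeasurable"
      from measure_linear_sufficient[OF lin this meq]
      show "?h ` S \<in> lmeasurable \<and> measure lebesgue (?h ` S) = \<bar>det (matrix ?h)\<bar> * measure lebesgue S"
        unfolding det_swap[OF mn] by simp
    qed
  next
    fix m n :: 'n assume mn: "m \<noteq> n"
    let ?h = "\<lambda>v::real^'n. \<chi> i. if i = m then v $ m + v $ n else v $ i"
    have lin: "linear ?h" by (rule linearI) (auto simp: vec_eq_iff algebra_simps)
    have meq: "measure lebesgue (?h ` cbox a b) = 1 * measure lebesgue (cbox a b)" for a b
      using measure_shear_cbox[OF mn] by simp
    show "\<forall>S\<in>lmeasurable. ?h ` S \<in> lmeasurable \<and> measure lebesgue (?h ` S) = \<bar>det (matrix ?h)\<bar> * measure lebesgue S"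
    proof
      fix S :: "(real^'n) set" assume "S \<in> lmeasurable"
      from measure_linear_sufficient[OF lin this meq]
      show "?h ` S \<in> lmeasurable \<and> measure lebesgue (?h ` S) = \<bar>det (matrix ?h)\<bar> * measure lebesgue S"
        unfolding det_shear[OF mn] by simp
    qed
  qed
  with assms(2) show ?thesis by blast
qed

lemma lborel_distr_SL:
  fixes A :: "real^'n^'n"
  assumes "\<bar>det A\<bar> = 1"
  shows "distr lborel borel ((*v) A) = lborel"
proof (rule lborel_eqI[symmetric])
  have "det A \<noteq> 0" using assms by auto
  then obtain B where AB: "A ** B = mat 1" "B ** A = mat 1" by (rule obtain_matrix_inverse)
  have "\<bar>det B\<bar> = 1" using AB(1) assms by (metis abs_mult det_I det_mul abs_1 mult_1)
  fix l u :: "real^'n" assume lu: "\<And>b. b \<in> Basis \<Longrightarrow> l \<bullet> b \<le> u \<bullet> b"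
  have pre: "(*v) A -` box l u = (*v) B ` box l u"
  proof
    show "(*v) A -` box l u \<subseteq> (*v) B ` box l u"
    proof
      fix x assume "x \<in> (*v) A -` box l u"
      then show "x \<in> (*v) B ` box l u"
        by (intro image_eqI[of _ _ "A *v x"]) (auto simp: matrix_vector_mul_assoc AB)
    qed
  qed (auto simp: matrix_vector_mul_assoc AB)
  have lm: "(*v) B ` box l u \<in> lmeasurable" "measure lebesgue ((*v) B ` box l u) = measure lebesgue (box l u)"
    using measure_linear_image_cart[of "(*v) B" "box l u"] \<open>\<bar>det B\<bar> = 1\<close>
    by (auto simp: matrix_vector_mul_linear)
  have meas: "(*v) A \<in> borel_measurable borel"
    by (intro borel_measurable_continuous_onI matrix_vector_mult_linear_continuous_on)
  then have bs: "(*v) B ` box l u \<in> sets borel"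
    unfolding pre[symmetric] using measurable_sets[OF meas, of "box l u"] by simp
  have "emeasure (distr lborel borel ((*v) A)) (box l u) = emeasure lborel ((*v) B ` box l u)"
    using meas by (simp add: emeasure_distr pre)
  also have "\<dots> = emeasure lebesgue ((*v) B ` box l u)" using bs by simp
  also have "\<dots> = ennreal (measure lebesgue (box l u))"
    using lm by (simp add: emeasure_eq_measure2)
  also have "\<dots> = emeasure lebesgue (box l u)"
    by (subst emeasure_eq_measure2) auto
  also have "\<dots> = (\<Prod>b\<in>Basis. (u - l) \<bullet> b)" using lu by simp
  finally show "emeasure (distr lborel borel ((*v) A)) (box l u) = (\<Prod>b\<in>Basis. (u - l) \<bullet> b)" .
qed simp

lemma admissible_integral:
  "admissible (\<lambda>u::real^'n \<Rightarrow> ereal. \<integral>x. exp_neg (u x) \<partial>lborel)"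
  unfolding admissible_def
proof (intro conjI)
  show "epi_continuous (\<lambda>u::real^'n \<Rightarrow> ereal. \<integral>x. exp_neg (u x) \<partial>lborel)"
    by (rule epi_continuous_integral)
  show "SL_invariant (\<lambda>u::real^'n \<Rightarrow> ereal. \<integral>x. exp_neg (u x) \<partial>lborel)"
    unfolding SL_invariant_def
  proof (intro ballI allI impI)
    fix u :: "real^'n \<Rightarrow> ereal" and A :: "real^'n^'n" assume u: "u \<in> conv_coe" and A: "det A = 1"
    have "det A \<noteq> 0" using A by simp
    then obtain B where inv: "inv ((*v) A) = (*v) B" by (rule obtain_matrix_inverse)
    have bij: "bij ((*v) A)" using A by (intro invertible_eq_bij[THEN iffD1]) (simp add: invertible_det_nz)
    have meas: "(*v) A \<in> borel_measurable borel" "(*v) B \<in> borel_measurable borel"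
      by (intro borel_measurable_continuous_onI matrix_vector_mult_linear_continuous_on)+
    have "(\<integral>x. exp_neg ((u \<circ> inv ((*v) A)) x) \<partial>lborel)
        = (\<integral>x. exp_neg ((u \<circ> inv ((*v) A)) x) \<partial>distr lborel borel ((*v) A))"
      using A by (simp add: lborel_distr_SL)
    also have "\<dots> = (\<integral>x. exp_neg ((u \<circ> inv ((*v) A)) (A *v x)) \<partial>lborel)"
    proof (rule integral_distr)
      show "(*v) A \<in> lborel \<rightarrow>\<^sub>M borel" using meas by simp
      have "u \<circ> inv ((*v) A) \<in> borel_measurable borel"
        unfolding inv by (rule measurable_comp[OF meas(2) borel_measurable_conv_coe[OF u]])
      then show "(\<lambda>x. exp_neg ((u \<circ> inv ((*v) A)) x)) \<in> borel_measurable borel"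
        by (rule measurable_compose) simp
    qed
    also have "\<dots> = (\<integral>x. exp_neg (u x) \<partial>lborel)"
      using bij by (simp add: inv_f_f bij_is_inj)
    finally show "(\<integral>x. exp_neg ((u \<circ> inv ((*v) A)) x) \<partial>lborel) = (\<integral>x. exp_neg (u x) \<partial>lborel)" .
  qed
  show "translation_invariant (\<lambda>u::real^'n \<Rightarrow> ereal. \<integral>x. exp_neg (u x) \<partial>lborel)"
    unfolding translation_invariant_def
  proof (intro ballI allI)
    fix u :: "real^'n \<Rightarrow> ereal" and a assume u: "u \<in> conv_coe"
    have "(\<integral>x. exp_neg ((u \<circ> inv (\<lambda>x. x + a)) x) \<partial>lborel) = (\<integral>x. exp_neg (u (x - a)) \<partial>lborel)"
      by (simp add: inv_translation)
    also have "\<dots> = (\<integral>x. exp_neg (u (x - a)) \<partial>distr lborel borel ((+) a))"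
      by (simp add: lborel_distr_plus)
    also have "\<dots> = (\<integral>x. exp_neg (u (a + x - a)) \<partial>lborel)"
    proof (rule integral_distr)
      have "(\<lambda>x. u (x - a)) \<in> borel_measurable borel"
        by (rule measurable_compose[OF _ borel_measurable_conv_coe[OF u]]) simp
      then show "(\<lambda>x. exp_neg (u (x - a))) \<in> borel_measurable borel"
        by (rule measurable_compose) simp
    qed simp
    finally show "(\<integral>x. exp_neg ((u \<circ> inv (\<lambda>x. x + a)) x) \<partial>lborel) = (\<integral>x. exp_neg (u x) \<partial>lborel)"
      by simp
  qed
  show "valuation (\<lambda>u::real^'n \<Rightarrow> ereal. \<integral>x. exp_neg (u x) \<partial>lborel)"
    unfolding valuation_def
  proof (intro ballI impI)
    fix u v :: "real^'n \<Rightarrow> ereal"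
    assume *: "u \<in> conv_coe" "v \<in> conv_coe"
      "(\<lambda>x. min (u x) (v x)) \<in> conv_coe" "(\<lambda>x. max (u x) (v x)) \<in> conv_coe"
    show "(\<integral>x. exp_neg (u x) \<partial>lborel) + (\<integral>x. exp_neg (v x) \<partial>lborel) =
        (\<integral>x. exp_neg (min (u x) (v x)) \<partial>lborel) + (\<integral>x. exp_neg (max (u x) (v x)) \<partial>lborel)"
      using *[THEN integrable_exp_neg]
      by (subst (1 2) Bochner_Integration.integral_add[symmetric]) (auto simp: exp_neg_min_max[symmetric])
  qed
  show "exp_homogeneous (\<lambda>u::real^'n \<Rightarrow> ereal. \<integral>x. exp_neg (u x) \<partial>lborel)"
    unfolding exp_homogeneous_def by (auto simp: exp_neg_add conv_coe_def)
qed

section \<open>Linear functions on simplicial cones\<close>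

text \<open>Composed with linear automorphisms these are the functions that are linear on a simplicial cone of
dimension \<open>card J\<close>, positive off the apex, and infinite outside; \<open>J = {}\<close> gives the indicator of the
origin.\<close>

definition orthant_fun :: "'n set \<Rightarrow> real^'n \<Rightarrow> ereal" where
  "orthant_fun J = extended {t. \<forall>i. 0 \<le> t $ i \<and> (i \<notin> J \<longrightarrow> t $ i = 0)} (\<lambda>t. \<Sum>i\<in>UNIV. t $ i)"

lemma norm_le_orthant_sum: "(\<And>i. 0 \<le> t $ i) \<Longrightarrow> norm t \<le> (\<Sum>i\<in>UNIV. (t::real^'n) $ i)"
  using norm_le_l1_cart[of t] by simp

lemma orthant_fun_conv_coe: "orthant_fun (J::'n::finite set) \<in> conv_coe"
  unfolding orthant_fun_def
proof (rule extended_in_conv_coe)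
  let ?K = "{t::real^'n. \<forall>i. 0 \<le> t $ i \<and> (i \<notin> J \<longrightarrow> t $ i = 0)}"
  show "closed ?K"
    by (intro closed_Collect_all closed_Collect_conj closed_Collect_imp closed_Collect_le
        closed_Collect_eq continuous_intros open_Collect_const)
  show K: "convex ?K" by (auto simp: convex_alt)
  have "0 \<in> ?K" by simp
  then show "?K \<noteq> {}" by blast
  show "convex_on ?K (\<lambda>t. \<Sum>i\<in>UNIV. t $ i)"
    by (rule convex_onI) (use K in \<open>auto simp: sum.distrib sum_distrib_left\<close>)
  show "continuous_on ?K (\<lambda>t. \<Sum>i\<in>UNIV. t $ i)" by (intro continuous_intros)
  show "bounded {x \<in> ?K. (\<Sum>i\<in>UNIV. x $ i) \<le> t}" for t
    unfolding bounded_iff by (rule exI[of _ t]) (auto intro: order_trans[OF norm_le_orthant_sum])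
qed

lemma det_scaleR_mat_1: "det (c *\<^sub>R mat 1 :: real^'n^'n) = c ^ CARD('n)"
  by (subst det_diagonal) (auto simp: mat_def)

lemma scaleR_mat_1_mult: "(c *\<^sub>R mat 1 :: real^'n^'n) *v x = c *\<^sub>R x"
  by (simp add: scaleR_matrix_vector_assoc[symmetric])

lemma orthant_fun_scaled_conv_coe: "0 < c \<Longrightarrow> (\<lambda>x. orthant_fun J (c *\<^sub>R x)) \<in> conv_coe"
  using conv_coe_comp_matrix[OF orthant_fun_conv_coe, of "c *\<^sub>R mat 1" J]
  by (simp add: det_scaleR_mat_1 scaleR_mat_1_mult)

text \<open>As the slope grows, every sublevel set at a non-negative level shrinks to the origin.\<close>

lemma orthant_fun_steep:
  fixes c :: "nat \<Rightarrow> real" and J :: "'n::finite set"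
  assumes c: "filterlim c at_top sequentially" "\<And>k. 0 < c k"
  shows "epi_converges (\<lambda>k x. orthant_fun J (c k *\<^sub>R x)) (orthant_fun {})"
proof (rule epi_convergesI)
  show "(\<lambda>x. orthant_fun J (c k *\<^sub>R x)) \<in> conv_coe" for k
    by (rule orthant_fun_scaled_conv_coe[OF c(2)])
  show "orthant_fun {} \<in> conv_coe" by (rule orthant_fun_conv_coe)
next
  fix x :: "real^'n" and t assume t: "ereal t < orthant_fun {} x"
  show "\<exists>N. open N \<and> x \<in> N \<and> (\<forall>\<^sub>F k in sequentially. \<forall>y\<in>N. ereal t < orthant_fun J (c k *\<^sub>R y))"
  proof (cases "x = 0")
    case True
    then have "t < 0" using t by (simp add: orthant_fun_def extended_def)
    then have "ereal t < orthant_fun J y" for y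
      by (auto simp: orthant_fun_def extended_def intro: less_le_trans[OF _ sum_nonneg])
    then show ?thesis by (intro exI[of _ UNIV]) auto
  next
    case False
    have "\<forall>\<^sub>F k in sequentially. 2 * \<bar>t\<bar> / norm x < c k"
      using c(1) by (simp add: filterlim_at_top_dense)
    then have "\<forall>\<^sub>F k in sequentially. \<forall>y\<in>{y. norm x / 2 < norm y}. ereal t < orthant_fun J (c k *\<^sub>R y)"
    proof eventually_elim
      case (elim k)
      show ?case
      proof
        fix y :: "real^'n" assume y: "y \<in> {y. norm x / 2 < norm y}"
        have "t < (\<Sum>i\<in>UNIV. (c k *\<^sub>R y) $ i)" if "\<And>i. 0 \<le> (c k *\<^sub>R y) $ i"
        proof -
          have "\<bar>t\<bar> < c k * (norm x / 2)" using elim False by (simp add: field_simps)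
          also have "\<dots> \<le> c k * norm y" using y c(2)[of k] by (intro mult_left_mono) auto
          also have "\<dots> = norm (c k *\<^sub>R y)" using c(2)[of k] by simp
          also have "\<dots> \<le> (\<Sum>i\<in>UNIV. (c k *\<^sub>R y) $ i)" by (rule norm_le_orthant_sum[OF that])
          finally show ?thesis by linarith
        qed
        then show "ereal t < orthant_fun J (c k *\<^sub>R y)"
          unfolding orthant_fun_def extended_def by auto
      qed
    qed
    moreover have "open {y. norm x / 2 < norm y}" by (intro open_Collect_less continuous_intros)
    ultimately show ?thesis using False by (intro exI[of _ "{y. norm x / 2 < norm y}"]) auto
  qed
next
  fix x :: "real^'n" and t e :: real assume t: "orthant_fun {} x < ereal t" "0 < e"
  then have "x = 0" "0 < t"
    by (auto simp: orthant_fun_def extended_def vec_eq_iff split: if_splits)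
  then have "\<exists>y\<in>ball x e. orthant_fun J (c k *\<^sub>R y) \<le> ereal t" for k
    using t(2) by (intro bexI[of _ 0]) (auto simp: orthant_fun_def extended_def)
  then show "\<forall>\<^sub>F k in sequentially. \<exists>y\<in>ball x e. orthant_fun J (c k *\<^sub>R y) \<le> ereal t"
    by simp
qed

lemma admissible_steep_tendsto:
  assumes Z: "admissible Z" and c: "filterlim c at_top sequentially" "\<And>k. 0 < c k"
  shows "(\<lambda>k. Z (\<lambda>x. orthant_fun J (c k *\<^sub>R x))) \<longlonglongrightarrow> Z (orthant_fun {})"
  by (rule admissible_tendsto[OF Z orthant_fun_scaled_conv_coe[OF c(2)] orthant_fun_conv_coe orthant_fun_steep[OF c]])

text \<open>A coordinate outside \<open>J\<close> is zero on the cone, so rescaling it changes the determinant of \<open>B\<close> but not the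
function.  Hence the value does not depend on \<open>B\<close> at all, and it is found by letting the slope grow.\<close>

lemma admissible_proper_face_cone:
  fixes B :: "real^'n^'n"
  assumes Z: "admissible Z" and J: "J \<noteq> UNIV" and B: "det B \<noteq> 0"
  shows "Z (\<lambda>x. orthant_fun J (B *v x)) = Z (orthant_fun {})"
proof -
  have indep: "Z (\<lambda>x. orthant_fun J (C *v x)) = Z (orthant_fun J)" if C: "det C \<noteq> 0" for C :: "real^'n^'n"
  proof -
    obtain i where i: "i \<notin> J" using J by auto
    define D :: "real^'n^'n" where "D = (\<chi> a b. if a = b then (if a = i then det C else 1) else 0)"
    have "det D = (\<Prod>a\<in>UNIV. if a = i then det C else 1)"
      unfolding D_def by (subst det_diagonal) auto
    then have detD: "det D = det C" by simp
    have Dx: "(D *v x) $ a = (if a = i then det C else 1) * x $ a" for x a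
    proof -
      have "(D *v x) $ a = (\<Sum>b\<in>UNIV. D $ a $ b * x $ b)" by (simp add: matrix_vector_mult_def)
      also have "\<dots> = (\<Sum>b\<in>UNIV. if b = a then (if a = i then det C else 1) * x $ a else 0)"
        by (rule sum.cong) (auto simp: D_def)
      finally show ?thesis by simp
    qed
    have "orthant_fun J (D *v x) = orthant_fun J x" for x
    proof (cases "x $ i = 0")
      case True
      then have "D *v x = x" by (simp add: vec_eq_iff Dx)
      then show ?thesis by simp
    next
      case False
      then have "(D *v x) $ i \<noteq> 0" using C by (simp add: Dx)
      then show ?thesis using False i unfolding orthant_fun_def extended_def
        by (smt (verit) mem_Collect_eq)
    qed
    then show ?thesis
      using admissible_cong_det[OF Z orthant_fun_conv_coe, of C D J] C detD by simp
  qed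
  have eq: "Z (\<lambda>x. orthant_fun J ((real k + 1) *\<^sub>R x)) = Z (orthant_fun J)" for k
    using indep[of "(real k + 1) *\<^sub>R mat 1"] by (simp add: det_scaleR_mat_1 scaleR_mat_1_mult)
  have "filterlim (\<lambda>k. real k + 1) at_top sequentially"
    by (rule filterlim_at_top_mono[OF filterlim_real_sequentially]) auto
  from admissible_steep_tendsto[OF Z this, of J]
  have "(\<lambda>k. Z (orthant_fun J)) \<longlonglongrightarrow> Z (orthant_fun {})" by (simp add: eq)
  then have "Z (orthant_fun J) = Z (orthant_fun {})" by (simp add: LIMSEQ_const_iff)
  with indep[OF B] show ?thesis by simp
qed

text \<open>The inverse of the linear map that sends the unit vector \<open>e\<^sub>j\<close> to the point \<open>(1 - l) e\<^sub>i + l e\<^sub>j\<close> and fixes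
the other unit vectors.  The hyperplane through this point and the other unit vectors cuts the
orthant into two simplicial cones; this map straightens the one that contains \<open>e\<^sub>i\<close>, and the same map
with \<open>i, j\<close> exchanged and \<open>1 - l\<close> for \<open>l\<close> straightens the other one.  Since the point has coordinate sum
one, coordinate sums are preserved.\<close>

definition split_map :: "'n \<Rightarrow> 'n \<Rightarrow> real \<Rightarrow> real^'n \<Rightarrow> real^'n" where
  "split_map i j l t = (\<chi> a. if a = j then t $ j / l else if a = i then t $ i - (1 - l) / l * t $ j else t $ a)"

lemma linear_split_map: "linear (split_map i j l)"
  by (rule linearI) (auto simp: split_map_def vec_eq_iff algebra_simps add_divide_distrib diff_divide_distrib)

lemma det_split_map:
  assumes "i \<noteq> (j::'n::finite)" "l \<noteq> 0"
  shows "det (matrix (split_map i j l)) = 1 / l"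
proof -
  define D :: "real^'n^'n" where "D = (\<chi> a b. if a = b then (if a = j then 1 / l else 1) else 0)"
  have "det D = (\<Prod>a\<in>UNIV. if a = j then 1 / l else 1)"
    unfolding D_def by (subst det_diagonal) auto
  then have "det D = 1 / l" by simp
  moreover have "matrix (split_map i j l) = (\<chi> k. if k = i then row i D + (- (1 - l)) *s row j D else row k D)"
    using assms by (auto simp: vec_eq_iff matrix_def row_def D_def axis_def split_map_def field_simps)
  ultimately show ?thesis using det_row_operation[OF assms(1), of D "- (1 - l)"] by simp
qed

lemma sum_split_map:
  assumes "i \<noteq> (j::'n::finite)" "l \<noteq> 0"
  shows "(\<Sum>a\<in>UNIV. split_map i j l t $ a) = (\<Sum>a\<in>UNIV. t $ a)"
proof -
  let ?d = "(1 - l) / l * t $ j"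
  have "split_map i j l t $ a = t $ a + ((if a = j then ?d else 0) - (if a = i then ?d else 0))" for a
    using assms by (auto simp: split_map_def field_simps)
  then show ?thesis by (simp add: sum.distrib sum_subtractf)
qed

lemma orthant_fun_split:
  assumes ij: "i \<noteq> (j::'n::finite)" and l: "0 < l" "l < 1"
  shows "min (orthant_fun UNIV (split_map i j l t)) (orthant_fun UNIV (split_map j i (1 - l) t)) = orthant_fun UNIV t"
    and "max (orthant_fun UNIV (split_map i j l t)) (orthant_fun UNIV (split_map j i (1 - l) t))
      = orthant_fun (UNIV - {i}) (split_map i j l t)"
proof -
  let ?R = "\<forall>a. a \<noteq> i \<and> a \<noteq> j \<longrightarrow> 0 \<le> t $ a"
  let ?c = "(1 - l) / l * t $ j" and ?d = "l / (1 - l) * t $ i"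
  have all: "(\<forall>a. P a) \<longleftrightarrow> (\<forall>a. a \<noteq> i \<and> a \<noteq> j \<longrightarrow> P a) \<and> P i \<and> P j" for P :: "'n \<Rightarrow> bool"
    by metis
  have 1: "(\<forall>a. 0 \<le> split_map i j l t $ a) \<longleftrightarrow> ?R \<and> 0 \<le> t $ j \<and> ?c \<le> t $ i" (is "?P1 = _")
    using ij l by (subst all) (auto simp: split_map_def zero_le_divide_iff)
  have 2: "(\<forall>a. 0 \<le> split_map j i (1 - l) t $ a) \<longleftrightarrow> ?R \<and> 0 \<le> t $ i \<and> ?d \<le> t $ j" (is "?P2 = _")
    using ij l by (subst all) (auto simp: split_map_def zero_le_divide_iff)
  have 3: "(\<forall>a. 0 \<le> t $ a) \<longleftrightarrow> ?R \<and> 0 \<le> t $ i \<and> 0 \<le> t $ j" (is "?P = _")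
    by auto
  have 4: "0 \<le> t $ j \<Longrightarrow> 0 \<le> ?c" "0 \<le> t $ i \<Longrightarrow> 0 \<le> ?d" using l by auto
  have 5: "?c \<le> t $ i \<longleftrightarrow> (1 - l) * t $ j \<le> l * t $ i" "?d \<le> t $ j \<longleftrightarrow> l * t $ i \<le> (1 - l) * t $ j"
    "split_map i j l t $ i = 0 \<longleftrightarrow> (1 - l) * t $ j = l * t $ i"
    using l ij by (auto simp: split_map_def field_simps)
  have "?c \<le> t $ i \<Longrightarrow> 0 \<le> t $ j \<Longrightarrow> 0 \<le> t $ i" "?d \<le> t $ j \<Longrightarrow> 0 \<le> t $ i \<Longrightarrow> 0 \<le> t $ j"
    using 4 by linarith+
  moreover have "?c \<le> t $ i \<or> ?d \<le> t $ j"
    "?c \<le> t $ i \<and> split_map i j l t $ i = 0 \<longleftrightarrow> ?c \<le> t $ i \<and> ?d \<le> t $ j"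
    unfolding 5 by auto
  ultimately have 6: "?c \<le> t $ i \<Longrightarrow> 0 \<le> t $ j \<Longrightarrow> 0 \<le> t $ i"
    "?d \<le> t $ j \<Longrightarrow> 0 \<le> t $ i \<Longrightarrow> 0 \<le> t $ j" "?c \<le> t $ i \<or> ?d \<le> t $ j"
    "?c \<le> t $ i \<and> split_map i j l t $ i = 0 \<longleftrightarrow> ?c \<le> t $ i \<and> ?d \<le> t $ j"
    by blast+
  have P: "?P \<longleftrightarrow> ?P1 \<or> ?P2" unfolding 1 2 3 using 6 by blast
  have Q: "?P1 \<and> split_map i j l t $ i = 0 \<longleftrightarrow> ?P1 \<and> ?P2" unfolding 1 2 using 6 by blast
  have s: "(\<Sum>a\<in>UNIV. split_map i j l t $ a) = (\<Sum>a\<in>UNIV. t $ a)"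
    "(\<Sum>a\<in>UNIV. split_map j i (1 - l) t $ a) = (\<Sum>a\<in>UNIV. t $ a)"
    using ij l by (auto intro!: sum_split_map)
  have o: "orthant_fun UNIV y = (if \<forall>a. 0 \<le> y $ a then ereal (\<Sum>a\<in>UNIV. y $ a) else \<infinity>)"
    "orthant_fun (UNIV - {i}) y = (if (\<forall>a. 0 \<le> y $ a) \<and> y $ i = 0 then ereal (\<Sum>a\<in>UNIV. y $ a) else \<infinity>)" for y :: "real^'n"
    by (auto simp: orthant_fun_def extended_def)
  show "min (orthant_fun UNIV (split_map i j l t)) (orthant_fun UNIV (split_map j i (1 - l) t)) = orthant_fun UNIV t"
    unfolding o s using P by auto
  show "max (orthant_fun UNIV (split_map i j l t)) (orthant_fun UNIV (split_map j i (1 - l) t))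
      = orthant_fun (UNIV - {i}) (split_map i j l t)"
    unfolding o s using Q by auto
qed

lemma additive_pos_zero_on_Rats:
  fixes f :: "real \<Rightarrow> real"
  assumes add: "\<And>x y. 0 < x \<Longrightarrow> 0 < y \<Longrightarrow> f (x + y) = f x + f y" and f1: "f 1 = 0"
    and q: "q \<in> \<rat>" "0 < q"
  shows "f q = 0"
proof -
  have mul: "f (real (Suc k) * x) = real (Suc k) * f x" if "0 < x" for k x
  proof (induction k)
    case (Suc k)
    have "f (real (Suc (Suc k)) * x) = f (real (Suc k) * x + x)" by (simp add: algebra_simps)
    also have "\<dots> = f (real (Suc k) * x) + f x" using that by (intro add) auto
    finally show ?case using Suc by (simp add: algebra_simps)
  qed simp
  obtain a b :: nat where "b \<noteq> 0" "\<bar>q\<bar> = real a / real b"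
    using Rats_abs_nat_div_natE[OF q(1)] by blast
  then have ab: "q = real a / real b" "0 < b" "0 < a"
    using q(2) by (auto intro: Nat.gr0I)
  have "0 = f (real (Suc (b - 1)) * (1 / real b))" using ab f1 by simp
  also have "\<dots> = real b * f (1 / real b)" using mul[of "1 / real b" "b - 1"] ab by simp
  finally have "f (1 / real b) = 0" using ab by simp
  then show ?thesis using mul[of "1 / real b" "a - 1"] ab by simp
qed

text \<open>For the full orthant let \<open>f d\<close> be the value at a matrix of determinant \<open>1 / d\<close>, i.e. for a cone whose
generators have determinant \<open>d\<close>.  Splitting the cone gives \<open>f d = f (l d) + f ((1 - l) d)\<close>, since the
common face contributes zero.  So \<open>f\<close> is additive; it is zero at \<open>1\<close>, hence at the positive rationals,
and tends to zero at \<open>0\<close> because the functions become steep.  Writing \<open>x\<close> as a rational plus a small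
remainder gives \<open>f x = 0\<close>.  Negative determinants are reduced to positive ones by exchanging two
coordinates, which needs \<open>n \<ge> 2\<close>, as does the splitting.\<close>

lemma admissible_zero_on_cones:
  fixes Z :: "(real^'n \<Rightarrow> ereal) \<Rightarrow> real" and B :: "real^'n^'n"
  assumes n: "CARD('n) \<ge> 2" and Z: "admissible Z"
    and Z0: "Z (orthant_fun {}) = 0" and Z1: "Z (orthant_fun UNIV) = 0" and B: "det B \<noteq> 0"
  shows "Z (\<lambda>x. orthant_fun J (B *v x)) = 0"
proof (cases "J = UNIV")
  case False
  then show ?thesis using admissible_proper_face_cone[OF Z _ B] Z0 by simp
next
  case True
  obtain i j :: 'n where ij: "i \<noteq> j"
    using n by (metis (full_types) One_nat_def card_le_Suc0_iff_eq finite iso_tuple_UNIV_I not_less_eq_eq numeral_2_eq_2)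
  define F :: "real^'n^'n \<Rightarrow> real" where "F = (\<lambda>C. Z (\<lambda>x. orthant_fun UNIV (C *v x)))"
  have F_det: "F C = F D" if "det C = det D" "det D \<noteq> 0" for C D
    unfolding F_def by (rule admissible_cong_det[OF Z orthant_fun_conv_coe that])
  define C :: "real \<Rightarrow> real^'n^'n" where "C d = root CARD('n) (1 / d) *\<^sub>R mat 1" for d
  have detC: "det (C d) = 1 / d" if "0 < d" for d
    using that unfolding C_def by (simp add: det_scaleR_mat_1 real_root_pow_pos2)
  define f where "f d = F (C d)" for d
  have split: "f d = f (l * d) + f ((1 - l) * d)" if d: "0 < d" and l: "0 < l" "l < 1" for d l
  proof -
    let ?B1 = "matrix (split_map i j l)" and ?B2 = "matrix (split_map j i (1 - l))"
    have B1: "?B1 *v x = split_map i j l x" and B2: "?B2 *v x = split_map j i (1 - l) x" for x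
      by (simp_all add: linear_split_map)
    have det1: "det ?B1 = 1 / l" "det ?B2 = 1 / (1 - l)"
      using ij l by (auto intro!: det_split_map)
    have dets: "det (?B1 ** C d) = det (C (l * d))" "det (?B2 ** C d) = det (C ((1 - l) * d))"
      using d l by (simp_all add: det_mul det1 detC)
    have nz: "det (C d) \<noteq> 0" "det (C (l * d)) \<noteq> 0" "det (C ((1 - l) * d)) \<noteq> 0"
      using d l by (simp_all add: detC)
    let ?u = "\<lambda>x. orthant_fun UNIV ((?B1 ** C d) *v x)"
    let ?v = "\<lambda>x. orthant_fun UNIV ((?B2 ** C d) *v x)"
    have mn: "(\<lambda>x. min (?u x) (?v x)) = (\<lambda>x. orthant_fun UNIV (C d *v x))"
      using orthant_fun_split(1)[OF ij l] by (simp flip: matrix_vector_mul_assoc add: B1 B2)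
    have mx: "(\<lambda>x. max (?u x) (?v x)) = (\<lambda>x. orthant_fun (UNIV - {i}) ((?B1 ** C d) *v x))"
      using orthant_fun_split(2)[OF ij l] by (simp flip: matrix_vector_mul_assoc add: B1 B2)
    have "Z ?u + Z ?v = Z (\<lambda>x. min (?u x) (?v x)) + Z (\<lambda>x. max (?u x) (?v x))"
    proof -
      have "?u \<in> conv_coe" "?v \<in> conv_coe" "(\<lambda>x. min (?u x) (?v x)) \<in> conv_coe"
        "(\<lambda>x. max (?u x) (?v x)) \<in> conv_coe"
        unfolding mn mx by (intro conv_coe_comp_matrix orthant_fun_conv_coe; simp add: dets nz)+
      then show ?thesis by (rule admissible_valuation[OF Z])
    qed
    moreover have "Z (\<lambda>x. max (?u x) (?v x)) = 0"
      unfolding mx using admissible_proper_face_cone[OF Z, of "UNIV - {i}" "?B1 ** C d"] dets nz Z0 by auto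
    moreover have "Z ?u = f (l * d)" "Z ?v = f ((1 - l) * d)"
      unfolding f_def F_def[symmetric] using dets nz by (auto intro!: F_det simp flip: F_def fun_cong[OF F_def])
    ultimately show ?thesis by (simp add: mn f_def F_def)
  qed
  have add: "f (x + y) = f x + f y" if "0 < x" "0 < y" for x y
  proof -
    have "x / (x + y) * (x + y) = x" "(1 - x / (x + y)) * (x + y) = y"
      using that by (simp_all add: field_simps)
    then show ?thesis using split[of "x + y" "x / (x + y)"] that by simp
  qed
  have f1: "f 1 = 0" using Z1 by (simp add: f_def F_def C_def)
  have frat: "f q = 0" if "q \<in> \<rat>" "0 < q" for q
    by (rule additive_pos_zero_on_Rats[OF add f1 that])
  have f0: "f x = 0" if x: "0 < x" for x
  proof -
    let ?n = "CARD('n)"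
    have "\<exists>q\<in>\<rat>. max 0 (x - 1 / (real k + 1) ^ ?n) < q \<and> q < x" for k
      using x by (intro Rats_dense_in_real) auto
    then obtain q where q: "\<And>k. q k \<in> \<rat>" "\<And>k. 0 < q k" "\<And>k. x - 1 / (real k + 1) ^ ?n < q k" "\<And>k. q k < x"
      by (metis max_less_iff_conj)
    \<comment> \<open>The orthant scaled by \<open>c k\<close> realises the determinant belonging to the remainder \<open>x - q k\<close>.\<close>
    define c where "c k = root ?n (1 / (x - q k))" for k
    have c: "real k + 1 \<le> c k" for k
    proof -
      have "x - q k \<le> 1 / (real k + 1) ^ ?n" using q(3)[of k] by linarith
      then have "(real k + 1) ^ ?n \<le> 1 / (x - q k)" using q(4)[of k] by (simp add: field_simps)
      then have "root ?n ((real k + 1) ^ ?n) \<le> c k" unfolding c_def by (intro real_root_le_mono) auto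
      then show ?thesis by (simp add: real_root_power_cancel)
    qed
    have "filterlim c at_top sequentially"
      by (rule filterlim_at_top_mono[OF filterlim_real_sequentially])
         (use c in \<open>auto intro!: always_eventually order_trans[OF _ c]\<close>)
    moreover have "0 < c k" for k using c[of k] by linarith
    ultimately have "(\<lambda>k. Z (\<lambda>x. orthant_fun UNIV (c k *\<^sub>R x))) \<longlonglongrightarrow> 0"
      using admissible_steep_tendsto[OF Z] Z0 by metis
    moreover have "Z (\<lambda>x. orthant_fun UNIV (c k *\<^sub>R x)) = f x" for k
    proof -
      have "f x = f (q k + (x - q k))" by simp
      also have "\<dots> = f (q k) + f (x - q k)" using q by (intro add) auto
      also have "\<dots> = f (x - q k)" using frat q by simp
      finally show ?thesis by (simp add: f_def F_def C_def c_def scaleR_mat_1_mult)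
    qed
    ultimately show ?thesis by (simp add: LIMSEQ_const_iff)
  qed
  show ?thesis
  proof (cases "0 < det B")
    case True
    then have "F B = F (C (1 / det B))" by (intro F_det) (auto simp: detC)
    then show ?thesis using f0[of "1 / det B"] True \<open>J = UNIV\<close> by (simp add: f_def F_def)
  next
    case False
    let ?h = "\<lambda>v::real^'n. \<chi> a. v $ Transposition.transpose i j a"
    define P where "P = matrix ?h"
    have lin: "linear ?h" by (rule linearI) (simp_all add: vec_eq_iff)
    have Px: "P *v x = ?h x" for x unfolding P_def using lin by simp
    have detP: "det P = -1" unfolding P_def by (rule det_swap[OF ij])
    have sumP: "(\<Sum>a\<in>UNIV. (P *v x) $ a) = (\<Sum>a\<in>UNIV. x $ a)" for x
      unfolding Px using sum.permute[OF permutes_swap_id, of i UNIV j "\<lambda>a. x $ a"] by (simp add: o_def)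
    have posP: "(\<forall>a. 0 \<le> (P *v x) $ a) \<longleftrightarrow> (\<forall>a. 0 \<le> x $ a)" for x
      unfolding Px by simp (metis transpose_involutory)
    have "orthant_fun UNIV (P *v x) = orthant_fun UNIV x" for x
      using posP[of x] sumP[of x] by (simp add: orthant_fun_def extended_def)
    then have "F (P ** B) = F B" by (simp add: F_def flip: matrix_vector_mul_assoc)
    moreover have "F (P ** B) = F (C (- 1 / det B))"
      using False B by (intro F_det) (auto simp: detC detP det_mul)
    ultimately show ?thesis using f0[of "- 1 / det B"] False B \<open>J = UNIV\<close>
      by (simp add: f_def F_def divide_neg_neg)
  qed
qed

definition vanishes_on_cones :: "((real^'n \<Rightarrow> ereal) \<Rightarrow> real) \<Rightarrow> bool" where
  "vanishes_on_cones Z \<longleftrightarrow> (\<forall>(B :: real^'n^'n) J. det B \<noteq> 0 \<longrightarrow> Z (\<lambda>x. orthant_fun J (B *v x)) = 0)"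

section \<open>Cells of generic hyperplane arrangements\<close>

text \<open>Linear independence of an indexed family: a repeated vector makes it dependent.\<close>

definition independent_on :: "'i set \<Rightarrow> ('i \<Rightarrow> 'a::real_vector) \<Rightarrow> bool" where
  "independent_on I p \<longleftrightarrow> (\<forall>c. (\<Sum>i\<in>I. c i *\<^sub>R p i) = 0 \<longrightarrow> (\<forall>i\<in>I. c i = 0))"

lemma independent_on_subset:
  assumes "independent_on I p" "J \<subseteq> I" "finite I"
  shows "independent_on J p"
  unfolding independent_on_def
proof (intro allI impI)
  fix c assume c: "(\<Sum>i\<in>J. c i *\<^sub>R p i) = 0"
  have "(\<Sum>i\<in>I. (if i \<in> J then c i else 0) *\<^sub>R p i) = (\<Sum>i\<in>J. (if i \<in> J then c i else 0) *\<^sub>R p i)"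
    by (rule sum.mono_neutral_right) (use assms in auto)
  also have "\<dots> = 0" using c by (simp cong: sum.cong)
  finally have "\<forall>i\<in>I. (if i \<in> J then c i else 0) = 0"
    using assms(1) unfolding independent_on_def by (elim allE[of _ "\<lambda>i. if i \<in> J then c i else 0"]) simp
  then show "\<forall>i\<in>J. c i = 0" using assms(2) by (auto split: if_splits)
qed

lemma independent_onD:
  assumes "independent_on I p" "finite I"
  shows "inj_on p I" "independent (p ` I)"
proof -
  show inj: "inj_on p I"
  proof (rule inj_onI, rule ccontr)
    fix i j assume ij: "i \<in> I" "j \<in> I" "p i = p j" "i \<noteq> j"
    let ?c = "\<lambda>k. (if k = i then 1 else 0) - (if k = j then 1 else 0 :: real)"
    have "(\<Sum>k\<in>I. ?c k *\<^sub>R p k) = (\<Sum>k\<in>I. (if k = i then p i else 0) - (if k = j then p j else 0))"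
      by (rule sum.cong) (auto simp: scaleR_left_diff_distrib)
    also have "\<dots> = 0" using ij assms(2) by (simp add: sum_subtractf)
    finally have "\<forall>k\<in>I. ?c k = 0" using assms(1) unfolding independent_on_def by (elim allE[of _ ?c]) simp
    then have "?c i = 0" using ij(1) by (rule bspec)
    with ij show False by simp
  qed
  show "independent (p ` I)"
  proof
    assume "dependent (p ` I)"
    then obtain u v where uv: "v \<in> p ` I" "u v \<noteq> 0" "(\<Sum>v\<in>p ` I. u v *\<^sub>R v) = 0"
      using dependent_finite[of "p ` I"] assms(2) by auto
    then have "(\<Sum>i\<in>I. u (p i) *\<^sub>R p i) = 0" using inj by (simp add: sum.reindex)
    then have "\<forall>i\<in>I. u (p i) = 0"
      using assms(1) unfolding independent_on_def by (elim allE[of _ "\<lambda>i. u (p i)"]) simp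
    with uv show False by auto
  qed
qed

lemma independent_on_full_unique:
  fixes p :: "'i \<Rightarrow> 'a::euclidean_space"
  assumes "finite I" "independent_on I p" "card I = DIM('a)" and d: "\<And>i. i \<in> I \<Longrightarrow> p i \<bullet> d = 0"
  shows "d = 0"
proof -
  note inj = independent_onD(1)[OF assms(2,1)] and ind = independent_onD(2)[OF assms(2,1)]
  have "dim (p ` I) = DIM('a)"
    using dim_eq_card_independent[OF ind] inj assms(3) by (simp add: card_image)
  then have "span (p ` I) = UNIV" by (simp add: dim_eq_full)
  moreover have "span (p ` I) \<subseteq> {x. d \<bullet> x = 0}"
    by (rule span_minimal) (use d in \<open>auto simp: inner_commute subspace_hyperplane2\<close>)
  ultimately have "d \<bullet> d = 0" by blast
  then show ?thesis by simp
qed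

lemma span_indexed:
  assumes "y \<in> span (p ` I)" "finite I" "inj_on p I"
  obtains c where "y = (\<Sum>i\<in>I. c i *\<^sub>R p i)"
proof -
  obtain u where "y = (\<Sum>v\<in>p ` I. u v *\<^sub>R v)"
    using assms(1,2) by (auto simp: span_finite)
  then have "y = (\<Sum>i\<in>I. u (p i) *\<^sub>R p i)" using assms(3) by (simp add: sum.reindex)
  then show ?thesis by (rule that)
qed

lemma obtain_orthogonal_component:
  fixes y :: "'a::euclidean_space"
  assumes "y \<notin> span A"
  obtains d where "\<And>v. v \<in> span A \<Longrightarrow> v \<bullet> d = 0" "0 < y \<bullet> d"
proof -
  obtain s d where sd: "s \<in> span A" "\<And>w. w \<in> span A \<Longrightarrow> orthogonal d w" "y = s + d"
    using orthogonal_subspace_decomp_exists[of A y] by blast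
  have "d \<noteq> 0" using assms sd by auto
  have "v \<bullet> d = 0" if "v \<in> span A" for v using sd(2)[OF that] by (simp add: orthogonal_def inner_commute)
  moreover from this sd(1) have "0 < y \<bullet> d" using \<open>d \<noteq> 0\<close> by (simp add: sd(3) inner_add_left)
  ultimately show ?thesis by (rule that)
qed

text \<open>The possible relations between a point and an oriented hyperplane: on the closed positive or negative
side, on it, or unconstrained.\<close>

definition sign_cond :: "real set \<Rightarrow> bool" where
  "sign_cond A \<longleftrightarrow> A = {0..} \<or> A = {..0} \<or> A = {0} \<or> A = UNIV"

lemma sign_cond_zero: "sign_cond A \<Longrightarrow> 0 \<in> A"
  unfolding sign_cond_def by (elim disjE) simp_all

lemma sign_cond_scale: "sign_cond A \<Longrightarrow> x \<in> A \<Longrightarrow> 0 \<le> e \<Longrightarrow> e * x \<in> A"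
  unfolding sign_cond_def by (elim disjE) (simp_all add: mult_nonneg_nonpos)

lemma sign_cond_cases:
  assumes "sign_cond A"
  obtains "A = UNIV" | "A = {0..}" | "A = {..0}" | "A = {0}"
  using assms unfolding sign_cond_def by blast

definition cell :: "'i set \<Rightarrow> ('i \<Rightarrow> 'a::real_inner) \<Rightarrow> ('i \<Rightarrow> real) \<Rightarrow> ('i \<Rightarrow> real set) \<Rightarrow> 'a set" where
  "cell M p b S = {x. \<forall>i\<in>M. p i \<bullet> x - b i \<in> S i}"

lemma cell_closed:
  fixes p :: "'i \<Rightarrow> 'a::real_inner"
  assumes "\<And>i. i \<in> M \<Longrightarrow> sign_cond (S i)" shows "closed (cell M p b S)"
proof -
  have "closed {x. p i \<bullet> x - b i \<in> S i}" if "i \<in> M" for i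
  proof -
    have "closed (S i)" using assms[OF that] unfolding sign_cond_def by (elim disjE) simp_all
    moreover have "continuous_on UNIV (\<lambda>x. p i \<bullet> x - b i)" by (intro continuous_intros)
    ultimately have "closed ((\<lambda>x. p i \<bullet> x - b i) -` S i)" by (rule closed_vimage)
    then show ?thesis by (simp add: vimage_def)
  qed
  moreover have "cell M p b S = (\<Inter>i\<in>M. {x. p i \<bullet> x - b i \<in> S i})" by (auto simp: cell_def)
  ultimately show ?thesis by (simp add: closed_INT)
qed

lemma cell_convex:
  fixes p :: "'i \<Rightarrow> 'a::real_inner"
  assumes "\<And>i. i \<in> M \<Longrightarrow> sign_cond (S i)" shows "convex (cell M p b S)"
proof -
  have "convex {x. p i \<bullet> x - b i \<in> S i}" if "i \<in> M" for i
  proof -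
    show ?thesis using assms[OF that] unfolding sign_cond_def
      by (elim disjE) (simp_all add: convex_halfspace_ge convex_halfspace_le convex_hyperplane)
  qed
  moreover have "cell M p b S = (\<Inter>i\<in>M. {x. p i \<bullet> x - b i \<in> S i})" by (auto simp: cell_def)
  ultimately show ?thesis by (simp add: convex_INT)
qed

lemma cell_mono: "N \<subseteq> M \<Longrightarrow> cell M p b S \<subseteq> cell N p b S"
  by (auto simp: cell_def)

lemma minimiser_exists:
  fixes K :: "'a::euclidean_space set"
  assumes "closed K" "K \<noteq> {}" "\<And>t. bounded {x\<in>K. y \<bullet> x \<le> t}"
  obtains x where "x \<in> K" "\<And>z. z \<in> K \<Longrightarrow> y \<bullet> x \<le> y \<bullet> z"
proof -
  obtain x1 where x1: "x1 \<in> K" using assms by auto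
  let ?L = "{x\<in>K. y \<bullet> x \<le> y \<bullet> x1}"
  have "closed {x. y \<bullet> x \<le> y \<bullet> x1}" by (rule closed_halfspace_le)
  then have "closed (K \<inter> {x. y \<bullet> x \<le> y \<bullet> x1})" using assms(1) by auto
  moreover have "?L = K \<inter> {x. y \<bullet> x \<le> y \<bullet> x1}" by auto
  ultimately have "compact ?L" using assms(3)[of "y \<bullet> x1"] by (simp add: compact_eq_bounded_closed)
  moreover have "?L \<noteq> {}" using x1 by blast
  moreover have "continuous_on ?L (\<lambda>x. y \<bullet> x)" by (intro continuous_intros)
  ultimately have "\<exists>x\<in>?L. \<forall>z\<in>?L. y \<bullet> x \<le> y \<bullet> z"
    by (rule continuous_attains_inf)
  then obtain x where x: "x \<in> ?L" "\<forall>z\<in>?L. y \<bullet> x \<le> y \<bullet> z" ..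
  show ?thesis
  proof (rule that[of x])
    fix z assume z: "z \<in> K"
    show "y \<bullet> x \<le> y \<bullet> z"
    proof (cases "y \<bullet> z \<le> y \<bullet> x1")
      case True
      then show ?thesis using x(2) z by simp
    next
      case False
      then show ?thesis using x(1) by simp
    qed
  qed (use x in blast)
qed

lemma cell_feasible_direction:
  fixes p :: "'i \<Rightarrow> 'a::real_inner"
  assumes M: "finite M" and S: "\<And>i. i \<in> M \<Longrightarrow> sign_cond (S i)" and x0: "x0 \<in> cell M p b S"
    and d: "\<And>i. i \<in> M \<Longrightarrow> p i \<bullet> x0 = b i \<Longrightarrow> p i \<bullet> d \<in> S i"
  obtains e where "0 < e" "x0 + e *\<^sub>R d \<in> cell M p b S"
proof -
  have "\<forall>\<^sub>F e in at_right 0. p i \<bullet> (x0 + e *\<^sub>R d) - b i \<in> S i" if i: "i \<in> M" for i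
  proof (cases "p i \<bullet> x0 = b i")
    case True
    show ?thesis
      using eventually_at_right_less[of "0::real"]
    proof eventually_elim
      case (elim e)
      have "p i \<bullet> (x0 + e *\<^sub>R d) - b i = e * (p i \<bullet> d)" using True by (simp add: inner_add_right)
      then show ?case using sign_cond_scale[OF S[OF i] d[OF i True], of e] elim by simp
    qed
  next
    case False
    have lim: "((\<lambda>e. p i \<bullet> (x0 + e *\<^sub>R d) - b i) \<longlongrightarrow> p i \<bullet> (x0 + 0 *\<^sub>R d) - b i) (at_right 0)"
      by (intro tendsto_intros)
    have in_S: "p i \<bullet> x0 - b i \<in> S i" using x0 i by (auto simp: cell_def)
    consider "S i = UNIV" | "S i = {0..}" "0 < p i \<bullet> x0 - b i" | "S i = {..0}" "p i \<bullet> x0 - b i < 0"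
      using S[OF i] in_S False unfolding sign_cond_def by force
    then show ?thesis
    proof cases
      case 2
      then have "\<forall>\<^sub>F e in at_right 0. 0 < p i \<bullet> (x0 + e *\<^sub>R d) - b i"
        using lim by (intro order_tendstoD(1)[OF lim]) simp
      then show ?thesis by eventually_elim (simp add: 2)
    next
      case 3
      then have "\<forall>\<^sub>F e in at_right 0. p i \<bullet> (x0 + e *\<^sub>R d) - b i < 0"
        using lim by (intro order_tendstoD(2)[OF lim]) simp
      then show ?thesis by eventually_elim (simp add: 3)
    qed simp
  qed
  then have "\<forall>\<^sub>F e in at_right 0. \<forall>i\<in>M. p i \<bullet> (x0 + e *\<^sub>R d) - b i \<in> S i"
    using M by (simp add: eventually_ball_finite)
  then have "\<forall>\<^sub>F e in at_right 0. 0 < e \<and> x0 + e *\<^sub>R d \<in> cell M p b S"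
    using eventually_at_right_less[of "0::real"] by eventually_elim (auto simp: cell_def)
  then have "\<exists>e. 0 < e \<and> x0 + e *\<^sub>R d \<in> cell M p b S"
    by (rule eventually_happens'[rotated]) simp
  then show ?thesis using that by blast
qed

text \<open>The conclusion says that the minimum is attained at a vertex whose tangent cone is simplicial, and
that the functional increases strictly along its edges.  If the functional were not a combination of
the normals of the active constraints, it would decrease in a direction orthogonal to all of them.
By \<open>G2\<close> this takes at least \<open>n\<close> normals, and by \<open>G1\<close> they are independent, so there are exactly \<open>n\<close>.  The
signs of the coefficients are read off by moving along the edges, which form the dual basis, and \<open>G2\<close>
excludes coefficients that are zero.\<close>

lemma generic_minimiser_active:
  fixes p :: "'i \<Rightarrow> 'a::euclidean_space"
  assumes M: "finite M" and S: "\<And>i. i \<in> M \<Longrightarrow> sign_cond (S i)"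
    and x0: "x0 \<in> cell M p b S" "\<And>x. x \<in> cell M p b S \<Longrightarrow> y \<bullet> x0 \<le> y \<bullet> x"
    and G1: "independent_on {i\<in>M. p i \<bullet> x0 = b i} p"
    and G2: "\<And>I. I \<subseteq> M \<Longrightarrow> card I < DIM('a) \<Longrightarrow> y \<notin> span (p ` I)"
    and Act: "Act = {i\<in>M. p i \<bullet> x0 = b i \<and> S i \<noteq> UNIV}"
  obtains c where "card Act = DIM('a)" "y = (\<Sum>i\<in>Act. c i *\<^sub>R p i)"
    "\<And>i. i \<in> Act \<Longrightarrow> S i = {0..} \<Longrightarrow> 0 < c i" "\<And>i. i \<in> Act \<Longrightarrow> S i = {..0} \<Longrightarrow> c i < 0"
proof -
  have fin: "finite Act" "Act \<subseteq> M" using M Act by auto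
  have ind: "independent_on Act p"
    by (rule independent_on_subset[OF G1]) (use Act M in auto)
  note inj = independent_onD(1)[OF ind fin(1)] and indep = independent_onD(2)[OF ind fin(1)]
  have dir: "0 \<le> y \<bullet> d" if d: "\<And>i. i \<in> Act \<Longrightarrow> p i \<bullet> d \<in> S i" for d
  proof -
    obtain e where e: "0 < e" "x0 + e *\<^sub>R d \<in> cell M p b S"
      by (rule cell_feasible_direction[OF M S x0(1), of d]) (use d Act in auto)
    then have "0 \<le> e * (y \<bullet> d)" using x0(2)[OF e(2)] by (simp add: inner_add_right)
    then show ?thesis using e by (simp add: zero_le_mult_iff)
  qed
  have ysp: "y \<in> span (p ` Act)"
  proof (rule ccontr)
    assume "y \<notin> span (p ` Act)"
    then obtain d where d: "\<And>v. v \<in> span (p ` Act) \<Longrightarrow> v \<bullet> d = 0" "0 < y \<bullet> d"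
      by (rule obtain_orthogonal_component) blast
    have "0 \<le> y \<bullet> (- d)"
      by (rule dir) (use d(1) fin S sign_cond_zero in \<open>force simp: span_base\<close>)
    with d show False by simp
  qed
  have "card Act = card (p ` Act)" using inj by (simp add: card_image)
  also have "\<dots> \<le> DIM('a)" using indep by (simp add: independent_bound)
  finally have card: "card Act = DIM('a)" using G2[OF fin(2)] ysp by force
  obtain c where c: "y = (\<Sum>i\<in>Act. c i *\<^sub>R p i)" using span_indexed[OF ysp fin(1) inj] .
  have dual: "\<exists>d. (\<forall>j\<in>Act - {i}. p j \<bullet> d = 0) \<and> 0 < p i \<bullet> d" if i: "i \<in> Act" for i
  proof -
    have "p i \<notin> span (p ` (Act - {i}))"
    proof -
      have "p ` (Act - {i}) = p ` Act - {p i}" using inj i by (auto simp: inj_on_def)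
      then show ?thesis using indep i by (auto simp: dependent_def)
    qed
    then obtain d where d: "\<And>v. v \<in> span (p ` (Act - {i})) \<Longrightarrow> v \<bullet> d = 0" "0 < p i \<bullet> d"
      by (rule obtain_orthogonal_component) blast
    then show ?thesis by (intro exI[of _ d]) (auto simp: span_base)
  qed
  have nz: "c i \<noteq> 0" if i: "i \<in> Act" for i
  proof
    assume "c i = 0"
    then have "y = (\<Sum>j\<in>Act - {i}. c j *\<^sub>R p j)"
      using c fin(1) i by (simp add: sum.remove[of Act i])
    also have "\<dots> \<in> span (p ` (Act - {i}))"
      by (intro span_sum span_scale span_base) auto
    finally have "y \<in> span (p ` (Act - {i}))" .
    moreover have "card (Act - {i}) < DIM('a)" using card i fin(1) by (metis card_Diff1_less)
    ultimately show False using G2[of "Act - {i}"] fin by blast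
  qed
  have yd: "y \<bullet> d = c i * (p i \<bullet> d)" if "i \<in> Act" "\<forall>j\<in>Act - {i}. p j \<bullet> d = 0" for i d
  proof -
    have "y \<bullet> d = (\<Sum>j\<in>Act. c j * (p j \<bullet> d))" by (simp add: c inner_sum_left)
    also have "\<dots> = c i * (p i \<bullet> d) + (\<Sum>j\<in>Act - {i}. c j * (p j \<bullet> d))"
      using that fin(1) by (simp add: sum.remove)
    also have "(\<Sum>j\<in>Act - {i}. c j * (p j \<bullet> d)) = 0" using that by (intro sum.neutral) auto
    finally show ?thesis by simp
  qed
  have pos: "0 < c i" if i: "i \<in> Act" "S i = {0..}" for i
  proof -
    obtain d where d: "\<forall>j\<in>Act - {i}. p j \<bullet> d = 0" "0 < p i \<bullet> d" using dual[OF i(1)] by blast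
    have "0 \<le> y \<bullet> d"
    proof (rule dir)
      fix j assume j: "j \<in> Act"
      show "p j \<bullet> d \<in> S j"
        using d i j sign_cond_zero[OF S, of j] fin by (cases "j = i") auto
    qed
    then have "0 \<le> c i" using yd[OF i(1) d(1)] d(2) by (simp add: zero_le_mult_iff)
    then show ?thesis using nz[OF i(1)] by simp
  qed
  have neg: "c i < 0" if i: "i \<in> Act" "S i = {..0}" for i
  proof -
    obtain d where d: "\<forall>j\<in>Act - {i}. p j \<bullet> d = 0" "0 < p i \<bullet> d" using dual[OF i(1)] by blast
    have "0 \<le> y \<bullet> (- d)"
    proof (rule dir)
      fix j assume j: "j \<in> Act"
      show "p j \<bullet> (- d) \<in> S j"
        using d i j sign_cond_zero[OF S, of j] fin by (cases "j = i") auto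
    qed
    then have "c i \<le> 0" using yd[OF i(1) d(1)] d(2) by (simp add: mult_le_0_iff)
    then show ?thesis using nz[OF i(1)] by simp
  qed
  show ?thesis by (rule that[OF card c pos neg])
qed

text \<open>The coordinates are the values of the \<open>n\<close> constraints, scaled by the coefficients of the functional so
that it becomes the coordinate sum.  A constraint that is an equation gets the scale one; the
corresponding coordinate is zero on the cone.\<close>

lemma vertex_cone_eq_orthant:
  fixes p :: "'i \<Rightarrow> real^'n"
  assumes fin: "finite I" and card: "card I = CARD('n)" and ind: "independent_on I p"
    and S: "\<And>i. i \<in> I \<Longrightarrow> S i = {0..} \<or> S i = {..0} \<or> S i = {0}"
    and y: "y = (\<Sum>i\<in>I. c i *\<^sub>R p i)"
    and c: "\<And>i. i \<in> I \<Longrightarrow> S i = {0..} \<Longrightarrow> 0 < c i" "\<And>i. i \<in> I \<Longrightarrow> S i = {..0} \<Longrightarrow> c i < 0"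
    and x0: "\<And>i. i \<in> I \<Longrightarrow> p i \<bullet> x0 = b i"
  obtains B :: "real^'n^'n" and J where "det B \<noteq> 0"
    "extended (cell I p b S) (\<lambda>x. y \<bullet> x + s) = (\<lambda>x. orthant_fun J (B *v (x - x0)) + ereal (y \<bullet> x0 + s))"
proof -
  obtain e :: "'n \<Rightarrow> 'i" where e: "bij_betw e UNIV I"
    using finite_same_card_bij[of "UNIV :: 'n set" I] fin card by auto
  have "I = range e" using e by (simp add: bij_betw_def)
  then have eI: "e k \<in> I" for k by simp
  have ne: "{0::real..} \<noteq> {0}" "{..0::real} \<noteq> {0}"
    by (metis atLeast_iff singletonD zero_le_one zero_neq_one)
       (metis atMost_iff neg_0_le_iff_le neg_equal_0_iff_equal singletonD minus_le_iff zero_le_one zero_neq_one minus_zero)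
  define \<delta> where "\<delta> i = (if S i = {0} then 1 else c i)" for i
  have d0: "\<delta> i \<noteq> 0" if "i \<in> I" for i using S[OF that] c[OF that] by (auto simp: \<delta>_def)
  define B :: "real^'n^'n" where "B = (\<chi> k. \<delta> (e k) *\<^sub>R p (e k))"
  define J where "J = {k. S (e k) \<noteq> {0}}"
  have Bx: "(B *v v) $ k = \<delta> (e k) * (p (e k) \<bullet> v)" for v k
    by (simp add: matrix_vector_mul_component B_def)
  have "\<forall>d. (\<Sum>k\<in>UNIV. d k *s row k B) = 0 \<longrightarrow> (\<forall>k. d k = 0)"
  proof (intro allI impI)
    fix d k assume 0: "(\<Sum>k\<in>UNIV. d k *s row k B) = 0"
    define g where "g i = d (inv_into UNIV e i) * \<delta> i" for i
    have inv: "inv_into UNIV e (e k) = k" for k using e by (simp add: bij_betw_def)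
    have "(\<Sum>i\<in>I. g i *\<^sub>R p i) = (\<Sum>k\<in>UNIV. g (e k) *\<^sub>R p (e k))"
      using sum.reindex_bij_betw[OF e, of "\<lambda>i. g i *\<^sub>R p i"] by simp
    also have "\<dots> = (\<Sum>k\<in>UNIV. d k *s row k B)"
      by (rule sum.cong) (simp_all add: g_def inv B_def row_def vec_eq_iff)
    finally have "g (e k) = 0" using 0 ind eI unfolding independent_on_def by metis
    then show "d k = 0" using d0[OF eI] by (simp add: g_def inv)
  qed
  then have "\<exists>B'. B ** B' = mat 1" using matrix_right_invertible_independent_rows by blast
  then have detB: "det B \<noteq> 0" by (metis invertible_det_nz invertible_right_inverse)
  have "extended (cell I p b S) (\<lambda>x. y \<bullet> x + s) x = orthant_fun J (B *v (x - x0)) + ereal (y \<bullet> x0 + s)" for x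
  proof -
    let ?t = "B *v (x - x0)"
    have bx: "p i \<bullet> (x - x0) = p i \<bullet> x - b i" if "i \<in> I" for i
      using x0[OF that] by (simp add: inner_diff_right)
    have one: "(0 \<le> ?t $ k \<and> (k \<notin> J \<longrightarrow> ?t $ k = 0)) \<longleftrightarrow> p (e k) \<bullet> x - b (e k) \<in> S (e k)" for k
    proof -
      consider "S (e k) = {0..}" | "S (e k) = {..0}" | "S (e k) = {0}" using S[OF eI[of k]] by blast
      then show ?thesis
      proof cases
        case 1
        then show ?thesis using c(1)[OF eI 1] ne
          unfolding Bx bx[OF eI] by (simp add: J_def \<delta>_def zero_le_mult_iff)
      next
        case 2
        then show ?thesis using c(2)[OF eI 2] ne
          unfolding Bx bx[OF eI] by (simp add: J_def \<delta>_def zero_le_mult_iff)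
      next
        case 3
        then have "k \<notin> J" "\<delta> (e k) = 1" by (simp_all add: J_def \<delta>_def)
        then show ?thesis unfolding Bx bx[OF eI] by (simp add: 3) linarith
      qed
    qed
    have "(\<forall>k. 0 \<le> ?t $ k \<and> (k \<notin> J \<longrightarrow> ?t $ k = 0)) \<longleftrightarrow> (\<forall>i\<in>I. p i \<bullet> x - b i \<in> S i)"
      unfolding one by (subst \<open>I = range e\<close>) (simp only: ball_simps)
    then have iff: "(\<forall>k. 0 \<le> ?t $ k \<and> (k \<notin> J \<longrightarrow> ?t $ k = 0)) \<longleftrightarrow> x \<in> cell I p b S" by (simp add: cell_def)
    have sum: "(\<Sum>k\<in>UNIV. ?t $ k) = y \<bullet> x - y \<bullet> x0" if "x \<in> cell I p b S"
    proof -
      have "(\<Sum>k\<in>UNIV. ?t $ k) = (\<Sum>k\<in>UNIV. c (e k) * (p (e k) \<bullet> (x - x0)))"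
      proof (rule sum.cong)
        fix k
        have "p (e k) \<bullet> x - b (e k) \<in> S (e k)" using that eI by (simp add: cell_def)
        then show "?t $ k = c (e k) * (p (e k) \<bullet> (x - x0))"
          unfolding Bx bx[OF eI] \<delta>_def by (cases "S (e k) = {0}") simp_all
      qed simp
      also have "\<dots> = (\<Sum>i\<in>I. c i * (p i \<bullet> (x - x0)))"
        using sum.reindex_bij_betw[OF e, of "\<lambda>i. c i * (p i \<bullet> (x - x0))"] by simp
      also have "\<dots> = y \<bullet> (x - x0)" by (simp add: y inner_sum_left)
      finally show ?thesis by (simp add: inner_diff_right)
    qed
    show ?thesis
    proof (cases "x \<in> cell I p b S")
      case True
      then have "?t \<in> {t. \<forall>k. 0 \<le> t $ k \<and> (k \<notin> J \<longrightarrow> t $ k = 0)}" using iff by simp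
      then show ?thesis unfolding orthant_fun_def extended_def by (simp only: True sum if_True) simp
    next
      case False
      then have "?t \<notin> {t. \<forall>k. 0 \<le> t $ k \<and> (k \<notin> J \<longrightarrow> t $ k = 0)}" using iff by simp
      then show ?thesis unfolding orthant_fun_def extended_def by (simp only: False if_False) simp
    qed
  qed
  then have "extended (cell I p b S) (\<lambda>x. y \<bullet> x + s) = (\<lambda>x. orthant_fun J (B *v (x - x0)) + ereal (y \<bullet> x0 + s))"
    by (rule ext)
  then show ?thesis by (rule that[OF detB])
qed

lemma admissible_vertex_cone:
  fixes p :: "'i \<Rightarrow> real^'n"
  assumes Z: "admissible Z"
    and van: "vanishes_on_cones Z"
    and I: "finite I" "card I = CARD('n)" "independent_on I p"
    and S: "\<And>i. i \<in> I \<Longrightarrow> S i = {0..} \<or> S i = {..0} \<or> S i = {0}"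
    and y: "y = (\<Sum>i\<in>I. c i *\<^sub>R p i)"
    and c: "\<And>i. i \<in> I \<Longrightarrow> S i = {0..} \<Longrightarrow> 0 < c i" "\<And>i. i \<in> I \<Longrightarrow> S i = {..0} \<Longrightarrow> c i < 0"
    and x0: "\<And>i. i \<in> I \<Longrightarrow> p i \<bullet> x0 = b i"
  shows "Z (extended (cell I p b S) (\<lambda>x. y \<bullet> x + s)) = 0"
    and "bounded {x \<in> cell I p b S. y \<bullet> x \<le> t}"
    and "\<And>x. x \<in> cell I p b S \<Longrightarrow> x \<noteq> x0 \<Longrightarrow> y \<bullet> x0 < y \<bullet> x"
proof -
  obtain B :: "real^'n^'n" and J where B: "det B \<noteq> 0"
    "extended (cell I p b S) (\<lambda>x. y \<bullet> x + s) = (\<lambda>x. orthant_fun J (B *v (x - x0)) + ereal (y \<bullet> x0 + s))"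
    by (rule vertex_cone_eq_orthant[OF I S y c x0])
  let ?w = "\<lambda>x. orthant_fun J (B *v x)"
  have w: "?w \<in> conv_coe" by (rule conv_coe_comp_matrix[OF orthant_fun_conv_coe B(1)])
  have w': "(\<lambda>x. ?w (x - x0)) \<in> conv_coe" by (rule conv_coe_translate[OF w])
  have "Z (\<lambda>x. ?w (x - x0) + ereal (y \<bullet> x0 + s)) = exp (- (y \<bullet> x0 + s)) * Z (\<lambda>x. ?w (x - x0))"
    by (rule admissible_add_const[OF Z w'])
  also have "Z (\<lambda>x. ?w (x - x0)) = 0" using admissible_translate[OF Z w] van B(1) by (simp add: vanishes_on_cones_def)
  finally show "Z (extended (cell I p b S) (\<lambda>x. y \<bullet> x + s)) = 0" unfolding B(2) by simp
  have "{x \<in> cell I p b S. y \<bullet> x \<le> t} \<subseteq> sublevel (\<lambda>x. ?w (x - x0)) (t - y \<bullet> x0)"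
  proof
    fix x assume x: "x \<in> {x \<in> cell I p b S. y \<bullet> x \<le> t}"
    then have "ereal (y \<bullet> x + s) = ?w (x - x0) + ereal (y \<bullet> x0 + s)"
      using fun_cong[OF B(2), of x] by (simp add: extended_def)
    then show "x \<in> sublevel (\<lambda>x. ?w (x - x0)) (t - y \<bullet> x0)"
      using x by (cases "?w (x - x0)") (auto simp: sublevel_def)
  qed
  then show "bounded {x \<in> cell I p b S. y \<bullet> x \<le> t}"
    by (rule bounded_subset[rotated]) (intro compact_imp_bounded compact_sublevel w')
  show "y \<bullet> x0 < y \<bullet> x" if x: "x \<in> cell I p b S" "x \<noteq> x0" for x
  proof -
    have px: "p i \<bullet> (x - x0) \<in> S i" if "i \<in> I" for i
      using x that x0[OF that] by (auto simp: cell_def inner_diff_right)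
    have eq: "y \<bullet> (x - x0) = (\<Sum>i\<in>I. c i * (p i \<bullet> (x - x0)))" by (simp add: y inner_sum_left)
    have nn: "0 \<le> c i * (p i \<bullet> (x - x0)) \<and> (c i * (p i \<bullet> (x - x0)) = 0 \<longrightarrow> p i \<bullet> (x - x0) = 0)" if i: "i \<in> I" for i
    proof -
      consider "S i = {0..}" | "S i = {..0}" | "S i = {0}" using S[OF i] by blast
      then show ?thesis
      proof cases
        case 1
        then show ?thesis using c(1)[OF i 1] px[OF i] by simp
      next
        case 2
        then show ?thesis using c(2)[OF i 2] px[OF i] by (simp add: mult_nonpos_nonpos)
      next
        case 3
        then show ?thesis using px[OF i] by simp
      qed
    qed
    have "0 \<le> y \<bullet> (x - x0)" unfolding eq using nn by (intro sum_nonneg) blast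
    moreover have "y \<bullet> (x - x0) \<noteq> 0"
    proof
      assume "y \<bullet> (x - x0) = 0"
      then have "\<forall>i\<in>I. c i * (p i \<bullet> (x - x0)) = 0"
        unfolding eq using nn I(1) by (subst (asm) sum_nonneg_eq_0_iff) blast+
      then have "\<And>i. i \<in> I \<Longrightarrow> p i \<bullet> (x - x0) = 0" using nn by blast
      then have "x - x0 = 0" by (intro independent_on_full_unique[OF I(1,3)]) (use I in simp_all)
      then show False using x by simp
    qed
    ultimately show ?thesis by (simp add: inner_diff_right)
  qed
qed

text \<open>The induction is on the number of vertices (points of the finite set \<open>V\<close>) at which the functional is
not smaller than at the minimiser \<open>x0\<close>.  This number drops for the parts that are cut off from the tangent cone at
\<open>x0\<close>: they do not contain \<open>x0\<close>, which is the unique minimiser on the cone.\<close>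

lemma admissible_generic_cell:
  fixes p :: "'i \<Rightarrow> real^'n"
  assumes Z: "admissible Z"
    and van: "vanishes_on_cones Z"
    and M: "finite M"
    and G1: "\<And>x. independent_on {i\<in>M. p i \<bullet> x = b i} p"
    and G2: "\<And>I. I \<subseteq> M \<Longrightarrow> card I < CARD('n) \<Longrightarrow> y \<notin> span (p ` I)"
    and S: "\<And>i. i \<in> M \<Longrightarrow> sign_cond (S i)"
    and ne: "cell M p b S \<noteq> {}" and bd: "\<And>t. bounded {x\<in>cell M p b S. y \<bullet> x \<le> t}"
  shows "Z (extended (cell M p b S) (\<lambda>x. y \<bullet> x + s)) = 0"
proof -
  let ?f = "\<lambda>x. y \<bullet> x + s"
  \<comment> \<open>Minimisers turn out to be common points of \<open>n\<close> independent hyperplanes, hence to lie in the finite set \<open>V\<close>.\<close>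
  define vert where "vert I = (SOME x. \<forall>i\<in>I. p i \<bullet> x = b i)" for I
  define V where "V = vert ` Pow M"
  have finV: "finite V" using M by (simp add: V_def)
  have main: "Z (extended (cell N p b S) ?f) = 0"
    if "N \<subseteq> M" "\<And>i. i \<in> N \<Longrightarrow> sign_cond (S i)" "x0 \<in> cell N p b S"
      "\<And>x. x \<in> cell N p b S \<Longrightarrow> y \<bullet> x0 \<le> y \<bullet> x" for N S x0
    using that
  proof (induction "card {v\<in>V. y \<bullet> x0 \<le> y \<bullet> v}" arbitrary: N S x0 rule: less_induct)
    case less
    note N = less.prems(1) and S = less.prems(2) and x0 = less.prems(3,4)
    have finN: "finite N" using N M by (rule finite_subset)
    define Act where "Act = {i\<in>N. p i \<bullet> x0 = b i \<and> S i \<noteq> UNIV}"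
    have A: "Act \<subseteq> N" "finite Act" "Act \<subseteq> M" using finN N by (auto simp: Act_def)
    have indA: "independent_on Act p"
      by (rule independent_on_subset[OF G1[of x0]]) (use A M in \<open>auto simp: Act_def\<close>)
    obtain c where c: "card Act = DIM(real^'n)" "y = (\<Sum>i\<in>Act. c i *\<^sub>R p i)"
      "\<And>i. i \<in> Act \<Longrightarrow> S i = {0..} \<Longrightarrow> 0 < c i" "\<And>i. i \<in> Act \<Longrightarrow> S i = {..0} \<Longrightarrow> c i < 0"
    proof (rule generic_minimiser_active[OF finN S x0 _ _ Act_def])
      show "independent_on {i \<in> N. p i \<bullet> x0 = b i} p"
        by (rule independent_on_subset[OF G1[of x0]]) (use N M in auto)
      show "y \<notin> span (p ` I)" if "I \<subseteq> N" "card I < DIM(real^'n)" for I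
        using G2[of I] that N by auto
    qed (blast intro: that)+
    have cardA: "card Act = CARD('n)" using c(1) by simp
    have SA: "S i = {0..} \<or> S i = {..0} \<or> S i = {0}" if "i \<in> Act" for i
      using S[of i] that by (auto simp: Act_def sign_cond_def)
    have xA: "p i \<bullet> x0 = b i" if "i \<in> Act" for i using that by (simp add: Act_def)
    have cone1: "Z (extended (cell Act p b S) ?f) = 0"
      by (rule admissible_vertex_cone(1)[OF Z van A(2) cardA indA SA c(2) c(3,4) xA])
    have cone2: "bounded {x\<in>cell Act p b S. y \<bullet> x \<le> t}" for t
      by (rule admissible_vertex_cone(2)[OF Z van A(2) cardA indA SA c(2) c(3,4) xA])
    have cone3: "y \<bullet> x0 < y \<bullet> x" if "x \<in> cell Act p b S" "x \<noteq> x0" for x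
      by (rule admissible_vertex_cone(3)[OF Z van A(2) cardA indA SA c(2) c(3,4) xA that])
    have "vert Act = x0"
    proof -
      have "\<forall>i\<in>Act. p i \<bullet> vert Act = b i"
        unfolding vert_def by (rule someI[of _ x0]) (use xA in blast)
      then have "vert Act - x0 = 0"
        by (intro independent_on_full_unique[OF A(2) indA c(1)]) (simp add: inner_diff_right xA)
      then show ?thesis by simp
    qed
    then have x0V: "x0 \<in> V" using A(3) by (auto simp: V_def)
    \<comment> \<open>A part that is cut off avoids \<open>x0\<close>, so its minimum is larger and \<open>x0\<close> no longer counts.\<close>
    have IH: "Z (extended (cell N' p b S') ?f) = 0"
      if N': "N' \<subseteq> M" "\<And>i. i \<in> N' \<Longrightarrow> sign_cond (S' i)" "cell N' p b S' \<noteq> {}"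
        "cell N' p b S' \<subseteq> cell Act p b S" "x0 \<notin> cell N' p b S'" for N' S'
    proof -
      have "bounded {x\<in>cell N' p b S'. y \<bullet> x \<le> t}" for t
        by (rule bounded_subset[OF cone2[of t]]) (use N'(4) in auto)
      then obtain x1 where x1: "x1 \<in> cell N' p b S'" "\<And>z. z \<in> cell N' p b S' \<Longrightarrow> y \<bullet> x1 \<le> y \<bullet> z"
        using minimiser_exists[OF cell_closed[OF N'(2)] N'(3)] by blast
      have "y \<bullet> x0 < y \<bullet> x1" using cone3[of x1] x1(1) N'(4,5) by blast
      then have "{v\<in>V. y \<bullet> x1 \<le> y \<bullet> v} \<subset> {v\<in>V. y \<bullet> x0 \<le> y \<bullet> v}"
        using x0V by (intro psubsetI subsetI) (auto dest: order.strict_trans1)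
      then have "card {v\<in>V. y \<bullet> x1 \<le> y \<bullet> v} < card {v\<in>V. y \<bullet> x0 \<le> y \<bullet> v}"
        using finV by (intro psubset_card_mono) auto
      then show ?thesis by (rule less.hyps[OF _ N'(1,2) x1])
    qed
    have chain: "T \<subseteq> N - Act \<Longrightarrow> Z (extended (cell (Act \<union> T) p b S) ?f) = 0" if "finite T" for T
      using that
    proof (induction T rule: finite_induct)
      case empty
      then show ?case using cone1 by simp
    next
      case (insert j T)
      let ?K = "cell (Act \<union> T) p b S" and ?K1 = "cell (Act \<union> insert j T) p b S"
      have jN: "j \<in> N" "j \<notin> Act" using insert.prems by auto
      have NT: "Act \<union> T \<subseteq> N" "Act \<union> insert j T \<subseteq> N" using insert.prems A by auto
      have ZK: "Z (extended ?K ?f) = 0" using insert by blast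
      have K1: "?K1 = ?K \<inter> {x. p j \<bullet> x - b j \<in> S j}" by (auto simp: cell_def)
      have x0K1: "x0 \<in> ?K1" using x0(1) NT(2) cell_mono by blast
      show ?case
      proof (cases "S j = UNIV")
        case True
        then have "?K1 = ?K" using K1 by auto
        then show ?thesis using ZK by simp
      next
        case False
        have x0j: "p j \<bullet> x0 - b j \<in> S j" "p j \<bullet> x0 \<noteq> b j"
          using jN False x0(1) by (auto simp: Act_def cell_def)
        \<comment> \<open>The half-line opposite to \<open>S j\<close>, which is not \<open>{0}\<close> as the constraint \<open>j\<close> is inactive at \<open>x0\<close>.\<close>
        define H where "H = (if S j = {0..} then {..0} else {0::real..})"
        define S2 where "S2 = S(j := H)"
        define S3 where "S3 = S(j := {0})"
        have Sj: "sign_cond H" "S j \<union> H = UNIV" "S j \<inter> H = {0}" "p j \<bullet> x0 - b j \<notin> H"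
          using S[OF jN(1)] False x0j unfolding H_def
          by (cases rule: sign_cond_cases; force simp: sign_cond_def split: if_splits)+
        have K2: "cell (Act \<union> insert j T) p b S2 = ?K \<inter> {x. p j \<bullet> x - b j \<in> H}"
          and K3: "cell (Act \<union> insert j T) p b S3 = ?K \<inter> {x. p j \<bullet> x - b j \<in> {0}}"
          using insert.hyps(2) jN(2) by (auto simp: cell_def S2_def S3_def)
        let ?K2 = "cell (Act \<union> insert j T) p b S2" and ?K3 = "cell (Act \<union> insert j T) p b S3"
        have val: "\<And>i. i \<in> Act \<union> T \<Longrightarrow> sign_cond (S i)" "\<And>i. i \<in> Act \<union> insert j T \<Longrightarrow> sign_cond (S i)"
          "\<And>i. i \<in> Act \<union> insert j T \<Longrightarrow> sign_cond (S2 i)" "\<And>i. i \<in> Act \<union> insert j T \<Longrightarrow> sign_cond (S3 i)"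
          using S NT Sj(1) by (auto simp: S2_def S3_def) (auto simp: sign_cond_def)
        have un: "?K1 \<union> ?K2 = ?K" and int: "?K1 \<inter> ?K2 = ?K3"
          unfolding K1 K2 K3 using Sj(2,3) by blast+
        show ?thesis
        proof (cases "?K2 = {}")
          case True
          then show ?thesis using un ZK by simp
        next
          case False
          then obtain z where z: "z \<in> ?K" "p j \<bullet> z - b j \<in> H" unfolding K2 by blast
          have K3ne: "?K3 \<noteq> {}"
          proof -
            have "x0 \<in> ?K" using x0K1 K1 by blast
            have "connected ?K" by (intro convex_connected cell_convex val)
            have "(p j \<bullet> x0 \<le> b j \<and> b j \<le> p j \<bullet> z) \<or> (p j \<bullet> z \<le> b j \<and> b j \<le> p j \<bullet> x0)"
              using z(2) Sj(4) unfolding H_def by (auto split: if_splits)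
            then obtain w where "w \<in> ?K" "p j \<bullet> w = b j"
              using connected_ivt_hyperplane[OF \<open>connected ?K\<close> \<open>x0 \<in> ?K\<close> z(1)]
                connected_ivt_hyperplane[OF \<open>connected ?K\<close> z(1) \<open>x0 \<in> ?K\<close>] by blast
            then show ?thesis unfolding K3 by auto
          qed
          have sub: "?K \<subseteq> cell Act p b S" by (rule cell_mono) auto
          have NM: "Act \<union> insert j T \<subseteq> M" using NT(2) N by (rule subset_trans)
          have "?K2 \<subseteq> ?K" "?K3 \<subseteq> ?K" using un int by blast+
          then have sub2: "?K2 \<subseteq> cell Act p b S" "?K3 \<subseteq> cell Act p b S"
            using sub by (meson subset_trans)+
          have "x0 \<notin> ?K2" unfolding K2 using Sj(4) by simp
          then have "Z (extended ?K2 ?f) = 0"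
            by (intro IH[where N'="Act \<union> insert j T" and S'=S2] NM val(3) False sub2(1))
          moreover have "x0 \<notin> ?K3" unfolding K3 using x0j(2) by simp
          then have "Z (extended ?K3 ?f) = 0"
            by (intro IH[where N'="Act \<union> insert j T" and S'=S3] NM val(4) K3ne sub2(2))
          moreover have "Z (extended ?K1 ?f) + Z (extended ?K2 ?f) = Z (extended ?K ?f) + Z (extended (?K1 \<inter> ?K2) ?f)"
          proof (rule admissible_cut[OF Z])
            show "convex_on ?K ?f" by (intro convex_on_affine_fun cell_convex val)
            show "continuous_on ?K ?f" by (intro continuous_intros)
            show "bounded {x\<in>?K. ?f x \<le> t}" for t
              by (rule bounded_subset[OF cone2[of "t - s"]]) (use sub in auto)
          qed (use un int K3ne in \<open>auto intro!: cell_closed cell_convex val\<close>)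
          ultimately show ?thesis using ZK int by simp
        qed
      qed
    qed
    have "Act \<union> (N - Act) = N" using A(1) by blast
    then show ?case using chain[of "N - Act"] finN by simp
  qed
  obtain x0 where "x0 \<in> cell M p b S" "\<And>z. z \<in> cell M p b S \<Longrightarrow> y \<bullet> x0 \<le> y \<bullet> z"
    using minimiser_exists[OF cell_closed[OF S] ne bd] by blast
  then show ?thesis by (intro main[of M S x0]) (use S in auto)
qed

section \<open>Piecewise affine functions on polytopes\<close>

text \<open>Only the offsets are moved.  Hyperplanes with dependent normals have a common point only if the
offsets satisfy the same linear relation.  Along the curve \<open>\<epsilon> \<mapsto> (b i - \<epsilon>^(i+1))\<^sub>i\<close> this relation is a
non-trivial polynomial equation in \<open>\<epsilon>\<close>, so it holds for finitely many \<open>\<epsilon>\<close> only.\<close>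

lemma generic_offsets:
  fixes p :: "nat \<Rightarrow> 'a::real_inner"
  assumes "0 < e"
  obtains \<epsilon> where "0 < \<epsilon>" "\<epsilon> < e" "\<And>x. independent_on {i\<in>{..<m}. p i \<bullet> x = b i - \<epsilon> ^ Suc i} p"
proof -
  define D where "D = {J. J \<subseteq> {..<m} \<and> \<not> independent_on J p}"
  have "\<exists>c. (\<Sum>i\<in>J. c i *\<^sub>R p i) = 0 \<and> (\<exists>i\<in>J. c i \<noteq> 0)" if "J \<in> D" for J
    using that by (auto simp: D_def independent_on_def)
  then obtain c where c: "\<And>J. J \<in> D \<Longrightarrow> (\<Sum>i\<in>J. c J i *\<^sub>R p i) = 0" "\<And>J. J \<in> D \<Longrightarrow> \<exists>i\<in>J. c J i \<noteq> 0"
    by metis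
  define Bad where "Bad J = {\<epsilon>::real. (\<Sum>i\<in>J. c J i * (b i - \<epsilon> ^ Suc i)) = 0}" for J
  have "finite (Bad J)" if J: "J \<in> D" for J
  proof -
    \<comment> \<open>Coefficients of the relation as a polynomial in \<open>\<epsilon>\<close>.\<close>
    define a where "a k = (case k of 0 \<Rightarrow> (\<Sum>i\<in>J. c J i * b i) | Suc i \<Rightarrow> if i \<in> J then - c J i else 0)" for k
    have "(\<Sum>k\<le>m. a k * \<epsilon> ^ k) = (\<Sum>i\<in>J. c J i * (b i - \<epsilon> ^ Suc i))" for \<epsilon> :: real
    proof -
      have "(\<Sum>k\<le>m. a k * \<epsilon> ^ k) = a 0 + (\<Sum>i<m. a (Suc i) * \<epsilon> ^ Suc i)"
        by (subst sum.atMost_shift) simp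
      also have "(\<Sum>i<m. a (Suc i) * \<epsilon> ^ Suc i) = (\<Sum>i\<in>J. - c J i * \<epsilon> ^ Suc i)"
        by (rule sum.mono_neutral_cong_right) (use J in \<open>auto simp: D_def a_def\<close>)
      also have "a 0 = (\<Sum>i\<in>J. c J i * b i)" by (simp add: a_def)
      finally show ?thesis by (simp add: sum_subtractf sum_negf right_diff_distrib)
    qed
    then have "Bad J = {\<epsilon>. (\<Sum>k\<le>m. a k * \<epsilon> ^ k) = 0}" by (simp add: Bad_def)
    moreover have "\<exists>k\<le>m. a k \<noteq> 0"
    proof -
      obtain i where "i \<in> J" "c J i \<noteq> 0" using c(2)[OF J] by blast
      then show ?thesis using J by (intro exI[of _ "Suc i"]) (auto simp: D_def a_def)
    qed
    ultimately show ?thesis using polyfun_finite_roots[of a m] by simp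
  qed
  moreover have "finite D" unfolding D_def by (rule finite_subset[of _ "Pow {..<m}"]) auto
  ultimately have "finite (\<Union>J\<in>D. Bad J)" by blast
  then obtain \<epsilon> where \<epsilon>: "\<epsilon> \<in> {0<..<e}" "\<epsilon> \<notin> (\<Union>J\<in>D. Bad J)"
    using infinite_Ioo[OF assms] by (meson finite_subset subsetI)
  show ?thesis
  proof (rule that)
    show "independent_on {i\<in>{..<m}. p i \<bullet> x = b i - \<epsilon> ^ Suc i} p" (is "independent_on ?A p") for x
    proof (rule ccontr)
      assume "\<not> independent_on ?A p"
      then have A: "?A \<in> D" by (auto simp: D_def)
      have "(\<Sum>i\<in>?A. c ?A i * (b i - \<epsilon> ^ Suc i)) = (\<Sum>i\<in>?A. c ?A i * (p i \<bullet> x))"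
        by (rule sum.cong) auto
      also have "\<dots> = (\<Sum>i\<in>?A. c ?A i *\<^sub>R p i) \<bullet> x" by (simp add: inner_sum_left)
      also have "\<dots> = 0" using c(1)[OF A] by simp
      finally show False using \<epsilon>(2) A by (auto simp: Bad_def)
    qed
  qed (use \<epsilon> in auto)
qed

text \<open>Finitely many proper subspaces do not cover a ball.\<close>

lemma generic_functional:
  fixes p :: "'i \<Rightarrow> 'a::euclidean_space"
  assumes "0 < e" "finite M"
  obtains y' where "y' \<in> ball y e" "\<And>I. I \<subseteq> M \<Longrightarrow> card I < DIM('a) \<Longrightarrow> y' \<notin> span (p ` I)"
proof -
  let ?F = "{I. I \<subseteq> M \<and> card I < DIM('a)}"
  have "negligible (span (p ` I))" if "I \<in> ?F" for I
  proof (rule negligible_lowdim)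
    have "finite I" using that assms(2) finite_subset by auto
    then have "dim (p ` I) \<le> card I" using dim_le_card'[of "p ` I"] card_image_le[of I p] by fastforce
    then show "dim (span (p ` I)) < DIM('a)" using that by simp
  qed
  moreover have "finite ?F" using assms(2) by (auto intro: finite_subset[of _ "Pow M"])
  ultimately have "negligible (\<Union>I\<in>?F. span (p ` I))" by (intro negligible_Union) auto
  moreover have "\<not> negligible (ball y e)" using assms(1) by (intro open_not_negligible) auto
  ultimately obtain y' where "y' \<in> ball y e" "y' \<notin> (\<Union>I\<in>?F. span (p ` I))"
    by (meson negligible_subset subsetI)
  then show ?thesis by (intro that[of y']) auto
qed

text \<open>The polytope is the limit of slightly larger polytopes in general position, and the functional the
limit of functionals in general position.  The boundedness of the set with all offsets lowered by
one bounds the approximating polytopes uniformly.\<close>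

lemma admissible_halfspace_polytope:
  fixes p :: "nat \<Rightarrow> real^'n"
  assumes Z: "admissible Z"
    and van: "vanishes_on_cones Z"
    and bd: "bounded {x. \<forall>i<m. b i - 1 \<le> p i \<bullet> x}" and ne: "{x. \<forall>i<m. b i \<le> p i \<bullet> x} \<noteq> {}"
  shows "Z (extended {x. \<forall>i<m. b i \<le> p i \<bullet> x} (\<lambda>x. y \<bullet> x + s)) = 0"
proof -
  let ?Q = "{x. \<forall>i<m. b i \<le> p i \<bullet> x}"
  have "\<forall>k. \<exists>\<epsilon>. 0 < \<epsilon> \<and> \<epsilon> < 1 / (real k + 1) \<and> (\<forall>x. independent_on {i\<in>{..<m}. p i \<bullet> x = b i - \<epsilon> ^ Suc i} p)"
  proof
    fix k
    have "0 < 1 / (real k + 1)" by simp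
    from generic_offsets[OF this, of m p b] obtain \<epsilon>
      where "0 < \<epsilon>" "\<epsilon> < 1 / (real k + 1)" "\<And>x. independent_on {i\<in>{..<m}. p i \<bullet> x = b i - \<epsilon> ^ Suc i} p" by blast
    then show "\<exists>\<epsilon>. 0 < \<epsilon> \<and> \<epsilon> < 1 / (real k + 1) \<and> (\<forall>x. independent_on {i\<in>{..<m}. p i \<bullet> x = b i - \<epsilon> ^ Suc i} p)"
      by (intro exI[of _ \<epsilon>] conjI allI)
  qed
  from choice[OF this] obtain \<epsilon> where \<epsilon>: "\<And>k. 0 < \<epsilon> k" "\<And>k. \<epsilon> k < 1 / (real k + 1)"
    "\<And>k x. independent_on {i\<in>{..<m}. p i \<bullet> x = b i - \<epsilon> k ^ Suc i} p"
    by blast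
  have "\<forall>k. \<exists>y'. y' \<in> ball y (1 / (real k + 1)) \<and> (\<forall>I. I \<subseteq> {..<m} \<longrightarrow> card I < DIM(real^'n) \<longrightarrow> y' \<notin> span (p ` I))"
  proof
    fix k
    have "0 < 1 / (real k + 1)" by simp
    from generic_functional[OF this, of "{..<m}" y p] obtain y' where "y' \<in> ball y (1 / (real k + 1))"
      "\<And>I. I \<subseteq> {..<m} \<Longrightarrow> card I < DIM(real^'n) \<Longrightarrow> y' \<notin> span (p ` I)" by blast
    then show "\<exists>y'. y' \<in> ball y (1 / (real k + 1)) \<and> (\<forall>I. I \<subseteq> {..<m} \<longrightarrow> card I < DIM(real^'n) \<longrightarrow> y' \<notin> span (p ` I))"
      by (intro exI[of _ y'] conjI allI impI)
  qed
  from choice[OF this] obtain y' where y': "\<And>k. y' k \<in> ball y (1 / (real k + 1))"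
    "\<And>k I. I \<subseteq> {..<m} \<Longrightarrow> card I < DIM(real^'n) \<Longrightarrow> y' k \<notin> span (p ` I)"
    by blast
  define Q where "Q k = cell {..<m} p (\<lambda>i. b i - \<epsilon> k ^ Suc i) (\<lambda>_. {0..})" for k
  let ?v = "\<lambda>k. extended (Q k) (\<lambda>x. y' k \<bullet> x + s)"
  have Qiff: "x \<in> Q k \<longleftrightarrow> (\<forall>i<m. b i - \<epsilon> k ^ Suc i \<le> p i \<bullet> x)" for x k
    by (auto simp: Q_def cell_def)
  have lt1: "\<epsilon> k < 1" for k
  proof -
    have "1 / (real k + 1) \<le> 1" by simp
    then show ?thesis using \<epsilon>(2)[of k] by linarith
  qed
  have eps_pow: "0 < \<epsilon> k ^ Suc i" "\<epsilon> k ^ Suc i \<le> \<epsilon> k" for k i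
  proof -
    have "\<epsilon> k ^ i \<le> 1" using \<epsilon>(1)[of k] lt1[of k] by (intro power_le_one) auto
    then show "\<epsilon> k ^ Suc i \<le> \<epsilon> k" using \<epsilon>(1)[of k] by simp
  qed (use \<epsilon>(1) in simp)
  have QQ: "?Q \<subseteq> Q k" for k
  proof
    fix x assume "x \<in> ?Q"
    then have "b i \<le> p i \<bullet> x" if "i < m" for i using that by blast
    then have "b i - \<epsilon> k ^ Suc i \<le> p i \<bullet> x" if "i < m" for i
      using that eps_pow(1)[of k i] by (smt (verit))
    then show "x \<in> Q k" unfolding Qiff by blast
  qed
  have Qb: "bounded (Q k)" for k
  proof (rule bounded_subset[OF bd])
    show "Q k \<subseteq> {x. \<forall>i<m. b i - 1 \<le> p i \<bullet> x}"
    proof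
      fix x assume x: "x \<in> Q k"
      have "b i - 1 \<le> p i \<bullet> x" if "i < m" for i
      proof -
        have "b i - \<epsilon> k ^ Suc i \<le> p i \<bullet> x" using x that unfolding Qiff by blast
        then show ?thesis using eps_pow(2)[of k i] lt1[of k] by linarith
      qed
      then show "x \<in> {x. \<forall>i<m. b i - 1 \<le> p i \<bullet> x}" by blast
    qed
  qed
  have Qbd: "bounded {x\<in>Q k. v \<bullet> x + c \<le> t}" for k v c t
    by (rule bounded_subset[OF Qb[of k]]) auto
  have sc: "sign_cond {0..}" by (simp add: sign_cond_def)
  have Q: "closed (Q k)" "convex (Q k)" "Q k \<noteq> {}" for k
    using QQ[of k] ne unfolding Q_def by (auto intro!: cell_closed cell_convex sc)
  have mem: "extended (Q k) (\<lambda>x. v \<bullet> x + s) \<in> conv_coe" for k v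
    by (rule extended_affine_conv_coe[OF Q Qbd])
  have "closed ?Q" "convex ?Q"
  proof -
    have "?Q = cell {..<m} p b (\<lambda>_. {0..})" by (auto simp: cell_def)
    then show "closed ?Q" "convex ?Q" by (auto intro!: cell_closed cell_convex sc)
  qed
  then have memQ: "extended ?Q (\<lambda>x. y \<bullet> x + s) \<in> conv_coe"
    by (rule extended_affine_conv_coe[OF _ _ ne bounded_subset[OF Qb[of 0]]]) (use QQ in auto)
  have zero: "Z (?v k) = 0" for k
    unfolding Q_def
  proof (rule admissible_generic_cell[OF Z van])
    show "y' k \<notin> span (p ` I)" if "I \<subseteq> {..<m}" "card I < CARD('n)" for I
      using y'(2)[OF that(1)] that(2) by simp
    show "bounded {x \<in> cell {..<m} p (\<lambda>i. b i - \<epsilon> k ^ Suc i) (\<lambda>_. {0..}). y' k \<bullet> x \<le> t}" for t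
      using Qbd[of k "y' k" 0 t] by (simp add: Q_def)
    show "cell {..<m} p (\<lambda>i. b i - \<epsilon> k ^ Suc i) (\<lambda>_. {0..}) \<noteq> {}"
      using Q(3) by (simp add: Q_def)
  qed (use \<epsilon>(3) sc in auto)
  have lim: "(\<lambda>k. 1 / (real k + 1)) \<longlonglongrightarrow> 0"
    using LIMSEQ_inverse_real_of_nat by (simp add: inverse_eq_divide add.commute)
  have small: "\<forall>\<^sub>F k in sequentially. \<epsilon> k < d \<and> (\<forall>x. norm x \<le> r \<longrightarrow> \<bar>y' k \<bullet> x - y \<bullet> x\<bar> < d)" if d: "0 < d" "0 < r" for d r
  proof -
    have "\<forall>\<^sub>F k in sequentially. 1 / (real k + 1) < min d (d / r)"
      using d by (intro order_tendstoD[OF lim]) auto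
    then show ?thesis
    proof eventually_elim
      case (elim k)
      have "\<bar>y' k \<bullet> x - y \<bullet> x\<bar> < d" if x: "norm x \<le> r" for x
      proof -
        have "\<bar>y' k \<bullet> x - y \<bullet> x\<bar> = \<bar>(y' k - y) \<bullet> x\<bar>" by (simp add: inner_diff_left)
        also have "\<dots> \<le> norm (y' k - y) * norm x" by (rule Cauchy_Schwarz_ineq2)
        also have "\<dots> \<le> norm (y' k - y) * r" using x by (rule mult_left_mono) simp
        also have "\<dots> < d / r * r"
          using y'(1)[of k] elim d by (intro mult_strict_right_mono) (auto simp: dist_norm norm_minus_commute)
        finally show ?thesis using d by simp
      qed
      then show ?case using elim \<epsilon>(2)[of k] by auto
    qed
  qed
  have "epi_converges ?v (extended ?Q (\<lambda>x. y \<bullet> x + s))"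
  proof (rule epi_convergesI[OF mem memQ])
    fix x t assume t: "ereal t < extended ?Q (\<lambda>x. y \<bullet> x + s) x"
    show "\<exists>N. open N \<and> x \<in> N \<and> (\<forall>\<^sub>F k in sequentially. \<forall>z\<in>N. ereal t < ?v k z)"
    proof (cases "x \<in> ?Q")
      case True
      define d where "d = (y \<bullet> x + s - t) / 2"
      have d: "0 < d" "t + d < y \<bullet> x + s" using t True by (auto simp: extended_def d_def field_simps)
      let ?N = "{z. t + d < y \<bullet> z + s} \<inter> {z. norm z < norm x + 1}"
      have "open ?N" by (intro open_Int open_Collect_less continuous_intros)
      moreover have "x \<in> ?N" using d by simp
      moreover have "\<forall>\<^sub>F k in sequentially. \<forall>z\<in>?N. ereal t < ?v k z"
        using small[OF d(1), of "norm x + 1"]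
      proof (rule eventually_mono)
        show "0 < norm x + 1" by (simp add: add_nonneg_pos)
        fix k assume k: "\<epsilon> k < d \<and> (\<forall>z. norm z \<le> norm x + 1 \<longrightarrow> \<bar>y' k \<bullet> z - y \<bullet> z\<bar> < d)"
        show "\<forall>z\<in>?N. ereal t < ?v k z"
        proof
          fix z assume z: "z \<in> ?N"
          then have "\<bar>y' k \<bullet> z - y \<bullet> z\<bar> < d" using k by auto
          then have "t < y' k \<bullet> z + s" using z by auto
          then show "ereal t < ?v k z" by (simp add: extended_def)
        qed
      qed
      ultimately show ?thesis by blast
    next
      case False
      then obtain i where i: "i < m" "p i \<bullet> x < b i" by (auto simp: not_le)
      define d where "d = (b i - p i \<bullet> x) / 2"
      have d: "0 < d" "p i \<bullet> x < b i - d" using i by (auto simp: d_def field_simps)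
      have "open {z. p i \<bullet> z < b i - d}" by (intro open_Collect_less continuous_intros)
      moreover have "\<forall>\<^sub>F k in sequentially. \<forall>z\<in>{z. p i \<bullet> z < b i - d}. ereal t < ?v k z"
        using small[OF d(1) zero_less_one]
      proof eventually_elim
        case (elim k)
        have "z \<notin> Q k" if "p i \<bullet> z < b i - d" for z
        proof
          assume "z \<in> Q k"
          then have "b i - \<epsilon> k ^ Suc i \<le> p i \<bullet> z" using i(1) unfolding Qiff by blast
          then show False using that eps_pow(2)[of k i] elim by linarith
        qed
        then show ?case by (simp add: extended_def)
      qed
      ultimately show ?thesis using d(2) by blast
    qed
  next
    fix x t and e :: real assume t: "extended ?Q (\<lambda>x. y \<bullet> x + s) x < ereal t" and e: "0 < e"
    then have x: "x \<in> ?Q" by (auto simp: extended_def split: if_splits)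
    define d where "d = t - (y \<bullet> x + s)"
    have d: "0 < d" using t x by (simp add: extended_def d_def)
    have "0 < norm x + 1" by (simp add: add_nonneg_pos)
    then have "\<forall>\<^sub>F k in sequentially. \<epsilon> k < d \<and> (\<forall>z. norm z \<le> norm x + 1 \<longrightarrow> \<bar>y' k \<bullet> z - y \<bullet> z\<bar> < d)"
      by (rule small[OF d])
    then show "\<forall>\<^sub>F k in sequentially. \<exists>z\<in>ball x e. ?v k z \<le> ereal t"
    proof eventually_elim
      case (elim k)
      then have "\<bar>y' k \<bullet> x - y \<bullet> x\<bar> < d" by simp
      then have "y' k \<bullet> x + s \<le> t" by (simp add: d_def)
      moreover have "x \<in> Q k" using x QQ by blast
      ultimately show ?case using e by (intro bexI[of _ x]) (auto simp: extended_def)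
    qed
  qed
  from admissible_tendsto[OF Z mem memQ this]
  show ?thesis by (simp add: zero LIMSEQ_const_iff)
qed

text \<open>The constraints of a cube around \<open>K\<close> are added to those of \<open>K\<close>, so that moving the offsets keeps the set
bounded.\<close>

lemma admissible_polytope:
  fixes K :: "(real^'n) set"
  assumes Z: "admissible Z"
    and van: "vanishes_on_cones Z"
    and K: "polytope K" "K \<noteq> {}"
  shows "Z (extended K (\<lambda>x. y \<bullet> x + s)) = 0"
proof -
  have "polyhedron K" "bounded K" using K(1) by (simp_all add: polytope_eq_bounded_polyhedron)
  then obtain F where F: "finite F" "K = \<Inter> F" and hs: "\<forall>h\<in>F. \<exists>a b. a \<noteq> 0 \<and> h = {x. a \<bullet> x \<le> b}"
    unfolding polyhedron_def by (elim exE conjE)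
  have "\<forall>h\<in>F. \<exists>g. h = {x. fst g \<bullet> x \<le> snd g}"
  proof
    fix h assume "h \<in> F"
    then obtain a b where "h = {x. a \<bullet> x \<le> b}" using hs by blast
    then show "\<exists>g. h = {x. fst g \<bullet> x \<le> snd g}" by (intro exI[of _ "(a, b)"]) simp
  qed
  from bchoice[OF this] obtain g where g: "\<forall>h\<in>F. h = {x. fst (g h) \<bullet> x \<le> snd (g h)}" ..
  define a c where "a h = fst (g h)" and "c h = snd (g h)" for h
  have ac: "x \<in> h \<longleftrightarrow> a h \<bullet> x \<le> c h" if "h \<in> F" for h x
    using arg_cong[OF bspec[OF g that], of "\<lambda>S. x \<in> S"] by (simp add: a_def c_def)
  obtain R where R: "\<And>x. x \<in> K \<Longrightarrow> norm x \<le> R" using \<open>bounded K\<close> unfolding bounded_iff by blast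
  define G where "G = (\<lambda>h. (- a h, - c h)) ` F \<union> (\<lambda>e. (e, - R)) ` Basis \<union> (\<lambda>e. (- e, - R)) ` Basis"
  have finG: "finite G" using F(1) by (simp add: G_def)
  have KG: "K = {x. \<forall>g\<in>G. snd g \<le> fst g \<bullet> x}"
  proof
    show "K \<subseteq> {x. \<forall>g\<in>G. snd g \<le> fst g \<bullet> x}"
    proof
      fix x assume x: "x \<in> K"
      have 1: "a h \<bullet> x \<le> c h" if "h \<in> F" for h using x F(2) ac[OF that, of x] that by simp
      have 2: "\<bar>x \<bullet> e\<bar> \<le> R" if "e \<in> Basis" for e
        using R[OF x] Basis_le_norm[OF that, of x] by linarith
      have 3: "- R \<le> e \<bullet> x" "e \<bullet> x \<le> R" if "e \<in> Basis" for e
        using 2[OF that] by (simp_all add: inner_commute abs_le_iff)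
      show "x \<in> {x. \<forall>g\<in>G. snd g \<le> fst g \<bullet> x}" using 1 3 by (simp add: G_def ball_Un)
    qed
    show "{x. \<forall>g\<in>G. snd g \<le> fst g \<bullet> x} \<subseteq> K"
    proof
      fix x assume "x \<in> {x. \<forall>g\<in>G. snd g \<le> fst g \<bullet> x}"
      then have xG: "\<forall>g\<in>G. snd g \<le> fst g \<bullet> x" by blast
      have "a h \<bullet> x \<le> c h" if "h \<in> F" for h
      proof -
        have "(- a h, - c h) \<in> G" using that by (simp add: G_def)
        from bspec[OF xG this] show ?thesis by simp
      qed
      then have "x \<in> h" if "h \<in> F" for h using ac[OF that, of x] that by simp
      then show "x \<in> K" using F(2) by blast
    qed
  qed
  obtain h where h: "bij_betw h {0..<card G} G" using ex_bij_betw_nat_finite[OF finG] by blast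
  define p b where "p = fst \<circ> h" and "b = snd \<circ> h"
  have Gall: "(\<forall>g\<in>G. P g) \<longleftrightarrow> (\<forall>i<card G. P (h i))" for P
  proof -
    have "G = h ` {0..<card G}" using h by (simp add: bij_betw_def)
    then have "(\<forall>g\<in>G. P g) \<longleftrightarrow> (\<forall>g\<in>h ` {0..<card G}. P g)" by simp
    then show ?thesis by auto
  qed
  have Kp: "K = {x. \<forall>i<card G. b i \<le> p i \<bullet> x}" unfolding KG Gall p_def b_def by simp
  have "bounded {x. \<forall>i<card G. b i - 1 \<le> p i \<bullet> x}"
    unfolding bounded_iff
  proof (intro exI ballI)
    fix x assume "x \<in> {x. \<forall>i<card G. b i - 1 \<le> p i \<bullet> x}"
    then have x: "\<forall>g\<in>G. snd g - 1 \<le> fst g \<bullet> x" unfolding Gall p_def b_def by simp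
    have "\<bar>x \<bullet> e\<bar> \<le> R + 1" if e: "e \<in> Basis" for e
    proof -
      have "(e, - R) \<in> G" "(- e, - R) \<in> G" using e by (simp_all add: G_def)
      from this[THEN bspec[OF x]] have "- R - 1 \<le> e \<bullet> x" "- R - 1 \<le> - (e \<bullet> x)" by simp_all
      then show ?thesis by (simp add: inner_commute abs_le_iff)
    qed
    then have "(\<Sum>e\<in>Basis. \<bar>x \<bullet> e\<bar>) \<le> (\<Sum>e\<in>(Basis :: (real^'n) set). R + 1)" by (rule sum_mono)
    then show "norm x \<le> (\<Sum>e\<in>(Basis :: (real^'n) set). R + 1)" using norm_le_l1[of x] by linarith
  qed
  from admissible_halfspace_polytope[OF Z van this] show ?thesis using K(2) unfolding Kp by blast
qed

text \<open>The indices run from \<open>0\<close> to \<open>k\<close>, so that the maximum is never over an empty set.\<close>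

primrec max_affine :: "(nat \<Rightarrow> 'a::real_inner \<times> real) \<Rightarrow> nat \<Rightarrow> 'a \<Rightarrow> real" where
  "max_affine \<alpha> 0 x = fst (\<alpha> 0) \<bullet> x + snd (\<alpha> 0)"
| "max_affine \<alpha> (Suc k) x = max (max_affine \<alpha> k x) (fst (\<alpha> (Suc k)) \<bullet> x + snd (\<alpha> (Suc k)))"

lemma max_affine_ge: "j \<le> k \<Longrightarrow> fst (\<alpha> j) \<bullet> x + snd (\<alpha> j) \<le> max_affine \<alpha> k x"
proof (induction k)
  case (Suc k)
  then show ?case by (cases "j = Suc k") (auto simp: le_max_iff_disj)
qed simp

lemma max_affine_attained: "\<exists>j\<le>k. max_affine \<alpha> k x = fst (\<alpha> j) \<bullet> x + snd (\<alpha> j)"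
proof (induction k)
  case (Suc k)
  then obtain j where j: "j \<le> k" "max_affine \<alpha> k x = fst (\<alpha> j) \<bullet> x + snd (\<alpha> j)" by blast
  show ?case
  proof (cases "max_affine \<alpha> k x \<le> fst (\<alpha> (Suc k)) \<bullet> x + snd (\<alpha> (Suc k))")
    case True
    then show ?thesis by (intro exI[of _ "Suc k"]) simp
  next
    case False
    then show ?thesis using j by (intro exI[of _ j]) simp
  qed
qed simp

lemma continuous_on_max_affine: "continuous_on K (max_affine \<alpha> k)"
proof (induction k)
  case 0
  have "continuous_on K (\<lambda>x. fst (\<alpha> 0) \<bullet> x + snd (\<alpha> 0))" by (intro continuous_intros)
  then show ?case by simp
next
  case (Suc k)
  have "continuous_on K (\<lambda>x. max (max_affine \<alpha> k x) (fst (\<alpha> (Suc k)) \<bullet> x + snd (\<alpha> (Suc k))))"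
    by (intro continuous_intros Suc)
  then show ?case by simp
qed

lemma convex_on_max_affine:
  fixes K :: "'a::real_inner set"
  assumes "convex K" shows "convex_on K (max_affine \<alpha> k)"
proof (rule convex_onI[OF _ assms])
  fix t :: real and x y :: 'a assume t: "0 < t" "t < 1"
  let ?z = "(1 - t) *\<^sub>R x + t *\<^sub>R y"
  obtain j where j: "j \<le> k" "max_affine \<alpha> k ?z = fst (\<alpha> j) \<bullet> ?z + snd (\<alpha> j)"
    using max_affine_attained by blast
  have "fst (\<alpha> j) \<bullet> ?z + snd (\<alpha> j)
      = (1 - t) * (fst (\<alpha> j) \<bullet> x + snd (\<alpha> j)) + t * (fst (\<alpha> j) \<bullet> y + snd (\<alpha> j))"
    unfolding inner_add_right inner_scaleR_right by algebra
  also have "\<dots> \<le> (1 - t) * max_affine \<alpha> k x + t * max_affine \<alpha> k y"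
    using t max_affine_ge[OF j(1)] by (intro add_mono mult_left_mono) auto
  finally show "max_affine \<alpha> k ?z \<le> (1 - t) * max_affine \<alpha> k x + t * max_affine \<alpha> k y" using j by simp
qed

lemma total_preorder_has_max:
  assumes "\<And>i j. i \<le> k \<Longrightarrow> j \<le> k \<Longrightarrow> r i j \<or> r j i" "\<And>i j l. r i j \<Longrightarrow> r j l \<Longrightarrow> r i l"
  shows "\<exists>j\<le>(k::nat). \<forall>i\<le>k. r i j"
  using assms(1)
proof (induction k)
  case 0
  then show ?case by auto
next
  case (Suc k)
  then have "\<exists>j\<le>k. \<forall>i\<le>k. r i j" by simp
  then obtain j where j: "j \<le> k" "\<And>i. i \<le> k \<Longrightarrow> r i j" by blast
  have "r j (Suc k) \<or> r (Suc k) j" "r (Suc k) (Suc k)" using Suc.prems[of j "Suc k"] Suc.prems[of "Suc k" "Suc k"] j(1) by auto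
  then show ?case
  proof (elim disjE)
    assume *: "r (Suc k) (Suc k)" "r j (Suc k)"
    then have "r i (Suc k)" if "i \<le> Suc k" for i
      using that j(2)[of i] assms(2)[of i j "Suc k"] by (cases "i = Suc k") auto
    then show ?thesis by blast
  next
    assume *: "r (Suc k) j"
    then have "r i j" if "i \<le> Suc k" for i using that j(2)[of i] by (cases "i = Suc k") auto
    then show ?thesis using j(1) by (intro exI[of _ j]) auto
  qed
qed

text \<open>The induction is on a set \<open>F\<close> of pairs of indices outside which any two of the affine functions are
already comparable on all of \<open>K\<close>.  If \<open>F\<close> is empty, one of the functions is the largest on \<open>K\<close>.
Otherwise \<open>K\<close> is cut along the hyperplane on which the two functions of a pair agree.\<close>

lemma admissible_polytope_max_affine:
  fixes K :: "(real^'n) set"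
  assumes Z: "admissible Z"
    and van: "vanishes_on_cones Z"
    and K: "polytope K" "K \<noteq> {}"
  shows "Z (extended K (max_affine \<alpha> k)) = 0"
proof -
  define A where "A i x = fst (\<alpha> i) \<bullet> x + snd (\<alpha> i)" for i x
  have main: "Z (extended K (max_affine \<alpha> k)) = 0"
    if "finite F" "polytope K" "K \<noteq> {}"
      "\<And>i j. i \<le> k \<Longrightarrow> j \<le> k \<Longrightarrow> (i, j) \<notin> F \<Longrightarrow> (\<forall>x\<in>K. A i x \<le> A j x) \<or> (\<forall>x\<in>K. A j x \<le> A i x)"
    for F and K :: "(real^'n) set"
    using that
  proof (induction F arbitrary: K rule: finite_induct)
    case empty
    have "\<exists>j\<le>k. \<forall>i\<le>k. \<forall>x\<in>K. A i x \<le> A j x"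
      by (rule total_preorder_has_max) (use empty.prems(3) in \<open>auto intro: order_trans\<close>)
    then obtain j where j: "j \<le> k" "\<And>i x. i \<le> k \<Longrightarrow> x \<in> K \<Longrightarrow> A i x \<le> A j x" by blast
    have "max_affine \<alpha> k x = A j x" if "x \<in> K" for x
    proof -
      obtain i where "i \<le> k" "max_affine \<alpha> k x = A i x"
        using max_affine_attained[of k \<alpha> x] by (auto simp: A_def)
      then show ?thesis using j(2)[of i x] that max_affine_ge[OF j(1), of \<alpha> x] by (simp add: A_def)
    qed
    then have "extended K (max_affine \<alpha> k) = extended K (\<lambda>x. fst (\<alpha> j) \<bullet> x + snd (\<alpha> j))"
      by (auto simp: extended_def A_def)
    then show ?case using admissible_polytope[OF Z van empty.prems(1,2)] by simp
  next
    case (insert ij F)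
    obtain i j where ij: "ij = (i, j)" by force
    let ?g = "fst (\<alpha> i) - fst (\<alpha> j)" and ?c = "snd (\<alpha> j) - snd (\<alpha> i)"
    have le: "A i x \<le> A j x \<longleftrightarrow> ?g \<bullet> x \<le> ?c" and ge: "A j x \<le> A i x \<longleftrightarrow> ?c \<le> ?g \<bullet> x" for x
      by (auto simp: A_def inner_diff_left)
    let ?K1 = "K \<inter> {x. ?g \<bullet> x \<le> ?c}" and ?K2 = "K \<inter> {x. ?c \<le> ?g \<bullet> x}"
    have poly: "polytope ?K1" "polytope ?K2" "polytope (?K1 \<inter> ?K2)"
    proof -
      show 1: "polytope ?K1" by (rule polytope_Int_polyhedron[OF insert.prems(1) polyhedron_halfspace_le])
      show 2: "polytope ?K2" by (rule polytope_Int_polyhedron[OF insert.prems(1) polyhedron_halfspace_ge])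
      show "polytope (?K1 \<inter> ?K2)" by (rule polytope_Int[OF 1 2])
    qed
    have step: "Z (extended K' (max_affine \<alpha> k)) = 0"
      if K': "polytope K'" "K' \<noteq> {}" "K' \<subseteq> K" "K' \<subseteq> ?K1 \<or> K' \<subseteq> ?K2" for K'
    proof (rule insert.IH[OF K'(1,2)])
      fix i' j' assume i'j': "i' \<le> k" "j' \<le> k" "(i', j') \<notin> F"
      show "(\<forall>x\<in>K'. A i' x \<le> A j' x) \<or> (\<forall>x\<in>K'. A j' x \<le> A i' x)"
      proof (cases "(i', j') = ij")
        case True
        then show ?thesis using K'(4) ij le ge by auto
      next
        case False
        then show ?thesis using insert.prems(3)[OF i'j'(1,2)] i'j'(3) K'(3) by blast
      qed
    qed
    show ?case
    proof (cases "?K1 = {} \<or> ?K2 = {}")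
      case True
      then have "K \<subseteq> ?K1 \<or> K \<subseteq> ?K2" by auto
      then show ?thesis using step[OF insert.prems(1,2)] by simp
    next
      case False
      then obtain x1 x2 where x: "x1 \<in> ?K1" "x2 \<in> ?K2" by blast
      have cK: "convex K" "compact K" using insert.prems(1) by (simp_all add: polytope_imp_convex polytope_imp_compact)
      obtain w where "w \<in> K" "?g \<bullet> w = ?c"
        using connected_ivt_hyperplane[OF convex_connected[OF cK(1)], of x1 x2 ?g ?c] x by blast
      then have ne: "?K1 \<inter> ?K2 \<noteq> {}" by force
      have "Z (extended ?K1 (max_affine \<alpha> k)) + Z (extended ?K2 (max_affine \<alpha> k))
          = Z (extended K (max_affine \<alpha> k)) + Z (extended (?K1 \<inter> ?K2) (max_affine \<alpha> k))"
      proof (rule admissible_cut[OF Z])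
        show "bounded {x\<in>K. max_affine \<alpha> k x \<le> t}" for t
          by (rule bounded_subset[OF compact_imp_bounded[OF cK(2)]]) auto
        show "closed ?K1" "closed ?K2" "convex ?K1" "convex ?K2"
          using poly by (simp_all add: polytope_imp_closed polytope_imp_convex)
        show "?K1 \<union> ?K2 = K" by auto
      qed (intro ne convex_on_max_affine continuous_on_max_affine cK)+
      moreover have "Z (extended ?K1 (max_affine \<alpha> k)) = 0" by (rule step[OF poly(1)]) (use False in blast)+
      moreover have "Z (extended ?K2 (max_affine \<alpha> k)) = 0" by (rule step[OF poly(2)]) (use False in blast)+
      moreover have "Z (extended (?K1 \<inter> ?K2) (max_affine \<alpha> k)) = 0" by (rule step[OF poly(3) ne]) blast+
      ultimately show ?thesis by simp
    qed
  qed
  show ?thesis by (rule main[OF _ K, of "{..k} \<times> {..k}"]) auto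
qed

section \<open>Approximation by piecewise affine functions\<close>

lemma epigraph_closed:
  assumes "u \<in> conv_coe" shows "closed {(z, r). u z \<le> ereal r}"
proof -
  have "open {(z, r). ereal r < u z}"
  proof (subst open_subopen, clarify)
    fix z r assume "ereal r < u z"
    then obtain q where q: "ereal r < ereal q" "ereal q < u z" using ereal_dense2 by blast
    have "open ({z. ereal q < u z} \<times> {..<q})"
      using assms by (intro open_Times lsc_open_superlevel) (auto simp: conv_coe_def)
    moreover have "{z. ereal q < u z} \<times> {..<q} \<subseteq> {(z, r). ereal r < u z}"
      by (auto intro: less_trans[of _ "ereal q"])
    ultimately show "\<exists>T. open T \<and> (z, r) \<in> T \<and> T \<subseteq> {(z, r). ereal r < u z}"
      using q by (intro exI[of _ "{z. ereal q < u z} \<times> {..<q}"]) auto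
  qed
  moreover have "{(z, r). u z \<le> ereal r} = - {(z, r). ereal r < u z}" by auto
  ultimately show ?thesis by (metis closed_Compl)
qed

lemma epigraph_convex:
  assumes "u \<in> conv_coe" shows "convex {(z, r). u z \<le> ereal r}"
  unfolding convex_alt
proof (intro ballI allI impI)
  fix v w and l :: real
  assume v: "v \<in> {(z, r). u z \<le> ereal r}" and w: "w \<in> {(z, r). u z \<le> ereal r}" and l: "0 \<le> l \<and> l \<le> 1"
  obtain x a y b where vw: "v = (x, a)" "w = (y, b)" by (cases v, cases w)
  show "(1 - l) *\<^sub>R v + l *\<^sub>R w \<in> {(z, r). u z \<le> ereal r}"
  proof (cases "l = 0 \<or> l = 1")
    case False
    with l have l: "0 < l" "l < 1" by auto
    have "u x \<le> ereal a" "u y \<le> ereal b" using v w vw by auto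
    moreover have "u x \<noteq> -\<infinity>" "u y \<noteq> -\<infinity>" using assms by (auto simp: conv_coe_def)
    ultimately obtain a' b' where ab: "u x = ereal a'" "a' \<le> a" "u y = ereal b'" "b' \<le> b"
      by (cases "u x"; cases "u y") auto
    have "u ((1 - l) *\<^sub>R x + l *\<^sub>R y) \<le> ereal (1 - l) * u x + ereal l * u y"
      using assms l unfolding conv_coe_def convex_ereal_def by auto
    also have "\<dots> = ereal ((1 - l) * a' + l * b')" by (simp add: ab)
    also have "\<dots> \<le> ereal ((1 - l) * a + l * b)"
      using ab l by (simp add: add_mono mult_left_mono)
    finally show ?thesis by (simp add: vw)
  qed (use v w in auto)
qed

text \<open>A hyperplane separates \<open>(x, t)\<close> from the epigraph.  If it is vertical, i.e. \<open>q = 0\<close>, a large multiple of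
the separating functional is added to the constant minorant \<open>min u\<close>.\<close>

lemma affine_minorant:
  fixes u :: "'a::euclidean_space \<Rightarrow> ereal"
  assumes u: "u \<in> conv_coe" and t: "ereal t < u x"
  obtains a c where "\<And>z. ereal (a \<bullet> z + c) \<le> u z" "t < a \<bullet> x + c"
proof -
  let ?E = "{(z, r). u z \<le> ereal r}"
  have "(x, t) \<notin> ?E" using t by auto
  from separating_hyperplane_closed_point[OF epigraph_convex[OF u] epigraph_closed[OF u] this]
  obtain w \<beta> where w: "w \<bullet> (x, t) < \<beta>" "\<forall>v\<in>?E. \<beta> < w \<bullet> v" by blast
  obtain p q where pq: "w = (p, q)" by (cases w)
  have sep: "p \<bullet> x + q * t < \<beta>" "\<And>z r. u z \<le> ereal r \<Longrightarrow> \<beta> < p \<bullet> z + q * r"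
    using w by (auto simp: pq)
  obtain m x0 where m: "min_value u = ereal m" "u x0 = ereal m" "\<And>y. ereal m \<le> u y"
    using min_value_real[OF u] by blast
  \<comment> \<open>The epigraph is unbounded upwards.\<close>
  have "0 \<le> q"
  proof (rule ccontr)
    assume "\<not> 0 \<le> q"
    then have q: "q < 0" by simp
    define r where "r = max m ((\<beta> - p \<bullet> x0) / q)"
    have "\<beta> < p \<bullet> x0 + q * r" using m by (intro sep(2)) (simp add: r_def)
    moreover have "q * r \<le> q * ((\<beta> - p \<bullet> x0) / q)" using q by (intro mult_left_mono_neg) (auto simp: r_def)
    ultimately show False using q by simp
  qed
  show ?thesis
  proof (cases "q = 0")
    case False
    with \<open>0 \<le> q\<close> have q: "0 < q" by simp
    show ?thesis
    proof (rule that[of "(- 1 / q) *\<^sub>R p" "\<beta> / q"])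
      show "ereal ((- 1 / q) *\<^sub>R p \<bullet> z + \<beta> / q) \<le> u z" for z
      proof (cases "u z")
        case (real r)
        then have "\<beta> < p \<bullet> z + q * r" by (intro sep(2)) simp
        then show ?thesis using q real by (simp add: field_simps)
      qed (use u in \<open>auto simp: conv_coe_def\<close>)
      show "t < (- 1 / q) *\<^sub>R p \<bullet> x + \<beta> / q" using sep(1) q by (simp add: field_simps)
    qed
  next
    case True
    then have px: "p \<bullet> x < \<beta>" using sep(1) by simp
    define l where "l = (\<bar>t - m\<bar> + 1) / (\<beta> - p \<bullet> x)"
    have l: "0 < l" "l * (\<beta> - p \<bullet> x) = \<bar>t - m\<bar> + 1" using px by (auto simp: l_def)
    show ?thesis
    proof (rule that[of "(- l) *\<^sub>R p" "m + l * \<beta>"])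
      show "ereal ((- l) *\<^sub>R p \<bullet> z + (m + l * \<beta>)) \<le> u z" for z
      proof (cases "u z = \<infinity>")
        case False
        then obtain r where "u z = ereal r" using u by (cases "u z") (auto simp: conv_coe_def)
        then have "\<beta> < p \<bullet> z" using sep(2)[of z r] True by simp
        then have "l * (\<beta> - p \<bullet> z) \<le> 0" using l(1) by (intro mult_nonneg_nonpos) auto
        then have "(- l) *\<^sub>R p \<bullet> z + (m + l * \<beta>) \<le> m" by (simp add: algebra_simps)
        then show ?thesis using m(3)[of z] by (meson ereal_less_eq(3) order_trans)
      qed simp
      show "t < (- l) *\<^sub>R p \<bullet> x + (m + l * \<beta>)" using l(2) by (simp add: algebra_simps)
    qed
  qed
qed

text \<open>For each rational \<open>q\<close> the set \<open>{u > q}\<close> is covered by the open half-spaces on which some minorant exceeds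
\<open>q\<close>; by the Lindelof property countably many of them suffice.\<close>

lemma countable_affine_minorants:
  fixes u :: "'a::euclidean_space \<Rightarrow> ereal"
  assumes u: "u \<in> conv_coe"
  shows "\<exists>\<alpha> :: nat \<Rightarrow> 'a \<times> real. (\<forall>j z. ereal (fst (\<alpha> j) \<bullet> z + snd (\<alpha> j)) \<le> u z) \<and>
    (\<forall>x t. ereal t < u x \<longrightarrow> (\<exists>j. t < fst (\<alpha> j) \<bullet> x + snd (\<alpha> j)))"
proof -
  define \<A> where "\<A> = {g. \<forall>z. ereal (fst g \<bullet> z + snd g) \<le> u z}"
  define H where "H t g = {x. t < fst g \<bullet> x + snd g}" for t :: real and g :: "'a \<times> real"
  have "\<forall>t. \<exists>\<B>. countable \<B> \<and> \<B> \<subseteq> \<A> \<and> (\<Union>g\<in>\<B>. H t g) = (\<Union>g\<in>\<A>. H t g)"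
  proof
    fix t
    have op: "open S" if "S \<in> H t ` \<A>" for S
      using that by (auto simp: H_def intro!: open_Collect_less continuous_intros)
    obtain F where F: "F \<subseteq> H t ` \<A>" "countable F" "\<Union> F = \<Union> (H t ` \<A>)"
      by (rule Lindelof[OF op])
    obtain \<B> where \<B>: "countable \<B> \<and> \<B> \<subseteq> \<A> \<and> F = H t ` \<B>"
      using countable_subset_image[THEN iffD1, OF conjI[OF F(2,1)]] ..
    then have "(\<Union>g\<in>\<B>. H t g) = (\<Union>g\<in>\<A>. H t g)" using F(3) by simp
    with \<B> show "\<exists>\<B>. countable \<B> \<and> \<B> \<subseteq> \<A> \<and> (\<Union>g\<in>\<B>. H t g) = (\<Union>g\<in>\<A>. H t g)"
      by (intro exI[of _ \<B>] conjI) simp_all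
  qed
  from choice[OF this] obtain \<B> where
    \<B>': "\<forall>t. countable (\<B> t) \<and> \<B> t \<subseteq> \<A> \<and> (\<Union>g\<in>\<B> t. H t g) = (\<Union>g\<in>\<A>. H t g)" ..
  have \<B>: "countable (\<B> t)" "\<B> t \<subseteq> \<A>" "(\<Union>g\<in>\<B> t. H t g) = (\<Union>g\<in>\<A>. H t g)" for t
    using spec[OF \<B>', of t] by simp_all
  define C where "C = (\<Union>t\<in>\<rat>. \<B> t)"
  have C: "countable C" "C \<subseteq> \<A>"
  proof -
    show "countable C" unfolding C_def by (rule countable_UN[OF countable_rat \<B>(1)])
    show "C \<subseteq> \<A>" unfolding C_def by (rule UN_least) (rule \<B>(2))
  qed
  have ex: "\<exists>g\<in>C. t < fst g \<bullet> x + snd g" if t: "ereal t < u x" for x t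
  proof -
    obtain s where s: "ereal t < ereal s" "ereal s < u x" using ereal_dense2[OF t] by blast
    then obtain q where q: "q \<in> \<rat>" "t < q" "q < s" using Rats_dense_in_real[of t s] by auto
    have "ereal q < u x" using q(3) s(2) by (meson less_ereal.simps(1) less_trans)
    then obtain a c where ac: "\<And>z. ereal (a \<bullet> z + c) \<le> u z" "q < a \<bullet> x + c"
      by (rule affine_minorant[OF u]) blast
    have "(a, c) \<in> \<A>" using ac(1) by (simp add: \<A>_def)
    moreover have "x \<in> H q (a, c)" using ac(2) by (simp add: H_def)
    ultimately have "x \<in> (\<Union>g\<in>\<A>. H q g)" by blast
    then obtain g where g: "g \<in> \<B> q" "x \<in> H q g" unfolding \<B>(3)[symmetric] by blast
    have "g \<in> C" unfolding C_def using q(1) g(1) by blast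
    moreover have "t < fst g \<bullet> x + snd g" using g(2) q(2) by (simp add: H_def)
    ultimately show ?thesis by blast
  qed
  obtain m x0 where m: "min_value u = ereal m" "u x0 = ereal m" "\<And>y. ereal m \<le> u y"
    using min_value_real[OF u] by blast
  have "C \<noteq> {}" using ex[of "m - 1" x0] m by auto
  then have range: "range (from_nat_into C) = C" using C(1) by (intro range_from_nat_into) auto
  show ?thesis
  proof (intro exI[of _ "from_nat_into C"] conjI allI impI)
    show "ereal (fst (from_nat_into C j) \<bullet> z + snd (from_nat_into C j)) \<le> u z" for j z
      using range C(2) by (auto simp: \<A>_def)
    show "\<exists>j. t < fst (from_nat_into C j) \<bullet> x + snd (from_nat_into C j)" if "ereal t < u x" for x t
      using ex[OF that] range by (metis imageE)
  qed
qed

theorem admissible_vanishes: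
  fixes Z :: "(real^'n \<Rightarrow> ereal) \<Rightarrow> real"
  assumes Z: "admissible Z"
    and van: "vanishes_on_cones Z"
    and u: "u \<in> conv_coe"
  shows "Z u = 0"
proof -
  obtain \<alpha> :: "nat \<Rightarrow> (real^'n) \<times> real" where \<alpha>: "(\<forall>j z. ereal (fst (\<alpha> j) \<bullet> z + snd (\<alpha> j)) \<le> u z) \<and>
    (\<forall>x t. ereal t < u x \<longrightarrow> (\<exists>j. t < fst (\<alpha> j) \<bullet> x + snd (\<alpha> j)))"
    using countable_affine_minorants[OF u] ..
  define K :: "nat \<Rightarrow> (real^'n) set" where "K k = cbox (- (\<chi> i. real k)) (\<chi> i. real k)" for k
  have K: "polytope (K k)" "0 \<in> K k" for k by (auto simp: K_def polytope_interval mem_box_cart)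
  have mem: "extended (K k) (max_affine \<alpha> k) \<in> conv_coe" for k
  proof (rule extended_in_conv_coe)
    show "closed (K k)" "convex (K k)" using K(1) by (simp_all add: polytope_imp_closed polytope_imp_convex)
    then show "convex_on (K k) (max_affine \<alpha> k)" by (intro convex_on_max_affine)
    show "bounded {x\<in>K k. max_affine \<alpha> k x \<le> t}" for t
      by (rule bounded_subset[OF polytope_imp_bounded[OF K(1)[of k]]]) auto
    show "K k \<noteq> {}" using K(2)[of k] by blast
  qed (rule continuous_on_max_affine)
  have "epi_converges (\<lambda>k. extended (K k) (max_affine \<alpha> k)) u"
  proof (rule epi_convergesI[OF mem u])
    fix x t assume "ereal t < u x"
    then obtain j where j: "t < fst (\<alpha> j) \<bullet> x + snd (\<alpha> j)" using \<alpha> by blast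
    let ?N = "{z. t < fst (\<alpha> j) \<bullet> z + snd (\<alpha> j)}"
    have "open ?N" by (intro open_Collect_less continuous_intros)
    moreover have "\<forall>\<^sub>F k in sequentially. \<forall>z\<in>?N. ereal t < extended (K k) (max_affine \<alpha> k) z"
      using eventually_ge_at_top[of j]
    proof eventually_elim
      case (elim k)
      show ?case
      proof
        fix z assume "z \<in> ?N"
        then have "t < max_affine \<alpha> k z" using max_affine_ge[OF elim, of \<alpha> z] by simp
        then show "ereal t < extended (K k) (max_affine \<alpha> k) z" by (simp add: extended_def)
      qed
    qed
    ultimately show "\<exists>N. open N \<and> x \<in> N \<and> (\<forall>\<^sub>F k in sequentially. \<forall>z\<in>N. ereal t < extended (K k) (max_affine \<alpha> k) z)"
      using j by blast
  next
    fix x t and e :: real assume t: "u x < ereal t" and e: "0 < e"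
    show "\<forall>\<^sub>F k in sequentially. \<exists>z\<in>ball x e. extended (K k) (max_affine \<alpha> k) z \<le> ereal t"
      using eventually_ge_at_top[of "nat \<lceil>norm x\<rceil>"]
    proof eventually_elim
      case (elim k)
      then have "norm x \<le> real k" by linarith
      then have "\<bar>x $ i\<bar> \<le> real k" for i using component_le_norm_cart[of x i] by linarith
      then have "x \<in> K k" by (simp add: K_def mem_box_cart abs_le_iff) (meson minus_le_iff)
      moreover obtain j where "max_affine \<alpha> k x = fst (\<alpha> j) \<bullet> x + snd (\<alpha> j)" using max_affine_attained by blast
      then have "ereal (max_affine \<alpha> k x) \<le> u x" using \<alpha> by simp
      then have "ereal (max_affine \<alpha> k x) \<le> ereal t" using t by (meson less_imp_le order_trans)
      ultimately show ?case using e by (intro bexI[of _ x]) (auto simp: extended_def)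
    qed
  qed
  from admissible_tendsto[OF Z mem u this]
  have "(\<lambda>k. Z (extended (K k) (max_affine \<alpha> k))) \<longlonglongrightarrow> Z u" .
  moreover have "Z (extended (K k) (max_affine \<alpha> k)) = 0" for k
    by (rule admissible_polytope_max_affine[OF Z van K(1)]) (use K(2)[of k] in blast)+
  ultimately show ?thesis by (simp add: LIMSEQ_const_iff)
qed

section \<open>The classification\<close>

lemma min_value_orthant_fun: "min_value (orthant_fun J) = 0"
  by (rule min_value_eqI[of _ 0]) (auto simp: orthant_fun_def extended_def intro: sum_nonneg)

lemma integral_orthant_fun_empty: "(\<integral>x. exp_neg (orthant_fun {} x) \<partial>lborel) = (0 :: real)"
proof (rule integral_eq_zero_AE)
  have "AE x in lborel. x \<noteq> (0 :: real^'n)" by (rule AE_lborel_singleton)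
  then show "AE x in lborel. exp_neg (orthant_fun {} (x :: real^'n)) = 0"
  proof eventually_elim
    case (elim x)
    then have "\<exists>i. x $ i \<noteq> 0" by (simp add: vec_eq_iff)
    then have "orthant_fun {} x = \<infinity>" by (auto simp: orthant_fun_def extended_def)
    then show ?case by (simp add: exp_neg_def)
  qed
qed

text \<open>With this the coefficient of the integral can be chosen so that the difference of the two functionals
is zero at the orthant.\<close>

lemma integral_orthant_fun_UNIV: "(\<integral>x. exp_neg (orthant_fun UNIV x) \<partial>lborel) \<noteq> (0 :: real)"
proof
  assume "(\<integral>x. exp_neg (orthant_fun UNIV x) \<partial>(lborel :: (real^'n) measure)) = 0"
  then have "AE x in lborel. exp_neg (orthant_fun UNIV (x :: real^'n)) = 0"
    by (subst (asm) integral_nonneg_eq_0_iff_AE) (auto intro: integrable_exp_neg orthant_fun_conv_coe)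
  then have "AE x in lborel. (x :: real^'n) \<notin> box 0 One"
  proof eventually_elim
    case (elim x)
    show ?case
    proof
      assume "x \<in> box 0 One"
      then have "0 \<le> x $ i" for i by (auto simp: mem_box_cart less_imp_le)
      then show False using elim by (simp add: orthant_fun_def extended_def exp_neg_def)
    qed
  qed
  then have "box 0 One \<in> null_sets (lborel :: (real^'n) measure)"
    by (subst (asm) AE_iff_null_sets[symmetric]) auto
  then have "emeasure (lborel :: (real^'n) measure) (box 0 One) = 0" by auto
  moreover have "emeasure (lborel :: (real^'n) measure) (box 0 One) = 1"
    by (subst emeasure_lborel_box) (auto simp: inner_Basis)
  ultimately show False by simp
qed

theorem theorem7p4:
  fixes Z :: "(real ^ 'n \<Rightarrow> ereal) \<Rightarrow> real"
  assumes "CARD('n) \<ge> 2"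
  shows "epi_continuous Z \<and> SL_invariant Z \<and> translation_invariant Z \<and> valuation Z \<and>
      (\<forall>u\<in>conv_coe. \<forall>t::real. Z (\<lambda>x. u x + ereal t) = exp (- t) * Z u)
    \<longleftrightarrow>
      (\<exists>c\<^sub>0 c\<^sub>n :: real. \<forall>u\<in>conv_coe.
         Z u = c\<^sub>0 * exp_neg (min_value u) + c\<^sub>n * (\<integral>x. exp_neg (u x) \<partial>lborel))"
    (is "?L \<longleftrightarrow> ?R")
proof -
  let ?E = "\<lambda>u :: real^'n \<Rightarrow> ereal. exp_neg (min_value u)"
  let ?I = "\<lambda>u :: real^'n \<Rightarrow> ereal. \<integral>x. exp_neg (u x) \<partial>lborel"
  have Y: "admissible (\<lambda>u. a * ?E u + b * ?I u)" for a b
    by (intro admissible_lincomb admissible_exp_neg_min_value admissible_integral)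
  have L: "?L \<longleftrightarrow> admissible Z" by (simp add: admissible_def exp_homogeneous_def)
  have "?R" if Z: "admissible Z"
  proof -
    define c0 where "c0 = Z (orthant_fun {})"
    define cn where "cn = (Z (orthant_fun UNIV) - c0) / ?I (orthant_fun UNIV)"
    define D where "D u = 1 * Z u + (- 1) * (c0 * ?E u + cn * ?I u)" for u
    have D: "admissible D"
      unfolding D_def by (rule admissible_lincomb[OF Z Y])
    have E: "?E (orthant_fun J) = 1" for J by (simp add: min_value_orthant_fun exp_neg_def)
    have D0: "D (orthant_fun {}) = 0"
      by (simp add: D_def E c0_def integral_orthant_fun_empty)
    have D1: "D (orthant_fun UNIV) = 0"
    proof -
      have "?I (orthant_fun UNIV) \<noteq> 0" by (rule integral_orthant_fun_UNIV)
      then show ?thesis by (simp add: D_def E cn_def)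
    qed
    have "vanishes_on_cones D"
      unfolding vanishes_on_cones_def using admissible_zero_on_cones[OF assms D D0 D1] by blast
    then have "D u = 0" if "u \<in> conv_coe" for u using that by (rule admissible_vanishes[OF D])
    then have "Z u = c0 * ?E u + cn * ?I u" if "u \<in> conv_coe" for u
      using that unfolding D_def by force
    then show ?thesis by (intro exI ballI)
  qed
  moreover have "admissible Z" if ?R
  proof -
    from that obtain c0 cn where "\<forall>u\<in>conv_coe. Z u = c0 * ?E u + cn * ?I u" by (elim exE)
    then show ?thesis by (intro admissible_cong[OF Y[of c0 cn]]) simp
  qed
  ultimately show ?thesis unfolding L by (rule iffI)
qed

end
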